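(* Let $\gamma=[a_1,a_2,a_3,\ldots]\in(0,1/2)\setminus\mathbb Q$ with convergents $p_n/q_n=[a_1,\ldots,a_n]$, let $P_{t_\gamma}$ be the quadratic representative of the class of angle $\gamma$, and set $\Lambda_{\rm rec}=\frac{16e^2}{e-1}$. If $$\sum_{n\ge1}a_{2n+1}(q_{2n}-p_{2n})\Lambda_{\rm rec}^{-q_{2n}}=+\infty,$$ then $P_{t_\gamma}$ does not admit an absolutely continuous (with respect to Lebesgue measure) invariant probability measure.
   Context: $P_t(x)=x^2+t$. Continued fractions: $[a_1,a_2,\ldots]=1/(a_1+1/(a_2+\cdots))$, with $p_0=0,q_0=1,p_1=1,q_1=a_1$, $p_{n+1}=a_{n+1}p_n+p_{n-1}$, $q_{n+1}=a_{n+1}q_n+q_{n-1}$. Kneading map of a unimodal map $f:I\to I$ with turning point $c$ a maximum (continuous, strictly increasing to the left of $c$ and strictly decreasing to the right, $f(\partial I)\subset\partial I$, $c_n=f^n(c)$, $c_2<c<c_1$, $c_2<c_3$): with $[a,b]$ denoting the closed interval with endpoints $a,b$ in either order, let $D_1=[c,c_1]$ and, for $n\ge2$, $D_n=f(D_{n-1})$ if $c\notin D_{n-1}$, $D_n=[c_n,c_1]$ if $c\in D_{n-1}$. An integer $n\ge1$ is a cutting time if $c\in D_n$; cutting times are enumerated as $1=S_0<S_1=2<S_2<\cdots$, consecutive differences of cutting times are cutting times, and the kneading map $Q:\mathbb N\to\mathbb N_0$ is defined by $S_k-S_{k-1}=S_{Q(k)}$. For real $t\in[-2,-1)$, $P_t$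 has a minimum at its turning point $0$; it is regarded as a unimodal map on $[-\beta_t,\beta_t]$, $\beta_t=\frac{1+\sqrt{1-4t}}2$, and its kneading map is by definition that of its maximum-type affine conjugate $x\mapsto -P_t(-x)$. For $\gamma\in(0,1/2)\setminus\mathbb Q$ put $\omega_\gamma=\gamma/(1-\gamma)$ and $Q_\gamma(k)=\lfloor k\omega_\gamma\rfloor-\lfloor(k-1)\omega_\gamma\rfloor$ for $k\ge1$. The quadratic representative $P_{t_\gamma}$ is the map with $t_\gamma$ the unique parameter $t\in[-2,-1]$ such that $P_t$ has kneading map $Q_\gamma$ (existence follows from known fullness of the real quadratic family and admissibility of $Q_\gamma$; uniqueness from known real quadratic rigidity). Standing assumption: $P_{t_\gamma}$ has no attracting or parabolic periodic orbit. *)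

theory Defs
  imports "HOL-Probability.Probability"
begin

section \<open>Continued fractions\<close>

text \<open>Digit sequences are indexed from 1; the value at index 0 is never used.\<close>

fun cf_value :: "nat list \<Rightarrow> real" where
  "cf_value [] = 0"
| "cf_value (d # ds) = 1 / (real d + cf_value ds)"

definition has_cf_expansion :: "real \<Rightarrow> (nat \<Rightarrow> nat) \<Rightarrow> bool" where
  "has_cf_expansion \<gamma> a \<longleftrightarrow>
     (\<forall>n\<ge>1. 1 \<le> a n) \<and> (\<lambda>n. cf_value (map a [1..<Suc n])) \<longlonglongrightarrow> \<gamma>"

fun cf_p :: "(nat \<Rightarrow> nat) \<Rightarrow> nat \<Rightarrow> nat" where
  "cf_p a 0 = 0"
| "cf_p a (Suc 0) = 1"
| "cf_p a (Suc (Suc n)) = a (Suc (Suc n)) * cf_p a (Suc n) + cf_p a n"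

fun cf_q :: "(nat \<Rightarrow> nat) \<Rightarrow> nat \<Rightarrow> nat" where
  "cf_q a 0 = 1"
| "cf_q a (Suc 0) = a 1"
| "cf_q a (Suc (Suc n)) = a (Suc (Suc n)) * cf_q a (Suc n) + cf_q a n"

section \<open>Unimodal maps and kneading maps\<close>

definition unimodal_map :: "real \<Rightarrow> real \<Rightarrow> real \<Rightarrow> (real \<Rightarrow> real) \<Rightarrow> bool" where
  "unimodal_map u v c f \<longleftrightarrow>
     u < c \<and> c < v \<and> f ` {u..v} \<subseteq> {u..v} \<and> continuous_on {u..v} f \<and>
     strict_mono_on {u..c} f \<and> strict_antimono_on {c..v} f \<and> f ` {u, v} \<subseteq> {u, v} \<and>
     (f ^^ 2) c < c \<and> c < f c \<and> (f ^^ 2) c < (f ^^ 3) c"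

text \<open>The sequence of intervals starts at index 1; index 0 is a dummy.\<close>

fun knead_D :: "(real \<Rightarrow> real) \<Rightarrow> real \<Rightarrow> nat \<Rightarrow> real set" where
  "knead_D f c 0 = {}"
| "knead_D f c (Suc 0) = closed_segment c (f c)"
| "knead_D f c (Suc (Suc n)) =
     (if c \<in> knead_D f c (Suc n)
      then closed_segment ((f ^^ Suc (Suc n)) c) (f c)
      else f ` knead_D f c (Suc n))"

definition cutting_time :: "(real \<Rightarrow> real) \<Rightarrow> real \<Rightarrow> nat \<Rightarrow> bool" where
  "cutting_time f c n \<longleftrightarrow> 1 \<le> n \<and> c \<in> knead_D f c n"

text \<open>The kneading map is defined on the positive integers, so the value of \<open>Q\<close> at 0 is
  irrelevant. It takes finite values only, so there must be infinitely many cutting times;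
  their increasing enumeration \<open>S\<close> is then unique.\<close>

definition has_kneading_map ::
  "real \<Rightarrow> real \<Rightarrow> real \<Rightarrow> (real \<Rightarrow> real) \<Rightarrow> (nat \<Rightarrow> nat) \<Rightarrow> bool" where
  "has_kneading_map u v c f Q \<longleftrightarrow> unimodal_map u v c f \<and>
     (\<exists>S :: nat \<Rightarrow> nat. strict_mono S \<and> range S = {n. cutting_time f c n} \<and>
        (\<forall>k\<ge>1. S k - S (k - 1) = S (Q k)))"

section \<open>The real quadratic family\<close>

definition quad :: "real \<Rightarrow> real \<Rightarrow> real" where
  "quad t x = x ^ 2 + t"

definition quad_beta :: "real \<Rightarrow> real" where
  "quad_beta t = (1 + sqrt (1 - 4 * t)) / 2"

definition quad_has_kneading_map :: "real \<Rightarrow> (nat \<Rightarrow> nat) \<Rightarrow> bool" where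
  "quad_has_kneading_map t Q \<longleftrightarrow>
     has_kneading_map (- quad_beta t) (quad_beta t) 0 (\<lambda>x. - quad t (- x)) Q"

text \<open>The unimodality requirement excludes no parameter strictly between \<open>-2\<close> and \<open>-1\<close>.
  At \<open>-1\<close> and \<open>-2\<close> one of the strict inequalities on the critical orbit becomes an equality.\<close>

lemma unimodal_map_quad:
  assumes "-2 < t" "t < -1"
  shows "unimodal_map (- quad_beta t) (quad_beta t) 0 (\<lambda>x. - quad t (- x))"
proof -
  let ?b = "quad_beta t" and ?f = "\<lambda>x. - quad t (- x)"
  have f: "?f x = - x\<^sup>2 - t" for x by (simp add: quad_def)
  have s: "3 > sqrt (1 - 4 * t) \<and> sqrt (1 - 4 * t) > 2"
    using assms real_sqrt_less_mono[of "1 - 4 * t" "3\<^sup>2"] real_sqrt_less_mono[of "2\<^sup>2" "1 - 4 * t"]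
    by auto
  have b2: "?b\<^sup>2 = ?b - t"
    using assms by (simp add: quad_beta_def power2_eq_square field_simps)
  have b: "3 / 2 < ?b" "?b < 2" using s by (auto simp: quad_beta_def)
  have "t \<ge> - ?b"
  proof -
    have "?b * ?b \<le> ?b * 2" using b by (intro mult_left_mono) auto
    then show ?thesis using b2 by (simp add: power2_eq_square)
  qed
  have sq: "x\<^sup>2 \<le> ?b\<^sup>2" if "x \<in> {- ?b..?b}" for x
    using that by (intro abs_le_square_iff[THEN iffD1]) auto
  have "?f x \<in> {- ?b..?b}" if "x \<in> {- ?b..?b}" for x
    using sq[OF that] b2 \<open>t \<ge> - ?b\<close> zero_le_power2[of x] unfolding f atLeastAtMost_iff by linarith
  then have 1: "?f ` {- ?b..?b} \<subseteq> {- ?b..?b}" by blast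
  have 2: "continuous_on {- ?b..?b} ?f" unfolding f by (intro continuous_intros)
  have 3: "strict_mono_on {- ?b..0} ?f"
    unfolding f
  proof (rule strict_mono_onI)
    fix r s assume "r \<in> {- ?b..0}" "s \<in> {- ?b..0}" "r < s"
    then have "(- s)\<^sup>2 < (- r)\<^sup>2" by (intro power_strict_mono) auto
    then show "- r\<^sup>2 - t < - s\<^sup>2 - t" by simp
  qed
  have 4: "strict_antimono_on {0..?b} ?f"
    unfolding f
  proof (rule monotone_onI)
    fix r s assume "r \<in> {0..?b}" "s \<in> {0..?b}" "r < s"
    then have "r\<^sup>2 < s\<^sup>2" by (intro power_strict_mono) auto
    then show "- r\<^sup>2 - t > - s\<^sup>2 - t" by simp
  qed
  have 5: "?f ` {- ?b, ?b} \<subseteq> {- ?b, ?b}" unfolding f using b2 by auto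
  have c2: "(?f ^^ 2) 0 = - t * (t + 1)" and c3: "(?f ^^ 3) 0 = - (t * (t + 1))\<^sup>2 - t"
    unfolding f by (simp_all add: eval_nat_numeral power_mult_distrib algebra_simps)
  have 6: "(?f ^^ 2) 0 < 0" using assms c2 by (simp add: mult_less_0_iff zero_less_mult_iff)
  have "(?f ^^ 3) 0 - (?f ^^ 2) 0 = (- t) ^ 3 * (t + 2)"
    unfolding c2 c3 by (simp add: eval_nat_numeral algebra_simps)
  also have "\<dots> > 0" using assms by (intro mult_pos_pos zero_less_power) auto
  finally have "(?f ^^ 2) 0 < (?f ^^ 3) 0" by simp
  moreover have "0 < ?f 0" unfolding f using assms by simp
  ultimately show ?thesis
    unfolding unimodal_map_def using 1 2 3 4 5 6 b by simp
qed

definition Q_angle :: "real \<Rightarrow> nat \<Rightarrow> nat" where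
  "Q_angle \<gamma> k =
     (let \<omega> = \<gamma> / (1 - \<gamma>) in nat (\<lfloor>real k * \<omega>\<rfloor> - \<lfloor>(real k - 1) * \<omega>\<rfloor>))"

text \<open>There is exactly one such \<open>t\<close> for each irrational \<open>\<gamma>\<close> between 0 and 1/2, by fullness
  and rigidity of the real quadratic family.\<close>

definition quadratic_representative :: "real \<Rightarrow> real \<Rightarrow> bool" where
  "quadratic_representative \<gamma> t \<longleftrightarrow> t \<in> {-2..-1} \<and> quad_has_kneading_map t (Q_angle \<gamma>)"

section \<open>Periodic orbits and invariant measures\<close>

text \<open>It does not matter below whether \<open>n\<close> is the minimal period: passing to a multiple
  replaces the multiplier by a power of itself.\<close>

definition has_attracting_orbit :: "(real \<Rightarrow> real) \<Rightarrow> bool" where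
  "has_attracting_orbit f \<longleftrightarrow>
     (\<exists>x. \<exists>n\<ge>1. (f ^^ n) x = x \<and> \<bar>deriv (f ^^ n) x\<bar> < 1)"

text \<open>Parabolic means that the multiplier is a root of unity; over the reals, 1 or -1.\<close>

definition has_parabolic_orbit :: "(real \<Rightarrow> real) \<Rightarrow> bool" where
  "has_parabolic_orbit f \<longleftrightarrow>
     (\<exists>x. \<exists>n\<ge>1. (f ^^ n) x = x \<and> (\<exists>m\<ge>1. deriv (f ^^ n) x ^ m = 1))"

definition is_acip :: "(real \<Rightarrow> real) \<Rightarrow> real measure \<Rightarrow> bool" where
  "is_acip f \<mu> \<longleftrightarrow>
     prob_space \<mu> \<and> sets \<mu> = sets borel \<and> absolutely_continuous lborel \<mu> \<and> distr \<mu> borel f = \<mu>"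

section \<open>The recurrence constant\<close>

definition Lambda_rec :: real where
  "Lambda_rec = 16 * (exp 1)\<^sup>2 / (exp 1 - 1)"

end

theory Submission
  imports Defs
begin

text \<open>Write \<open>f x = b - x\<^sup>2\<close> with \<open>b = - t\<close>, and \<open>c n\<close> for the critical orbit.

  The kneading map takes only the values 0 and 1. Hence every monotone branch of an iterate
  \<open>f ^^ n\<close> has a long image that is cut again after at most two steps, and the part that is
  released from the critical orbit does so with Koebe space on both sides. As \<open>f\<close> expands
  cross-ratios, the return maps have bounded distortion there; this excludes homtervals, because the
  kneading sequence is not periodic. Let \<open>\<mu>\<close> be an invariant probability measure with a density. If
  releases had frequency zero, then \<open>\<mu>\<close> would live on the closure of the critical orbit, which has
  Lebesgue measure zero. So releases recur, and bounded distortion yields \<open>\<mu> {-\<epsilon><..<\<epsilon>} \<ge> \<kappa> * \<epsilon>\<close>.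

  On the other hand, for \<open>q = q\<^sub>2\<^sub>n\<close> the kneading sequence has period \<open>q\<close> for about \<open>a\<^sub>2\<^sub>n\<^sub>+\<^sub>1 / 2\<close> periods,
  so \<open>c q, c (2 * q), \<dots>\<close> moves monotonically away from 0 and \<open>{- c q<..<c q}\<close> is disjoint from that
  many of its images under \<open>f ^^ q\<close>; its measure is therefore at most about \<open>2 / a\<^sub>2\<^sub>n\<^sub>+\<^sub>1\<close>. Without an
  attracting orbit \<open>c q\<close> is at least of order \<open>4 ^ (- q)\<close>. Thus \<open>a\<^sub>2\<^sub>n\<^sub>+\<^sub>1\<close> is bounded by a constant
  times \<open>4 ^ q\<close>, and since 4 is much smaller than \<open>Lambda_rec\<close> the series would converge.\<close>

section \<open>The quadratic map and cross-ratios\<close>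

text \<open>Everything rests on making long images uniform although \<open>f\<close> is not
  hyperbolic. Within distance \<delta> = sqrt (b - sqrt b) of 0 the second image is negative; the
  kneading data forbid this at cutting times, so the ends of branch images stay away from 0. A
  release interval stops at the next cut and not at the end of the branch: this costs at most two
  iterates and buys Koebe space on that side. Distortion is read off cross-ratios, whose growth
  under a quadratic map is an exact algebraic identity.

  Releases are measured at a single time \<open>n\<close>, and invariance identifies the measure of
  a set with that of its preimage under \<open>f ^^ n\<close>, so no ergodic theorem enters. The
  density is merely integrable: it is restricted to a set where it lies between two positive
  constants, chosen before \<epsilon> so that \<kappa> does not depend on \<epsilon>. In place of
  density points there are compact inner approximations, uniform over all finite disjoint families
  of small sets.

  Even convergents lie below \<gamma>; hence the floors of \<open>k * \<omega>\<close> and of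
  \<open>k * p / (q - p)\<close> agree until the accumulated excess becomes too large.\<close>

definition qmap :: "real \<Rightarrow> real \<Rightarrow> real" where
  "qmap b x = b - x\<^sup>2"

text \<open>The bound on \<open>i\<close> is strict, so \<open>qmap b ^^ n\<close> itself may vanish
  on the set. The turning points of this iterate are the zeros of earlier ones; on a segment the
  condition therefore means monotonicity.\<close>

definition zero_free :: "real \<Rightarrow> nat \<Rightarrow> real set \<Rightarrow> bool" where
  "zero_free b n A \<longleftrightarrow> (\<forall>x\<in>A. \<forall>i<n. (qmap b ^^ i) x \<noteq> 0)"

text \<open>Both orientations are allowed because each application of the map may reverse the
  order.\<close>

definition ordered4 :: "real \<Rightarrow> real \<Rightarrow> real \<Rightarrow> real \<Rightarrow> bool" where
  "ordered4 p q r s \<longleftrightarrow> p < q \<and> q < r \<and> r < s \<or> p > q \<and> q > r \<and> r > s"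

text \<open>Middle gap times the whole, divided by the two outer gaps: thin outer gaps make it
  large.\<close>

definition cross_ratio :: "real \<Rightarrow> real \<Rightarrow> real \<Rightarrow> real \<Rightarrow> real" where
  "cross_ratio p q r s = (q - r) * (p - s) / ((p - q) * (r - s))"

lemma open_segment_real: "x \<in> open_segment a d \<longleftrightarrow> a < x \<and> x < d \<or> d < x \<and> x < (a::real)"
  by (auto simp: open_segment_eq_real_ivl)

lemma closed_segment_real: "x \<in> closed_segment a d \<longleftrightarrow> a \<le> x \<and> x \<le> d \<or> d \<le> x \<and> x \<le> (a::real)"
  by (auto simp: closed_segment_eq_real_ivl)

lemma qmap_less_iff: "x \<ge> 0 \<Longrightarrow> y \<ge> 0 \<Longrightarrow> qmap b x < qmap b y \<longleftrightarrow> y < x"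
  unfolding qmap_def using power_mono_iff[of x y 2] power_mono_iff[of y x 2]
    power2_eq_iff_nonneg[of x y] by linarith

lemma qmap_less_iff': "x \<le> 0 \<Longrightarrow> y \<le> 0 \<Longrightarrow> qmap b x < qmap b y \<longleftrightarrow> x < y"
  using qmap_less_iff[of "-x" "-y" b] by (simp add: qmap_def)

lemma one_sided:
  fixes a d :: real
  assumes "0 \<notin> open_segment a d"
  shows "0 \<le> a \<and> 0 \<le> d \<or> a \<le> 0 \<and> d \<le> 0"
  using assms by (auto simp: open_segment_real)

lemma qmap_open_segment:
  assumes "0 \<notin> open_segment a d"
  shows "qmap b ` open_segment a d = open_segment (qmap b a) (qmap b d)"
proof -
  have "y \<in> qmap b ` open_segment a d" if y: "y \<in> open_segment (qmap b a) (qmap b d)" for y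
  proof -
    have yb: "y < b"
      using y zero_le_power2[of a] zero_le_power2[of d]
      unfolding open_segment_real qmap_def by linarith
    define x where "x = sqrt (b - y)"
    have x: "x \<ge> 0" "qmap b x = y" "qmap b (-x) = y" using yb by (auto simp: x_def qmap_def)
    from one_sided[OF assms] show ?thesis
    proof
      assume "0 \<le> a \<and> 0 \<le> d"
      then have "x \<in> open_segment a d" using y x
        qmap_less_iff[of a x b] qmap_less_iff[of x a b] qmap_less_iff[of d x b] qmap_less_iff[of x d b]
        unfolding open_segment_real by linarith
      then show ?thesis by (rule rev_image_eqI) (simp add: x)
    next
      assume "a \<le> 0 \<and> d \<le> 0"
      then have "-x \<in> open_segment a d" using y x
        qmap_less_iff'[of a "-x" b] qmap_less_iff'[of "-x" a b] qmap_less_iff'[of d "-x" b] qmap_less_iff'[of "-x" d b]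
        unfolding open_segment_real by linarith
      then show ?thesis by (rule rev_image_eqI) (simp add: x)
    qed
  qed
  moreover have "qmap b x \<in> open_segment (qmap b a) (qmap b d)" if "x \<in> open_segment a d" for x
    using one_sided[OF assms]
  proof
    assume "0 \<le> a \<and> 0 \<le> d"
    then show ?thesis using that qmap_less_iff[of a x b] qmap_less_iff[of x a b] qmap_less_iff[of d x b] qmap_less_iff[of x d b]
      unfolding open_segment_real by linarith
  next
    assume "a \<le> 0 \<and> d \<le> 0"
    then show ?thesis using that qmap_less_iff'[of a x b] qmap_less_iff'[of x a b] qmap_less_iff'[of d x b] qmap_less_iff'[of x d b]
      unfolding open_segment_real by linarith
  qed
  ultimately show ?thesis by (intro equalityI subsetI) auto
qed

text \<open>Peels off the first iterate, so that inductions on \<open>n\<close> can move the end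
  points by one step of the map.\<close>

lemma zero_free_Suc:
  "zero_free b (Suc n) (open_segment a d) \<longleftrightarrow>
     0 \<notin> open_segment a d \<and> zero_free b n (open_segment (qmap b a) (qmap b d))"
proof (cases "0 \<in> open_segment a d")
  case True
  then have "\<not> zero_free b (Suc n) (open_segment a d)"
    unfolding zero_free_def by (auto intro!: bexI[of _ 0] exI[of _ 0])
  with True show ?thesis by simp
next
  case False
  have "zero_free b (Suc n) (open_segment a d) \<longleftrightarrow>
      (\<forall>x\<in>open_segment a d. \<forall>i<n. (qmap b ^^ Suc i) x \<noteq> 0)"
    unfolding zero_free_def
  proof (intro ball_cong refl)
    fix x assume "x \<in> open_segment a d"
    with False have "x \<noteq> 0" by blast
    then show "(\<forall>i<Suc n. (qmap b ^^ i) x \<noteq> 0) \<longleftrightarrow> (\<forall>i<n. (qmap b ^^ Suc i) x \<noteq> 0)"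
      by (simp add: All_less_Suc2)
  qed
  also have "\<dots> \<longleftrightarrow> zero_free b n (qmap b ` open_segment a d)"
    by (simp add: zero_free_def funpow_swap1)
  finally show ?thesis using False by (simp add: qmap_open_segment)
qed

lemma zero_free_subset: "zero_free b n A \<Longrightarrow> B \<subseteq> A \<Longrightarrow> m \<le> n \<Longrightarrow> zero_free b m B"
  by (force simp: zero_free_def)

lemma funpow_open_segment:
  assumes "zero_free b n (open_segment a d)"
  shows "(qmap b ^^ n) ` open_segment a d = open_segment ((qmap b ^^ n) a) ((qmap b ^^ n) d)"
  using assms
proof (induction n arbitrary: a d)
  case 0
  then show ?case by simp
next
  case (Suc n)
  then have "0 \<notin> open_segment a d" "zero_free b n (open_segment (qmap b a) (qmap b d))"
    by (auto simp: zero_free_Suc)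
  with Suc.IH[of "qmap b a" "qmap b d"] have
    "(qmap b ^^ n) ` (qmap b ` open_segment a d) = open_segment ((qmap b ^^ n) (qmap b a)) ((qmap b ^^ n) (qmap b d))"
    by (simp add: qmap_open_segment)
  then show ?case by (simp add: image_image funpow_swap1)
qed

lemma funpow_inj_on:
  assumes "zero_free b n (open_segment a d)"
  shows "inj_on (qmap b ^^ n) (closed_segment a d)"
  using assms
proof (induction n arbitrary: a d)
  case 0
  then show ?case by simp
next
  case (Suc n)
  then have 0: "0 \<notin> open_segment a d" and n: "zero_free b n (open_segment (qmap b a) (qmap b d))"
    by (auto simp: zero_free_Suc)
  show ?case
  proof (rule inj_onI)
    fix x y assume xy: "x \<in> closed_segment a d" "y \<in> closed_segment a d" "(qmap b ^^ Suc n) x = (qmap b ^^ Suc n) y"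
    have "qmap b z \<in> closed_segment (qmap b a) (qmap b d)" if "z \<in> closed_segment a d" for z
      using that qmap_open_segment[OF 0, of b]
      by (auto simp: closed_segment_eq_open)
    with xy inj_onD[OF Suc.IH[OF n], of "qmap b x" "qmap b y"] have "qmap b x = qmap b y"
      by (simp add: funpow_swap1)
    moreover have "0 \<le> x \<and> 0 \<le> y \<or> x \<le> 0 \<and> y \<le> 0"
      using one_sided[OF 0] xy(1,2) by (auto simp: closed_segment_real)
    ultimately show "x = y"
      using qmap_less_iff[of x y b] qmap_less_iff[of y x b] qmap_less_iff'[of x y b]
        qmap_less_iff'[of y x b] by linarith
  qed
qed

lemma cross_ratio_nonneg:
  assumes "ordered4 p q r s"
  shows "0 \<le> cross_ratio p q r s"
proof -
  have "0 \<le> (q - r) * (p - s)" "0 \<le> (p - q) * (r - s)"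
    using assms by (auto simp: ordered4_def zero_le_mult_iff)
  then show ?thesis unfolding cross_ratio_def by (rule divide_nonneg_nonneg)
qed

lemma cross_ratio_abs:
  assumes "ordered4 p q r s"
  shows "cross_ratio p q r s = \<bar>q - r\<bar> * \<bar>p - s\<bar> / (\<bar>p - q\<bar> * \<bar>r - s\<bar>)"
proof -
  have "cross_ratio p q r s = \<bar>cross_ratio p q r s\<bar>"
    using cross_ratio_nonneg[OF assms] by simp
  also have "\<dots> = \<bar>q - r\<bar> * \<bar>p - s\<bar> / (\<bar>p - q\<bar> * \<bar>r - s\<bar>)"
    unfolding cross_ratio_def by (simp only: abs_mult abs_divide)
  finally show ?thesis .
qed

text \<open>A difference of images is the difference of the points times their sum, up to sign. The
  cross-ratio is thus multiplied by \<open>(q + r) * (p + s) / A\<close> with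
  \<open>A = (p + q) * (r + s)\<close>, and this numerator exceeds \<open>A\<close> by
  \<open>(p - r) * (q - s)\<close>, which is nonnegative.\<close>

lemma ordered4_step:
  assumes o: "ordered4 p q r s" and 0: "0 \<notin> open_segment p s"
  shows "ordered4 (qmap b p) (qmap b q) (qmap b r) (qmap b s)"
    and "cross_ratio p q r s \<le> cross_ratio (qmap b p) (qmap b q) (qmap b r) (qmap b s)"
proof -
  have os: "0 \<le> p \<and> 0 \<le> q \<and> 0 \<le> r \<and> 0 \<le> s \<or> p \<le> 0 \<and> q \<le> 0 \<and> r \<le> 0 \<and> s \<le> 0"
    using one_sided[OF 0] o by (auto simp: ordered4_def)
  show "ordered4 (qmap b p) (qmap b q) (qmap b r) (qmap b s)"
    using os o by (auto simp: ordered4_def qmap_less_iff qmap_less_iff')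
  have d: "qmap b x - qmap b y = - ((x - y) * (x + y))" for x y
    by (simp add: qmap_def power2_eq_square algebra_simps)
  define A where "A = (p + q) * (r + s)"
  have A: "A > 0" using os o unfolding A_def ordered4_def
    by (elim disjE) (auto intro: mult_pos_pos mult_neg_neg)
  have AB: "(q + r) * (p + s) - A = (p - r) * (q - s)" by (simp add: A_def algebra_simps)
  have "(p - r) * (q - s) \<ge> 0" using o unfolding ordered4_def
    by (auto simp: zero_le_mult_iff)
  then have "A \<le> (q + r) * (p + s)" using AB by linarith
  then have 1: "1 \<le> (q + r) * (p + s) / A" by (simp only: le_divide_eq_1_pos[OF A])
  note c = cross_ratio_nonneg[OF o]
  have "cross_ratio (qmap b p) (qmap b q) (qmap b r) (qmap b s) = cross_ratio p q r s * ((q + r) * (p + s) / A)"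
    unfolding cross_ratio_def d A_def
    by (simp only: times_divide_times_eq mult_minus_left mult_minus_right minus_minus mult_ac)
  with mult_left_mono[OF 1 c]
  show "cross_ratio p q r s \<le> cross_ratio (qmap b p) (qmap b q) (qmap b r) (qmap b s)" by simp
qed

lemma ordered4_funpow:
  assumes "ordered4 p q r s" and "zero_free b n (open_segment p s)"
  shows "ordered4 ((qmap b ^^ n) p) ((qmap b ^^ n) q) ((qmap b ^^ n) r) ((qmap b ^^ n) s)
    \<and> cross_ratio p q r s \<le> cross_ratio ((qmap b ^^ n) p) ((qmap b ^^ n) q) ((qmap b ^^ n) r) ((qmap b ^^ n) s)"
  using assms
proof (induction n arbitrary: p q r s)
  case 0
  then show ?case by simp
next
  case (Suc n)
  then have 0: "0 \<notin> open_segment p s" and n: "zero_free b n (open_segment (qmap b p) (qmap b s))"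
    by (auto simp: zero_free_Suc)
  from Suc.IH[OF ordered4_step(1)[OF Suc.prems(1) 0] n] ordered4_step(2)[OF Suc.prems(1) 0, of b]
  show ?case by (simp add: funpow_swap1)
qed

lemma divide_le_times_iff:
  fixes x y u v :: real
  assumes "0 < y" "0 < v"
  shows "x / y \<le> u / v \<longleftrightarrow> x * v \<le> u * y"
  using assms by (simp add: pos_divide_le_eq pos_le_divide_eq)

text \<open>One half of the Koebe principle: the cross-ratio inequality with the short interval
  placed at the end of the quadruple, so that it appears in the denominator.\<close>

lemma koebe_half:
  assumes o: "ordered4 p q r s" and n: "zero_free b n (open_segment p s)"
    and M: "\<bar>(qmap b ^^ n) p - (qmap b ^^ n) s\<bar> \<le> M"
    and \<delta>: "\<delta> > 0" "\<bar>(qmap b ^^ n) r - (qmap b ^^ n) s\<bar> \<ge> \<delta>"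
  shows "\<bar>(qmap b ^^ n) p - (qmap b ^^ n) q\<bar> * \<delta> * \<bar>q - r\<bar> \<le> M\<^sup>2 * \<bar>p - q\<bar>"
proof -
  define P Q R S where PQRS: "P = (qmap b ^^ n) p" "Q = (qmap b ^^ n) q" "R = (qmap b ^^ n) r" "S = (qmap b ^^ n) s"
  note O = conjunct1[OF ordered4_funpow[OF o n], folded PQRS]
  note le = conjunct2[OF ordered4_funpow[OF o n], folded PQRS]
  note cr = cross_ratio_abs
  have d: "\<bar>p - q\<bar> > 0" "\<bar>r - s\<bar> > 0" "\<bar>p - s\<bar> \<ge> \<bar>r - s\<bar>"
    "\<bar>P - Q\<bar> > 0" "\<bar>R - S\<bar> > 0" "\<bar>Q - R\<bar> \<le> \<bar>P - S\<bar>"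
    using o O by (auto simp: ordered4_def)
  have "\<bar>q - r\<bar> / \<bar>p - q\<bar> = \<bar>q - r\<bar> * \<bar>r - s\<bar> / (\<bar>p - q\<bar> * \<bar>r - s\<bar>)"
    by (rule nonzero_mult_divide_mult_cancel_right[symmetric]) (use d(2) in simp)
  also have "\<dots> \<le> \<bar>q - r\<bar> * \<bar>p - s\<bar> / (\<bar>p - q\<bar> * \<bar>r - s\<bar>)"
    using d(3) by (intro divide_right_mono mult_left_mono) auto
  also have "\<dots> \<le> \<bar>Q - R\<bar> * \<bar>P - S\<bar> / (\<bar>P - Q\<bar> * \<bar>R - S\<bar>)"
    using le unfolding cr[OF o] cr[OF O] .
  also have "\<dots> \<le> M * M / (\<bar>P - Q\<bar> * \<delta>)"
  proof (rule frac_le)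
    show "\<bar>Q - R\<bar> * \<bar>P - S\<bar> \<le> M * M"
      by (rule mult_mono) (use d(6) M[folded PQRS] in linarith)+
    show "\<bar>P - Q\<bar> * \<delta> \<le> \<bar>P - Q\<bar> * \<bar>R - S\<bar>"
      using \<delta>(2)[folded PQRS] by (rule mult_left_mono) simp
    show "0 < \<bar>P - Q\<bar> * \<delta>" using d(4) \<delta>(1) by (rule mult_pos_pos)
  qed simp
  finally have "\<bar>q - r\<bar> / \<bar>p - q\<bar> \<le> M * M / (\<bar>P - Q\<bar> * \<delta>)" .
  then have "\<bar>q - r\<bar> * (\<bar>P - Q\<bar> * \<delta>) \<le> M * M * \<bar>p - q\<bar>"
    by (simp only: divide_le_times_iff[OF d(1) mult_pos_pos[OF d(4) \<delta>(1)]])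
  then show ?thesis by (simp only: PQRS power2_eq_square mult_ac)
qed

text \<open>Here the middle interval is the one of interest. If the images of both outer gaps have
  length at least \<delta>, the cross-ratio of the images is at most
  \<open>(M / \<delta>)\<^sup>2\<close>; so is the original one, and the outer gaps cannot be thin
  compared with the middle.\<close>

lemma koebe_space:
  assumes o: "ordered4 p q r s" and n: "zero_free b n (open_segment p s)"
    and M: "\<bar>(qmap b ^^ n) p - (qmap b ^^ n) s\<bar> \<le> M"
    and \<delta>: "\<delta> > 0" "\<bar>(qmap b ^^ n) r - (qmap b ^^ n) s\<bar> \<ge> \<delta>" "\<bar>(qmap b ^^ n) p - (qmap b ^^ n) q\<bar> \<ge> \<delta>"
  shows "\<bar>q - r\<bar>\<^sup>2 * \<delta>\<^sup>2 \<le> M\<^sup>2 * (\<bar>p - q\<bar> * \<bar>r - s\<bar>)"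
proof -
  define P Q R S where PQRS: "P = (qmap b ^^ n) p" "Q = (qmap b ^^ n) q" "R = (qmap b ^^ n) r" "S = (qmap b ^^ n) s"
  note O = conjunct1[OF ordered4_funpow[OF o n], folded PQRS]
  note le = conjunct2[OF ordered4_funpow[OF o n], folded PQRS]
  note cr = cross_ratio_abs
  have d: "\<bar>p - q\<bar> > 0" "\<bar>r - s\<bar> > 0" "\<bar>p - s\<bar> \<ge> \<bar>q - r\<bar>"
    "\<bar>P - Q\<bar> > 0" "\<bar>R - S\<bar> > 0" "\<bar>Q - R\<bar> \<le> \<bar>P - S\<bar>"
    using o O by (auto simp: ordered4_def)
  have "\<bar>q - r\<bar> * \<bar>q - r\<bar> / (\<bar>p - q\<bar> * \<bar>r - s\<bar>) \<le> \<bar>q - r\<bar> * \<bar>p - s\<bar> / (\<bar>p - q\<bar> * \<bar>r - s\<bar>)"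
    using d by (intro divide_right_mono mult_left_mono) auto
  also have "\<dots> \<le> \<bar>Q - R\<bar> * \<bar>P - S\<bar> / (\<bar>P - Q\<bar> * \<bar>R - S\<bar>)"
    using le unfolding cr[OF o] cr[OF O] .
  also have "\<dots> \<le> M * M / (\<delta> * \<delta>)"
  proof (rule frac_le)
    show "\<bar>Q - R\<bar> * \<bar>P - S\<bar> \<le> M * M"
      by (rule mult_mono) (use d(6) M[folded PQRS] in linarith)+
    show "\<delta> * \<delta> \<le> \<bar>P - Q\<bar> * \<bar>R - S\<bar>"
      by (rule mult_mono) (use \<delta>[folded PQRS] in linarith)+
    show "0 < \<delta> * \<delta>" using \<delta>(1) \<delta>(1) by (rule mult_pos_pos)
  qed simp
  finally have "\<bar>q - r\<bar> * \<bar>q - r\<bar> * (\<delta> * \<delta>) \<le> M * M * (\<bar>p - q\<bar> * \<bar>r - s\<bar>)"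
    by (simp only: divide_le_times_iff[OF mult_pos_pos[OF d(1,2)] mult_pos_pos[OF \<delta>(1,1)]])
  then show ?thesis by (simp only: PQRS power2_eq_square mult_ac)
qed

text \<open>\<open>S\<close> enumerates the cutting times. The kneading map enters through signs of
  the critical orbit only: after \<open>S k\<close> the orbit is negative at once if the next gap is
  1, and positive for two steps if the gap is 2. \<open>crit_aperiodic\<close> is the form in which
  irrationality of the angle is used.\<close>

locale bounded_kneading =
  fixes b :: real and S Q :: "nat \<Rightarrow> nat"
  assumes b_gt: "1 < b" and b_lt: "b < 2"
    and S_0: "S 0 = 1" and S_Suc: "S (Suc k) = S k + S (Q (Suc k))"
    and Q_1: "Q (Suc 0) = 0" and Q_le: "Q k \<le> 1"
    and crit_neg: "Q (Suc k) = 0 \<Longrightarrow> (qmap b ^^ (S k + 1)) 0 < 0"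
    and crit_pos: "Q (Suc k) = 1 \<Longrightarrow> 0 < (qmap b ^^ (S k + 1)) 0 \<and> 0 < (qmap b ^^ (S k + 2)) 0"
    and crit_aperiodic: "1 \<le> d \<Longrightarrow> \<exists>l\<ge>2. sgn ((qmap b ^^ (l + d)) 0) \<noteq> sgn ((qmap b ^^ l) 0)"
begin

abbreviation f :: "real \<Rightarrow> real" where "f \<equiv> qmap b"

definition c :: "nat \<Rightarrow> real" where "c n = (f ^^ n) 0"

definition \<delta> :: real where "\<delta> = sqrt (b - sqrt b)"

lemma c_simps: "c 0 = 0" "c (Suc 0) = b" "c 2 = b - b\<^sup>2"
  by (simp_all add: c_def qmap_def numeral_2_eq_2)

lemma f_c: "f (c n) = c (Suc n)" "(f ^^ i) (c n) = c (n + i)"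
  by (simp_all add: c_def funpow_add[symmetric, THEN fun_cong, simplified] add.commute)

lemma S_1: "S (Suc 0) = 2"
  using S_Suc[of 0] by (simp add: Q_1 S_0)

lemma Q_cases: "Q k = 0 \<or> Q k = 1"
  using Q_le[of k] by auto

lemma S_Q: "S (Q k) = Suc (Q k)"
  using Q_cases[of k] by (auto simp: S_0 S_1)

lemma S_ge: "Suc k \<le> S k"
  by (induction k) (auto simp: S_0 S_Suc S_Q)

lemma b_sq: "b\<^sup>2 \<le> 2 * b" "b < b\<^sup>2"
  using b_gt b_lt mult_strict_left_mono[of 1 b b] by (auto simp: power2_eq_square)

lemma sqrt_b: "1 < sqrt b" "sqrt b < b" "sqrt b ^ 2 = b"
  using b_gt b_sq(2) by (auto simp: real_less_lsqrt power2_eq_square)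

lemma \<delta>: "0 < \<delta>" "\<delta>\<^sup>2 = b - sqrt b" "\<delta> < 1"
proof -
  show "0 < \<delta>" "\<delta>\<^sup>2 = b - sqrt b" using sqrt_b by (auto simp: \<delta>_def)
  have "b - sqrt b < 1" using sqrt_b(1) b_lt by linarith
  then show "\<delta> < 1" by (simp add: \<delta>_def)
qed

lemma f_bound: "\<bar>x\<bar> \<le> b \<Longrightarrow> f x \<in> {c 2..c 1}"
proof -
  assume "\<bar>x\<bar> \<le> b"
  then have "x\<^sup>2 \<le> b\<^sup>2" using b_gt by (simp add: abs_le_square_iff[symmetric])
  then show ?thesis by (simp add: c_simps qmap_def)
qed

lemma I_bound: "x \<in> {c 2..c 1} \<Longrightarrow> \<bar>x\<bar> \<le> b"
  using b_sq b_gt by (auto simp: c_simps)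

lemma f_I: "x \<in> {c 2..c 1} \<Longrightarrow> f x \<in> {c 2..c 1}"
  using f_bound I_bound by blast

lemma funpow_I: "x \<in> {c 2..c 1} \<Longrightarrow> (f ^^ n) x \<in> {c 2..c 1}"
  by (induction n) (simp_all add: f_I del: atLeastAtMost_iff One_nat_def)

lemma c_I: "1 \<le> n \<Longrightarrow> c n \<in> {c 2..c 1}"
proof -
  assume "1 \<le> n"
  have "c 1 \<in> {c 2..c 1}" using b_gt by (simp add: c_simps)
  from funpow_I[OF this, of "n - 1"] \<open>1 \<le> n\<close> show ?thesis by (simp only: f_c) simp
qed

text \<open>The factor is \<open>\<bar>x + y\<bar> \<le> 2 * b < 4\<close>; the powers
  \<open>4 ^ i\<close> in later estimates come from here.\<close>

lemma f_lipschitz: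
  assumes "\<bar>x\<bar> \<le> b" "\<bar>y\<bar> \<le> b"
  shows "\<bar>f x - f y\<bar> \<le> 4 * \<bar>x - y\<bar>"
proof -
  have "f x - f y = (y - x) * (x + y)" by (simp add: qmap_def power2_eq_square algebra_simps)
  then have "\<bar>f x - f y\<bar> = \<bar>x - y\<bar> * \<bar>x + y\<bar>" by (simp add: abs_mult abs_minus_commute)
  also have "\<dots> \<le> \<bar>x - y\<bar> * 4" by (rule mult_left_mono) (use assms b_lt in auto)
  finally show ?thesis by simp
qed

lemma time_cases:
  assumes "2 \<le> n"
  shows "\<exists>k. n = S k + 1 \<or> n = S k + 2 \<and> Q (Suc k) = 1"
  using assms
proof (induction n rule: dec_induct)
  case base
  show ?case by (intro exI[of _ 0]) (simp add: S_0)
next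
  case (step n)
  then obtain k where "n = S k + 1 \<or> n = S k + 2 \<and> Q (Suc k) = 1" by blast
  with Q_cases[of "Suc k"] have "Suc n = S (Suc k) + 1 \<or> Suc n = S k + 2 \<and> Q (Suc k) = 1"
    by (auto simp: S_Suc S_Q)
  then show ?case by blast
qed

lemma c_sign:
  "Q (Suc k) = 0 \<Longrightarrow> c (S (Suc k)) < 0" "Q (Suc k) = 1 \<Longrightarrow> 0 < c (S (Suc k))"
  "Q (Suc k) = 1 \<Longrightarrow> 0 < c (Suc (S k))"
  using crit_neg[of k] crit_pos[of k] by (auto simp: c_def S_Suc[of k] S_0 S_1)

lemma c_1_pos: "0 < c (Suc 0)" and c_2_neg: "c 2 < 0"
  using b_gt b_sq by (auto simp: c_simps)

lemma c_SQ: "Q k = 0 \<Longrightarrow> c (S (Q k)) > 0" "Q k = 1 \<Longrightarrow> c (S (Q k)) < 0"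
  using c_1_pos c_2_neg by (auto simp: S_0 S_1)

text \<open>If \<open>Q k = 0\<close>, then \<open>c (S k)\<close> is negative and
  \<open>c (S (Q k)) = c 1\<close> is positive; if \<open>Q k = 1\<close>, then
  \<open>c (S k)\<close> is positive and \<open>c 2\<close> is negative. This guarantees that every
  branch is cut again.\<close>

lemma c_opposite:
  assumes "1 \<le> k"
  shows "0 \<in> open_segment (c (S k)) (c (S (Q k)))"
  using assms c_sign[of "k - 1"] c_SQ[of k] Q_cases[of k] by (auto simp: open_segment_real)

lemma c_nonzero: "1 \<le> n \<Longrightarrow> c n \<noteq> 0"
proof -
  assume "1 \<le> n"
  show ?thesis
  proof (cases "n = 1")
    case True
    then show ?thesis using c_1_pos by simp
  next
    case False
    with \<open>1 \<le> n\<close> obtain k where "n = S k + 1 \<or> n = S k + 2 \<and> Q (Suc k) = 1" using time_cases[of n] by auto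
    then show ?thesis using crit_neg[of k] crit_pos[of k] Q_cases[of "Suc k"]
      by (auto simp: c_def simp del: funpow.simps)
  qed
qed

text \<open>A value closer to 0 would be followed by one above \<open>sqrt b\<close> and then by a
  negative one. Neither sign pattern after a cutting time allows this.\<close>

lemma c_S_large: "\<delta> \<le> \<bar>c (S k)\<bar>"
proof -
  have fc: "c (S k + 1) = b - (c (S k))\<^sup>2" "c (S k + 2) = b - (c (S k + 1))\<^sup>2"
    using f_c(1)[of "S k"] f_c(1)[of "S k + 1"] by (simp_all add: qmap_def)
  have "b - sqrt b \<le> (c (S k))\<^sup>2"
  proof (cases "Q (Suc k) = 0")
    case True
    with crit_neg[of k] have "c (S k + 1) < 0" by (simp only: c_def)
    with fc have "b < (c (S k))\<^sup>2" by simp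
    then show ?thesis using sqrt_b(1) by linarith
  next
    case False
    with crit_pos[of k] Q_cases[of "Suc k"] have "0 < c (S k + 1)" "0 < c (S k + 2)" by (auto simp only: c_def)
    with fc(2) have "(c (S k + 1))\<^sup>2 < (sqrt b)\<^sup>2" using sqrt_b by simp
    then have "c (S k + 1) < sqrt b" using sqrt_b by (intro power2_less_imp_less[of _ "sqrt b"]) auto
    with fc(1) show ?thesis by simp
  qed
  then have "\<delta>\<^sup>2 \<le> (c (S k))\<^sup>2" by (simp add: \<delta>)
  then show ?thesis using abs_le_square_iff[of \<delta> "c (S k)"] \<delta>(1) by simp
qed

text \<open>Negative values of the critical orbit occur at cutting times only, since the
  intermediate time of a gap of length 2 has a positive value.\<close>

lemma c_gap: "1 \<le> n \<Longrightarrow> c n \<notin> {-\<delta><..<0}"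
proof
  assume "1 \<le> n" and neg: "c n \<in> {-\<delta><..<0}"
  then have "n \<noteq> 1" using c_1_pos by auto
  with \<open>1 \<le> n\<close> obtain k where k: "n = S k + 1 \<or> n = S k + 2 \<and> Q (Suc k) = 1" using time_cases[of n] by auto
  have "n = S (Suc k)"
  proof (rule ccontr)
    assume "n \<noteq> S (Suc k)"
    with k Q_cases[of "Suc k"] have "n = S k + 1" "Q (Suc k) = 1" by (auto simp: S_Suc S_Q)
    with crit_pos[of k] neg show False by (auto simp: c_def)
  qed
  with c_S_large[of "Suc k"] neg show False by auto
qed

lemma zero_preimage_large:
  assumes "i = 1 \<or> i = 2" and "(f ^^ i) x = 0"
  shows "\<delta> \<le> \<bar>x\<bar>"
proof (rule ccontr)
  assume "\<not> \<delta> \<le> \<bar>x\<bar>"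
  then have "x\<^sup>2 < \<delta>\<^sup>2" using \<delta>(1) abs_le_square_iff[of \<delta> x] by auto
  then have fx: "sqrt b < f x" by (simp add: \<delta> qmap_def)
  then have "(sqrt b)\<^sup>2 < (f x)\<^sup>2" using sqrt_b by (intro power_strict_mono) auto
  then have "f (f x) < 0" using sqrt_b by (simp add: qmap_def[of b "f x"])
  with fx assms sqrt_b show False by (auto simp: numeral_2_eq_2)
qed

section \<open>The tree of monotone branches\<close>

text \<open>\<open>branch n k x y\<close>: \<open>f ^^ n\<close> is monotone between \<open>x\<close> and \<open>y\<close> and maps these points to
  \<open>c (S k)\<close> and \<open>c (S (Q k))\<close>, which lie on opposite sides of the turning point. Cutting at the zero
  \<open>z\<close> of \<open>f ^^ n\<close> leaves two pieces: on one the orbit keeps following the critical orbit, on the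
  other it is released and starts again at height \<open>Suc (Q k)\<close>.\<close>

inductive branch :: "nat \<Rightarrow> nat \<Rightarrow> real \<Rightarrow> real \<Rightarrow> bool" where
  root: "branch 0 (Suc 0) (c 2) (c 1)"
| follow: "branch n k x y \<Longrightarrow> z \<in> open_segment x y \<Longrightarrow> (f ^^ n) z = 0 \<Longrightarrow>
    branch (n + S (Q (Suc k))) (Suc k) x z"
| release: "branch n k x y \<Longrightarrow> z \<in> open_segment x y \<Longrightarrow> (f ^^ n) z = 0 \<Longrightarrow>
    branch (n + S (Q (Suc (Q k)))) (Suc (Q k)) y z"

lemma open_segment_sub:
  fixes z :: real
  assumes "z \<in> open_segment x y" "e = x \<or> e = y"
  shows "open_segment z e \<subseteq> open_segment x y" "z \<noteq> e" "z \<in> closed_segment x y" "e \<in> closed_segment x y"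
  using assms by (auto simp: open_segment_real closed_segment_real)

text \<open>By injectivity \<open>z\<close> is the only zero of \<open>f ^^ n\<close>, so the piece
  between \<open>z\<close> and \<open>e\<close> survives one more step. If the next gap is 2 it
  survives another one, because at time \<open>Suc n\<close> its ends are at the positive values
  \<open>c 1\<close> and \<open>c (S k + 1)\<close>.\<close>

lemma child:
  assumes nz: "zero_free b n (open_segment x y)" and z: "z \<in> open_segment x y" "(f ^^ n) z = 0"
    and e: "e = x \<or> e = y" "(f ^^ n) e = c (S k)"
  shows "zero_free b (Suc n) (open_segment z e)"
    and "zero_free b (n + S (Q (Suc k))) (open_segment z e)"
    and "(f ^^ (n + i)) e = c (S k + i)" "(f ^^ (n + i)) z = c i"
proof -
  note sub = open_segment_sub[OF z(1) e(1)]
  have ne: "(f ^^ n) u \<noteq> 0" if "u \<in> open_segment z e" for u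
  proof
    assume "(f ^^ n) u = 0"
    moreover have "u \<in> closed_segment x y" using that sub(1) by (auto simp: closed_segment_eq_open)
    ultimately have "u = z" using funpow_inj_on[OF nz] z(2) sub(3) by (metis inj_onD)
    with that show False by (simp add: open_segment_def)
  qed
  show nz1: "zero_free b (Suc n) (open_segment z e)"
    unfolding zero_free_def
  proof (intro ballI allI impI)
    fix u i assume "u \<in> open_segment z e" "i < Suc n"
    with ne nz sub(1) show "(f ^^ i) u \<noteq> 0" unfolding zero_free_def by (metis less_Suc_eq subsetD)
  qed
  have iter: "(f ^^ (n + i)) u = (f ^^ i) ((f ^^ n) u)" for u i
    by (metis add.commute comp_apply funpow_add)
  show ie: "(f ^^ (n + i)) e = c (S k + i)" and iz: "(f ^^ (n + i)) z = c i" for i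
    by (simp_all add: iter e f_c) (simp add: z c_def)
  show "zero_free b (n + S (Q (Suc k))) (open_segment z e)"
  proof (cases "Q (Suc k) = 0")
    case True
    with nz1 show ?thesis by (simp add: S_0)
  next
    case False
    then have Q: "Q (Suc k) = 1" using Q_cases[of "Suc k"] by auto
    have "(f ^^ Suc n) u \<noteq> 0" if "u \<in> open_segment z e" for u
    proof -
      have "(f ^^ Suc n) u \<in> open_segment (c (Suc 0)) (c (Suc (S k)))"
        using funpow_open_segment[OF nz1] that ie[of 1] iz[of 1] by (auto simp del: funpow.simps)
      with c_1_pos c_sign(3)[OF Q] show ?thesis by (auto simp: open_segment_real simp del: funpow.simps)
    qed
    with nz1 have "zero_free b (Suc (Suc n)) (open_segment z e)"
      unfolding zero_free_def by (metis less_Suc_eq)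
    then show ?thesis by (simp add: Q S_1)
  qed
qed

lemma branch_facts:
  assumes "branch n k x y"
  shows "1 \<le> k" "x \<in> {c 2..c 1}" "y \<in> {c 2..c 1}" "x \<noteq> y" "zero_free b n (open_segment x y)"
    "(f ^^ n) x = c (S k)" "(f ^^ n) y = c (S (Q k))"
    "x \<in> {c 1, c 2} \<or> (\<exists>i<n. (f ^^ i) x = 0)" "y \<in> {c 1, c 2} \<or> (\<exists>i<n. (f ^^ i) y = 0)"
proof -
  have "1 \<le> k \<and> x \<in> {c 2..c 1} \<and> y \<in> {c 2..c 1} \<and> x \<noteq> y \<and> zero_free b n (open_segment x y) \<and>
    (f ^^ n) x = c (S k) \<and> (f ^^ n) y = c (S (Q k)) \<and> 
    (x \<in> {c 1, c 2} \<or> (\<exists>i<n. (f ^^ i) x = 0)) \<and> (y \<in> {c 1, c 2} \<or> (\<exists>i<n. (f ^^ i) y = 0))"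
    using assms
  proof induction
    case root
    show ?case using c_I[of 2] c_I[of 1] c_1_pos c_2_neg by (auto simp: zero_free_def S_0 S_1 Q_1)
  next
    case (follow n k x y z)
    then have nz: "zero_free b n (open_segment x y)" and e: "x = x \<or> x = y" "(f ^^ n) x = c (S k)"
      by simp_all
    note ch = child[OF nz follow.hyps(2,3) e]
    have "z \<in> {c 2..c 1}" using follow by (auto simp: open_segment_real)
    moreover have "n < n + S (Q (Suc k))" by (simp add: S_Q)
    moreover have "x \<in> {c 1, c 2} \<or> (\<exists>i<n + S (Q (Suc k)). (f ^^ i) x = 0)"
      using follow.IH by (meson trans_less_add1)
    ultimately show ?case
      using follow ch(2) open_segment_sub(2)[OF follow.hyps(2) e(1)]
      unfolding S_Suc ch(3)[of "S (Q (Suc k))", folded S_Suc] ch(4) open_segment_commute[of x z] by auto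
  next
    case (release n k x y z)
    then have nz: "zero_free b n (open_segment x y)" and e: "y = x \<or> y = y" "(f ^^ n) y = c (S (Q k))"
      by simp_all
    note ch = child[OF nz release.hyps(2,3) e]
    have "z \<in> {c 2..c 1}" using release by (auto simp: open_segment_real)
    moreover have "n < n + S (Q (Suc (Q k)))" by (simp add: S_Q)
    moreover have "y \<in> {c 1, c 2} \<or> (\<exists>i<n + S (Q (Suc (Q k))). (f ^^ i) y = 0)"
      using release.IH by (meson trans_less_add1)
    ultimately show ?case
      using release ch(2) open_segment_sub(2)[OF release.hyps(2) e(1)]
      unfolding S_Suc ch(3)[of "S (Q (Suc (Q k)))", folded S_Suc] ch(4) open_segment_commute[of y z] by auto
  qed
  then show "1 \<le> k" "x \<in> {c 2..c 1}" "y \<in> {c 2..c 1}" "x \<noteq> y" "zero_free b n (open_segment x y)"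
    and "(f ^^ n) x = c (S k)" "(f ^^ n) y = c (S (Q k))"
    and "x \<in> {c 1, c 2} \<or> (\<exists>i<n. (f ^^ i) x = 0)" "y \<in> {c 1, c 2} \<or> (\<exists>i<n. (f ^^ i) y = 0)"
    by blast+
qed

text \<open>The end point of height \<open>k\<close> has been on the critical orbit for some time.
  The record goes back to index 2 and no further because the root starts with \<open>c 2\<close> at
  time 0.\<close>

lemma branch_history:
  assumes "branch n k x y"
  shows "S k \<le> n + 2 \<and> (\<forall>j\<le>S k - 2. (f ^^ (n - j)) x = c (S k - j))"
  using assms
proof induction
  case root
  show ?case by (simp add: S_1)
next
  case (follow n k x y z)
  let ?s = "S (Q (Suc k))"
  have "(f ^^ (n + ?s - j)) x = c (S k + ?s - j)" if j: "j \<le> S k + ?s - 2" for j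
  proof (cases "j \<le> ?s")
    case True
    then have "(f ^^ (n + ?s - j)) x = (f ^^ (?s - j)) ((f ^^ n) x)"
      by (metis Nat.add_diff_assoc add.commute comp_apply funpow_add)
    with True show ?thesis by (simp add: branch_facts(6)[OF follow.hyps(1)] f_c)
  next
    case False
    with j have "j - ?s \<le> S k - 2" "n + ?s - j = n - (j - ?s)" "S k + ?s - j = S k - (j - ?s)" by auto
    with follow.IH show ?thesis by metis
  qed
  with follow.IH show ?case by (auto simp: S_Suc)
next
  case (release n k x y z)
  let ?s = "S (Q (Suc (Q k)))"
  have 2: "S (Q k) \<le> 2" using Q_le[of k] by (simp add: S_Q)
  have "(f ^^ (n + ?s - j)) y = c (S (Q k) + ?s - j)" if j: "j \<le> S (Q k) + ?s - 2" for j
  proof -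
    have js: "j \<le> ?s" using j 2 by simp
    then have "(f ^^ (n + ?s - j)) y = (f ^^ (?s - j)) ((f ^^ n) y)"
      by (metis Nat.add_diff_assoc add.commute comp_apply funpow_add)
    with js show ?thesis by (simp add: branch_facts(7)[OF release.hyps(1)] f_c)
  qed
  with 2 show ?case by (auto simp: S_Suc)
qed

end

lemma funpow_closed_segment:
  assumes "zero_free b n (open_segment x y)"
  shows "(qmap b ^^ n) ` closed_segment x y = closed_segment ((qmap b ^^ n) x) ((qmap b ^^ n) y)"
  using funpow_open_segment[OF assms] by (simp add: closed_segment_eq_open image_Un)

text \<open>Turns equal sign patterns into monotonicity: as long as there is no zero, the image of
  the segment is spanned by the images of its ends, which lie on one side of 0.\<close>

lemma zero_free_if_same_sgn:
  assumes "\<And>i. i < n \<Longrightarrow> sgn ((qmap b ^^ i) x) = sgn ((qmap b ^^ i) y) \<and> (qmap b ^^ i) x \<noteq> 0"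
  shows "zero_free b n (open_segment x y)"
  using assms
proof (induction n)
  case 0
  then show ?case by (simp add: zero_free_def)
next
  case (Suc n)
  then have nz: "zero_free b n (open_segment x y)" by simp
  have "0 \<notin> open_segment ((qmap b ^^ n) x) ((qmap b ^^ n) y)"
    using Suc.prems[of n] by (auto simp: open_segment_real sgn_if split: if_splits)
  then have "(qmap b ^^ n) u \<noteq> 0" if "u \<in> open_segment x y" for u
    using that funpow_open_segment[OF nz] by (metis imageI)
  with nz show ?case unfolding zero_free_def by (metis less_Suc_eq)
qed

lemma sgn_funpow_endpoint:
  assumes "zero_free b n (open_segment x y)" "u \<in> open_segment x y" "i < n" "(qmap b ^^ i) x \<noteq> 0"
  shows "sgn ((qmap b ^^ i) u) = sgn ((qmap b ^^ i) x)"
proof -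
  have nz: "zero_free b i (open_segment x y)" "zero_free b (Suc i) (open_segment x y)"
    using zero_free_subset[OF assms(1)] assms(3) by simp_all
  have img: "(qmap b ^^ i) ` open_segment x y = open_segment ((qmap b ^^ i) x) ((qmap b ^^ i) y)"
    by (rule funpow_open_segment[OF nz(1)])
  have "0 \<notin> (qmap b ^^ i) ` open_segment x y"
    using nz(2) unfolding zero_free_def by (metis imageE lessI)
  then have "0 \<notin> open_segment ((qmap b ^^ i) x) ((qmap b ^^ i) y)" unfolding img .
  from one_sided[OF this] have "0 \<le> (qmap b ^^ i) x \<and> 0 \<le> (qmap b ^^ i) y \<or> (qmap b ^^ i) x \<le> 0 \<and> (qmap b ^^ i) y \<le> 0" .
  moreover have "(qmap b ^^ i) u \<in> open_segment ((qmap b ^^ i) x) ((qmap b ^^ i) y)"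
    using img assms(2) by blast
  ultimately show ?thesis using assms(4) by (auto simp: open_segment_real sgn_if)
qed

section \<open>Release intervals and their distortion\<close>

context bounded_kneading
begin

text \<open>Two consecutive cuts: \<open>z\<close> cuts the branch, and \<open>w\<close> cuts the
  piece between \<open>z\<close> and \<open>e\<close>, whose end \<open>e\<close> has height
  \<open>j\<close>. The interval between the cuts has room on both sides at time \<open>n\<close>:
  the other piece of the branch lies beyond \<open>z\<close>, the rest of the piece up to
  \<open>e\<close> lies beyond \<open>w\<close>.\<close>

definition release_interval :: "nat \<Rightarrow> nat \<Rightarrow> real \<Rightarrow> real \<Rightarrow> bool" where
  "release_interval n i z w \<longleftrightarrow>
     (\<exists>k x y e j. branch n k x y \<and> z \<in> open_segment x y \<and> (f ^^ n) z = 0 \<and>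
        (e = x \<and> j = k \<or> e = y \<and> j = Q k) \<and> i = S (Q (Suc j)) \<and>
        w \<in> open_segment z e \<and> (f ^^ (n + i)) w = 0)"

text \<open>\<open>16 = 4 ^ 2\<close>: a distance \<delta> at time \<open>n + i\<close> is pulled
  back through at most two steps, each with Lipschitz constant 4.\<close>

definition \<eta> :: real where "\<eta> = \<delta> / 16"

lemma \<eta>: "0 < \<eta>" "\<eta> \<le> \<delta>" "\<eta> \<le> 1"
  using \<delta> by (auto simp: \<eta>_def)

lemma funpow_lipschitz:
  assumes "\<bar>x\<bar> \<le> b" "\<bar>y\<bar> \<le> b"
  shows "\<bar>(f ^^ i) x - (f ^^ i) y\<bar> \<le> 4 ^ i * \<bar>x - y\<bar>"
  using assms
proof (induction i arbitrary: x y)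
  case 0
  then show ?case by simp
next
  case (Suc i)
  have "\<bar>f x\<bar> \<le> b" "\<bar>f y\<bar> \<le> b" using Suc.prems f_bound I_bound by blast+
  from Suc.IH[OF this] have "\<bar>(f ^^ i) (f x) - (f ^^ i) (f y)\<bar> \<le> 4 ^ i * \<bar>f x - f y\<bar>" .
  also have "\<dots> \<le> 4 ^ i * (4 * \<bar>x - y\<bar>)"
    using f_lipschitz[OF Suc.prems] by (intro mult_left_mono) auto
  finally show ?case by (simp add: funpow_swap1)
qed

lemma open_segment_I:
  assumes "x \<in> {c 2..c 1}" "y \<in> {c 2..c 1}" "z \<in> open_segment x y"
  shows "z \<in> {c 2..c 1}"
  using assms by (auto simp: open_segment_real)

text \<open>At time \<open>n\<close> the point \<open>u\<close> sits at a critical value of a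
  cutting time, hence at distance at least \<delta> from the image 0 of \<open>z\<close>. At time
  \<open>n + i\<close> the same holds for \<open>e\<close> and \<open>w\<close>, and pulling back
  gives \<eta>.\<close>

lemma release_interval_space:
  assumes "release_interval n i z w"
  obtains u e where "ordered4 u z w e" "zero_free b n (open_segment u e)"
    "u \<in> {c 2..c 1}" "e \<in> {c 2..c 1}" "(f ^^ n) z = 0" "(f ^^ (n + i)) w = 0" "i = 1 \<or> i = 2"
    "\<eta> \<le> \<bar>(f ^^ n) u - (f ^^ n) z\<bar>" "\<eta> \<le> \<bar>(f ^^ n) w - (f ^^ n) e\<bar>" "\<delta> \<le> \<bar>(f ^^ n) w\<bar>"
    "zero_free b (Suc (n + i)) (open_segment z w)"
proof -
  from assms obtain k x y e j where br: "branch n k x y" and z: "z \<in> open_segment x y" "(f ^^ n) z = 0"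
    and e: "e = x \<and> j = k \<or> e = y \<and> j = Q k" and i: "i = S (Q (Suc j))"
    and w: "w \<in> open_segment z e" "(f ^^ (n + i)) w = 0"
    unfolding release_interval_def by blast
  note F = branch_facts[OF br]
  have i12: "i = 1 \<or> i = 2" using Q_cases[of "Suc j"] by (auto simp: i S_0 S_1)
  have e1: "e = x \<or> e = y" and e2: "(f ^^ n) e = c (S j)" using e F(6,7) by auto
  define u where "u = (if e = x then y else x)"
  have seg: "open_segment u e = open_segment x y"
    using e1 by (auto simp: u_def open_segment_commute)
  have uI: "u \<in> {c 2..c 1}" "e \<in> {c 2..c 1}" using F(2,3) e1 by (auto simp: u_def)
  have o: "ordered4 u z w e"
    using z(1) w(1) unfolding seg[symmetric] by (auto simp: ordered4_def open_segment_real)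
  have zI: "z \<in> {c 2..c 1}" using open_segment_I[OF F(2,3) z(1)] .
  have wI: "w \<in> {c 2..c 1}" using open_segment_I[OF zI uI(2) w(1)] .
  have iter: "(f ^^ (n + i)) t = (f ^^ i) ((f ^^ n) t)" for t i
    by (metis add.commute comp_apply funpow_add)
  have fu: "(f ^^ n) u = c (S j) \<or> (f ^^ n) u = c (S k) \<or> (f ^^ n) u = c (S (Q k))"
    using F(6,7) by (auto simp: u_def)
  then have "\<delta> \<le> \<bar>(f ^^ n) u\<bar>" using c_S_large by auto
  then have sp1: "\<eta> \<le> \<bar>(f ^^ n) u - (f ^^ n) z\<bar>" using z(2) \<eta>(2) by simp
  have le2: "(4::real) ^ i \<le> 16" using i12 by auto
  have "\<delta> \<le> \<bar>c (S (Suc j))\<bar>" by (rule c_S_large)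
  also have "c (S (Suc j)) = (f ^^ i) ((f ^^ n) e)" by (simp add: e2 f_c S_Suc i)
  also have "\<bar>\<dots>\<bar> = \<bar>(f ^^ i) ((f ^^ n) e) - (f ^^ i) ((f ^^ n) w)\<bar>"
    using w(2) by (simp add: iter)
  also have "\<dots> \<le> 4 ^ i * \<bar>(f ^^ n) e - (f ^^ n) w\<bar>"
    using funpow_I[OF uI(2)] funpow_I[OF wI] by (intro funpow_lipschitz I_bound)
  also have "\<dots> \<le> 16 * \<bar>(f ^^ n) e - (f ^^ n) w\<bar>" by (rule mult_right_mono[OF le2]) simp
  finally have sp2: "\<eta> \<le> \<bar>(f ^^ n) w - (f ^^ n) e\<bar>" by (simp add: \<eta>_def abs_minus_commute)
  have sp3: "\<delta> \<le> \<bar>(f ^^ n) w\<bar>"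
    by (rule zero_preimage_large[OF i12]) (use w(2) iter in simp)
  note ch = child[OF F(5) z e1 e2]
  have "(f ^^ (n + i)) z = c (S (Q (Suc j)))" using ch(4) i by simp
  then have last: "zero_free b (Suc (n + i)) (open_segment w z)"
    by (intro child(1)[OF ch(2)[folded i] w]) auto
  show ?thesis
    by (rule that[OF o F(5)[folded seg] uI z(2) w(2) i12 sp1 sp2 sp3 last[unfolded open_segment_commute[of w z]]])
qed

text \<open>The preimage of the segment between \<open>p\<close> and \<open>q\<close> splits the
  interval into three pieces. The outer two are controlled by \<open>koebe_half\<close> with
  constant \<open>4\<^sup>2\<close>, the middle one trivially with constant 4, and
  \<open>36 = 16 + 4 + 16\<close>.\<close>

lemma release_interval_koebe:
  assumes R: "release_interval n i z w" and pq: "p \<in> closed_segment 0 q" "p \<noteq> q" "q \<in> closed_segment 0 ((f ^^ n) w)"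
  obtains p' q' where "open_segment p' q' \<subseteq> open_segment z w"
    "(f ^^ n) ` open_segment p' q' = open_segment p q"
    "\<eta> / 36 * \<bar>p - q\<bar> * \<bar>z - w\<bar> \<le> \<bar>p' - q'\<bar>"
proof -
  from release_interval_space[OF R] obtain u e where o: "ordered4 u z w e"
    and nz: "zero_free b n (open_segment u e)" and I: "u \<in> {c 2..c 1}" "e \<in> {c 2..c 1}" and z: "(f ^^ n) z = 0"
    and sp: "\<eta> \<le> \<bar>(f ^^ n) u - (f ^^ n) z\<bar>" "\<eta> \<le> \<bar>(f ^^ n) w - (f ^^ n) e\<bar>" by metis
  have "open_segment z w \<subseteq> open_segment u e" using o by (auto simp: ordered4_def open_segment_real)
  then have nzw: "zero_free b n (open_segment z w)" using nz zero_free_subset by blast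
  from pq(3) funpow_closed_segment[OF nzw] obtain q' where q': "q' \<in> closed_segment z w" "(f ^^ n) q' = q"
    using z by (metis imageE)
  have "open_segment z q' \<subseteq> open_segment z w" using q'(1)
    by (auto simp: closed_segment_real open_segment_real)
  then have nzq: "zero_free b n (open_segment z q')" using nzw zero_free_subset by blast
  from pq(1) funpow_closed_segment[OF nzq] obtain p' where p': "p' \<in> closed_segment z q'" "(f ^^ n) p' = p"
    using z q'(2) by (metis imageE)
  have ne: "p' \<noteq> q'" using p' q' pq(2) by auto
  have sub: "open_segment p' q' \<subseteq> open_segment z w" using p'(1) q'(1)
    by (auto simp: closed_segment_real open_segment_real)
  have img: "(f ^^ n) ` open_segment p' q' = open_segment p q"
    using funpow_open_segment[of b n p' q'] sub nzw zero_free_subset p'(2) q'(2) by blast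
  have M: "\<bar>(f ^^ n) s - (f ^^ n) t\<bar> \<le> 4" if "s \<in> {c 2..c 1}" "t \<in> {c 2..c 1}" for s t
    using I_bound[OF funpow_I[OF that(1)], of n] I_bound[OF funpow_I[OF that(2)], of n] b_lt by linarith
  have cI: "z \<in> {c 2..c 1}" "w \<in> {c 2..c 1}" using o I by (auto simp: ordered4_def)
  then have I': "p' \<in> {c 2..c 1}" "q' \<in> {c 2..c 1}" using p'(1) q'(1) by (auto simp: closed_segment_real)
  have right: "\<bar>p - q\<bar> * \<eta> * \<bar>q' - w\<bar> \<le> 4\<^sup>2 * \<bar>p' - q'\<bar>"
  proof (cases "q' = w")
    case False
    then have "ordered4 p' q' w e" using o p'(1) q'(1) ne by (auto simp: ordered4_def closed_segment_real)
    moreover have "open_segment p' e \<subseteq> open_segment u e"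
      using o p'(1) q'(1) by (auto simp: ordered4_def closed_segment_real open_segment_real)
    ultimately show ?thesis
      using koebe_half[of p' q' w e b n 4 \<eta>] M[OF I'(1) I(2)] \<eta>(1) sp(2) nz p'(2) q'(2)
        zero_free_subset[OF nz, of "open_segment p' e" n] by simp
  qed simp
  have left: "\<bar>q - p\<bar> * \<eta> * \<bar>p' - z\<bar> \<le> 4\<^sup>2 * \<bar>q' - p'\<bar>"
  proof (cases "p' = z")
    case False
    then have "ordered4 q' p' z u" using o p'(1) q'(1) ne by (auto simp: ordered4_def closed_segment_real)
    moreover have "open_segment q' u \<subseteq> open_segment u e"
      using o p'(1) q'(1) by (auto simp: ordered4_def closed_segment_real open_segment_real)
    ultimately show ?thesis
      using koebe_half[of q' p' z u b n 4 \<eta>] M[OF I'(2) I(1)] \<eta>(1) sp(1) nz p'(2) q'(2)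
        zero_free_subset[OF nz, of "open_segment q' u" n] by (simp add: abs_minus_commute)
  qed simp
  have pqI: "\<bar>p - q\<bar> \<le> 4" using M[OF I'] p'(2) q'(2) by simp
  have "\<bar>p - q\<bar> * \<eta> \<le> 4 * 1" using pqI \<eta> by (intro mult_mono) auto
  then have mid: "\<bar>p - q\<bar> * \<eta> * \<bar>p' - q'\<bar> \<le> 4 * \<bar>p' - q'\<bar>" by (intro mult_right_mono) auto
  have "\<bar>z - w\<bar> = \<bar>p' - z\<bar> + \<bar>p' - q'\<bar> + \<bar>q' - w\<bar>"
    using p'(1) q'(1) by (auto simp: closed_segment_real)
  then have "\<bar>p - q\<bar> * \<eta> * \<bar>z - w\<bar> = \<bar>p - q\<bar> * \<eta> * \<bar>p' - z\<bar> + \<bar>p - q\<bar> * \<eta> * \<bar>p' - q'\<bar> + \<bar>p - q\<bar> * \<eta> * \<bar>q' - w\<bar>"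
    by (simp add: distrib_left)
  also have "\<dots> \<le> 36 * \<bar>p' - q'\<bar>"
    using left right mid by (simp add: abs_minus_commute)
  finally have "\<eta> / 36 * \<bar>p - q\<bar> * \<bar>z - w\<bar> \<le> \<bar>p' - q'\<bar>" by (simp add: mult_ac)
  with sub img show ?thesis by (rule that)
qed

lemma branch_step:
  assumes "branch n k x y" "t \<in> open_segment x y" "(f ^^ n) t \<noteq> 0"
  shows "\<exists>n' k' x' y'. branch n' k' x' y' \<and> t \<in> open_segment x' y' \<and> n < n' \<and> n' \<le> n + 2"
proof -
  note F = branch_facts[OF assms(1)]
  have "0 \<in> (f ^^ n) ` open_segment x y"
    using c_opposite[OF F(1)] funpow_open_segment[OF F(5)] F(6,7) by simp
  then obtain z where z: "z \<in> open_segment x y" "(f ^^ n) z = 0" by (metis imageE)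
  have s: "n < n + S (Q l)" "n + S (Q l) \<le> n + 2" for l using Q_le[of l] by (auto simp: S_Q)
  have "t \<noteq> z" using assms(3) z by auto
  then have "t \<in> open_segment x z \<or> t \<in> open_segment y z"
    using assms(2) z(1) by (auto simp: open_segment_real)
  then show ?thesis
    using branch.follow[OF assms(1) z] branch.release[OF assms(1) z] s by metis
qed

text \<open>Passing to a child advances the time by one or two, so no two consecutive times are
  skipped.\<close>

lemma branch_exists:
  assumes t: "t \<in> {c 2<..<c 1}" and nz: "\<And>i. (f ^^ i) t \<noteq> 0"
  shows "\<exists>n k x y. branch n k x y \<and> t \<in> open_segment x y \<and> N \<le> n \<and> n \<le> N + 1"
proof (induction N)
  case 0
  show ?case using branch.root t by (intro exI[of _ 0] exI) (auto simp: open_segment_real)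
next
  case (Suc N)
  then obtain n k x y where br: "branch n k x y" "t \<in> open_segment x y" "N \<le> n" "n \<le> N + 1" by blast
  show ?case
  proof (cases "n = N")
    case True
    with branch_step[OF br(1,2) nz] show ?thesis by (metis Suc_leI add_2_eq_Suc' add.commute plus_1_eq_Suc)
  next
    case False
    then have "n = Suc N" using br by simp
    with br show ?thesis by (intro exI[of _ n] exI[of _ k] exI[of _ x] exI[of _ y]) simp
  qed
qed

definition released :: "real \<Rightarrow> nat \<Rightarrow> bool" where
  "released t m \<longleftrightarrow> (\<exists>i z w. release_interval m i z w \<and> t \<in> open_segment z w)"

text \<open>Following adds the same amount to the time and to \<open>S k\<close>, so only a release
  needs an argument. There \<open>t\<close> lies between the last two cuts, and these bound a
  release interval.\<close>

lemma branch_released: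
  assumes "branch n k x y" "t \<in> open_segment x y"
  shows "n \<le> S k \<or> (\<exists>m. released t m \<and> m < n \<and> n \<le> m + S k + 2)"
  using assms
proof (induction arbitrary: t)
  case root
  then show ?case by simp
next
  case (follow n k x y z)
  have "t \<in> open_segment x y" using follow.prems follow.hyps(2) by (auto simp: open_segment_real)
  from follow.IH[OF this] show ?case by (auto simp: S_Suc)
next
  case (release n k x y z)
  have s: "S (Q l) \<le> 2" "0 < S (Q l)" for l using Q_le[of l] by (auto simp: S_Q)
  have t: "t \<in> open_segment z y" using release.prems by (simp add: open_segment_commute)
  \<comment> \<open>Unless the parent is the root, its second end point \<open>y\<close> is its
    latest cut point, made at the time \<open>m\<close> of the grandparent; \<open>y\<close> and the
    new cut \<open>z\<close> bound the release interval.\<close>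
  from release.hyps(1) show ?case
  proof cases
    case root
    then show ?thesis by (auto simp: Q_1 S_0 S_1)
  next
    case (follow m j y')
    have "release_interval m (S (Q (Suc j))) y z"
      unfolding release_interval_def
      using follow release.hyps(2,3)
      by (intro exI[of _ j] exI[of _ x] exI[of _ y'] exI[of _ x] exI[of _ j]) (simp add: open_segment_commute)
    then have "released t m" unfolding released_def using t by (auto simp: open_segment_commute)
    then show ?thesis using follow(1) s[of "Suc j"] s[of "Suc (Q k)"] S_ge[of "Suc (Q k)"]
      by (intro disjI2 exI[of _ m]) simp
  next
    case (release m j x')
    have "release_interval m (S (Q (Suc (Q j)))) y z"
      unfolding release_interval_def
      using release \<open>z \<in> open_segment x y\<close> \<open>(f ^^ n) z = 0\<close>
      by (intro exI[of _ j] exI[of _ x'] exI[of _ x] exI[of _ x] exI[of _ "Q j"]) (simp add: open_segment_commute)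
    then have "released t m" unfolding released_def using t by (auto simp: open_segment_commute)
    then show ?thesis using release(1) s[of "Suc (Q j)"] s[of "Suc (Q k)"] S_ge[of "Suc (Q k)"]
      by (intro disjI2 exI[of _ m]) simp
  qed
qed

lemma branch_shadow:
  assumes br: "branch n k x y" and t: "t \<in> open_segment x y" and j: "1 \<le> j" "j \<le> S k - 2"
  shows "sgn ((f ^^ (n - j)) t) = sgn (c (S k - j))"
proof -
  have h: "S k \<le> n + 2" "(f ^^ (n - j)) x = c (S k - j)" using branch_history[OF br] j by auto
  have "c (S k - j) \<noteq> 0" using j by (intro c_nonzero) simp
  then show ?thesis
    using sgn_funpow_endpoint[OF branch_facts(5)[OF br] t, of "n - j"] h j by simp
qed

section \<open>Absence of homtervals\<close>

text \<open>Without releases after \<open>N\<close> the height keeps pace with the time: the offset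
  \<open>D = n + 2 - S k\<close> stays at most \<open>N + 4\<close>. If each of these finitely many
  offsets failed at some index, a branch with a record longer than all these indices would give a
  contradiction.\<close>

lemma shadow_critical_orbit:
  assumes t: "t \<in> {c 2<..<c 1}" and nz: "\<And>i. (f ^^ i) t \<noteq> 0"
    and fin: "\<And>n. n \<ge> N \<Longrightarrow> \<not> released t n"
  shows "\<exists>D. \<forall>i. sgn ((f ^^ (i + D)) t) = sgn (c (i + 2))"
proof (rule ccontr)
  assume "\<not> ?thesis"
  then have "\<forall>D. \<exists>i. sgn ((f ^^ (i + D)) t) \<noteq> sgn (c (i + 2))" by blast
  then obtain I where I: "\<And>D. sgn ((f ^^ (I D + D)) t) \<noteq> sgn (c (I D + 2))" by metis
  define M where "M = Max (I ` {..N + 4})"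
  have IM: "I D \<le> M" if "D \<le> N + 4" for D using that by (auto simp: M_def)
  obtain n k x y where br: "branch n k x y" "t \<in> open_segment x y" "M + N + 10 \<le> n"
    using branch_exists[OF t nz, of "M + N + 10"] by blast
  have le: "n \<le> N + S k + 2"
    using branch_released[OF br(1,2)]
  proof (elim disjE exE conjE)
    fix m assume m: "released t m" "n \<le> m + S k + 2"
    then have "m < N" using fin not_le by blast
    with m show ?thesis by simp
  qed simp
  have hist: "S k \<le> n + 2" using branch_history[OF br(1)] by blast
  define D where "D = n + 2 - S k"
  have D: "D \<le> N + 4" using le by (simp add: D_def)
  define j where "j = S k - (I D + 2)"
  have Sk: "M + 4 < S k" using le br(3) by simp
  have j: "1 \<le> j" "j \<le> S k - 2" "S k - j = I D + 2" "n - j = I D + D"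
    using IM[OF D] Sk hist by (auto simp: j_def D_def)
  from branch_shadow[OF br(1,2) j(1,2)] I[of D] show False by (simp add: j(3,4))
qed

text \<open>\<open>koebe_space\<close> bounds the product of the two outer gaps below by
  \<open>4 * \<xi>\<close>. Each gap is at most 4, so each is at least \<xi>; this explains
  \<open>64 = 16 * 4\<close>.\<close>

lemma release_interval_extend:
  assumes R: "release_interval n i z w" and h: "h1 < h2" "{h1<..<h2} \<subseteq> open_segment z w"
    and \<xi>: "\<xi> \<le> (h2 - h1)\<^sup>2 * \<eta>\<^sup>2 / 64"
  shows "zero_free b n {h1 - \<xi><..<h2 + \<xi>}" "{h1 - \<xi><..<h2 + \<xi>} \<subseteq> {c 2..c 1}"
proof -
  from release_interval_space[OF R] obtain u e where o: "ordered4 u z w e"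
    and nz: "zero_free b n (open_segment u e)" and I: "u \<in> {c 2..c 1}" "e \<in> {c 2..c 1}" and z: "(f ^^ n) z = 0"
    and sp: "\<eta> \<le> \<bar>(f ^^ n) u - (f ^^ n) z\<bar>" "\<eta> \<le> \<bar>(f ^^ n) w - (f ^^ n) e\<bar>" by metis
  have M: "\<bar>s - t\<bar> \<le> 4" if "s \<in> {c 2..c 1}" "t \<in> {c 2..c 1}" for s t
    using I_bound[OF that(1)] I_bound[OF that(2)] b_lt by linarith
  have "\<bar>z - w\<bar>\<^sup>2 * \<eta>\<^sup>2 \<le> 4\<^sup>2 * (\<bar>u - z\<bar> * \<bar>w - e\<bar>)"
    by (rule koebe_space[OF o nz M \<eta>(1) sp(2,1)]) (use funpow_I I in blast)+
  moreover have "h2 - h1 \<le> \<bar>z - w\<bar>" and zw: "min z w \<le> h1" "h2 \<le> max z w"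
  proof -
    have "open_segment z w = {min z w<..<max z w}" by (auto simp: open_segment_real min_def max_def)
    then have "{h1<..<h2} \<subseteq> {min z w<..<max z w}" using h(2) by simp
    then show 1: "min z w \<le> h1" "h2 \<le> max z w"
      using h(1) unfolding greaterThanLessThan_subseteq_greaterThanLessThan by auto
    then show "h2 - h1 \<le> \<bar>z - w\<bar>" by (auto simp: min_def max_def split: if_splits)
  qed
  then have "(h2 - h1)\<^sup>2 \<le> \<bar>z - w\<bar>\<^sup>2" using h(1) by (intro power_mono) auto
  then have "(h2 - h1)\<^sup>2 * \<eta>\<^sup>2 \<le> \<bar>z - w\<bar>\<^sup>2 * \<eta>\<^sup>2" by (rule mult_right_mono) simp
  ultimately have "64 * \<xi> \<le> 16 * (\<bar>u - z\<bar> * \<bar>w - e\<bar>)" using \<xi> by simp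
  then have prod: "4 * \<xi> \<le> \<bar>u - z\<bar> * \<bar>w - e\<bar>" by simp
  have zwI: "z \<in> {c 2..c 1}" "w \<in> {c 2..c 1}" using o I by (auto simp: ordered4_def)
  have "\<bar>u - z\<bar> * \<bar>w - e\<bar> \<le> \<bar>u - z\<bar> * 4" using M[OF zwI(2) I(2)] by (rule mult_left_mono) simp
  from order_trans[OF prod this] have s1: "\<xi> \<le> \<bar>u - z\<bar>" by simp
  have "\<bar>u - z\<bar> * \<bar>w - e\<bar> \<le> 4 * \<bar>w - e\<bar>" using M[OF I(1) zwI(1)] by (rule mult_right_mono) simp
  from order_trans[OF prod this] have s2: "\<xi> \<le> \<bar>w - e\<bar>" by simp
  have sub: "{h1 - \<xi><..<h2 + \<xi>} \<subseteq> open_segment u e"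
  proof
    fix t assume t: "t \<in> {h1 - \<xi><..<h2 + \<xi>}"
    show "t \<in> open_segment u e"
      using o unfolding ordered4_def
    proof
      assume "u < z \<and> z < w \<and> w < e"
      then show ?thesis using t s1 s2 zw by (auto simp: open_segment_real)
    next
      assume "z < u \<and> w < z \<and> e < w"
      then show ?thesis using t s1 s2 zw by (auto simp: open_segment_real)
    qed
  qed
  show "zero_free b n {h1 - \<xi><..<h2 + \<xi>}" by (rule zero_free_subset[OF nz sub order_refl])
  show "{h1 - \<xi><..<h2 + \<xi>} \<subseteq> {c 2..c 1}" using sub open_segment_I[OF I] by blast
qed

definition homterval :: "real \<Rightarrow> real \<Rightarrow> bool" where
  "homterval u v \<longleftrightarrow> u < v \<and> {u<..<v} \<subseteq> {c 2..c 1} \<and> (\<forall>t\<in>{u<..<v}. \<forall>i. (f ^^ i) t \<noteq> 0)"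

lemma homterval_in_release_interval:
  assumes "homterval u v" "t \<in> {u<..<v}" "t \<in> open_segment z w" "(f ^^ m) z = 0" "(f ^^ n) w = 0"
  shows "{u<..<v} \<subseteq> open_segment z w"
proof -
  have "z \<notin> {u<..<v}" "w \<notin> {u<..<v}" using assms unfolding homterval_def by blast+
  with assms(2,3) show ?thesis by (auto simp: open_segment_real)
qed

text \<open>A release interval around \<open>t\<close> contains the whole homterval, as its ends are
  zeros of iterates. It can then be widened by \<xi> on both sides, and releases at arbitrarily late
  times keep the wider interval free of zeros for ever. Lengths only grow, so the same \<xi> serves
  again and again until the interval outgrows its bounded range.\<close>

lemma homterval_finitely_released:
  assumes h: "homterval u v" and t: "t \<in> {u<..<v}"
  shows "\<exists>N. \<forall>n\<ge>N. \<not> released t n"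
proof (rule ccontr)
  assume "\<not> ?thesis"
  then have inf: "\<forall>N. \<exists>n\<ge>N. released t n" by blast
  define \<xi> where "\<xi> = (v - u)\<^sup>2 * \<eta>\<^sup>2 / 64"
  have uv: "u < v" using h by (simp add: homterval_def)
  have \<xi>: "0 < \<xi>" using uv \<eta>(1) by (simp add: \<xi>_def)
  have ext: "homterval (u - real m * \<xi>) (v + real m * \<xi>)" for m
  proof (induction m)
    case 0
    show ?case using h by simp
  next
    case (Suc m)
    let ?u = "u - real m * \<xi>" and ?v = "v + real m * \<xi>"
    have m: "0 \<le> real m * \<xi>" using \<xi> by simp
    have t': "t \<in> {?u<..<?v}" using t m unfolding greaterThanLessThan_iff by linarith
    have "(v - u)\<^sup>2 \<le> (?v - ?u)\<^sup>2" by (rule power_mono) (use uv m in linarith)+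
    then have "(v - u)\<^sup>2 * \<eta>\<^sup>2 / 64 \<le> (?v - ?u)\<^sup>2 * \<eta>\<^sup>2 / 64"
      by (intro divide_right_mono mult_right_mono) auto
    then have \<xi>': "\<xi> \<le> (?v - ?u)\<^sup>2 * \<eta>\<^sup>2 / 64" by (simp only: \<xi>_def)
    have uv': "?u < ?v" using uv m by linarith
    have *: "zero_free b n {?u - \<xi><..<?v + \<xi>} \<and> {?u - \<xi><..<?v + \<xi>} \<subseteq> {c 2..c 1}" if "released t n" for n
    proof -
      from that obtain i z w where R: "release_interval n i z w" and tzw: "t \<in> open_segment z w"
        unfolding released_def by blast
      have "(f ^^ n) z = 0" "(f ^^ (n + i)) w = 0" using release_interval_space[OF R] by metis+
      then have sub: "{?u<..<?v} \<subseteq> open_segment z w"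
        using homterval_in_release_interval[OF Suc.IH t' tzw] by blast
      from release_interval_extend[OF R uv' sub \<xi>'] show ?thesis by blast
    qed
    have "(f ^^ i) s \<noteq> 0" if s: "s \<in> {?u - \<xi><..<?v + \<xi>}" for s i
    proof -
      obtain n where "n \<ge> Suc i" "released t n" using inf by blast
      with *[of n] s show ?thesis unfolding zero_free_def by auto
    qed
    moreover obtain n where "released t n" using inf by blast
    ultimately have "homterval (?u - \<xi>) (?v + \<xi>)"
      using *[of n] uv' \<xi> unfolding homterval_def by simp
    then show ?case by (simp add: algebra_simps)
  qed
  obtain m :: nat where m: "4 < real m * \<xi>" using reals_Archimedean3[OF \<xi>] by blast
  have "{u - real m * \<xi><..<v + real m * \<xi>} \<subseteq> {c 2..c 1}" using ext[of m] by (simp add: homterval_def)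
  moreover have "u \<in> {u - real m * \<xi><..<v + real m * \<xi>}" "u + 4 \<in> {u - real m * \<xi><..<v + real m * \<xi>}"
    using m uv by auto
  ultimately have "\<bar>u\<bar> \<le> b" "\<bar>u + 4\<bar> \<le> b" using I_bound by blast+
  with b_lt show False by linarith
qed

text \<open>An interval without zeros of iterates would follow the critical orbit from some time on, and so
  would have to lie next to \<open>c 3\<close>. Applying the same to points next to \<open>c 3\<close> makes the kneading
  sequence periodic.\<close>

lemma no_homterval: "\<not> homterval u v"
proof
  assume h: "homterval u v"
  then have uv: "u < v" and nzh: "\<And>t i. t \<in> {u<..<v} \<Longrightarrow> (f ^^ i) t \<noteq> 0" and I: "{u<..<v} \<subseteq> {c 2..c 1}"
    by (auto simp: homterval_def)
  have inner: "{s<..<r} \<subseteq> {c 2<..<c 1}" if "{s<..<r} \<subseteq> {c 2..c 1}" for s r :: real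
  proof
    fix t assume t: "t \<in> {s<..<r}"
    have "(s + t) / 2 \<in> {s<..<r}" "(t + r) / 2 \<in> {s<..<r}" using t by auto
    then have "(s + t) / 2 \<in> {c 2..c 1}" "(t + r) / 2 \<in> {c 2..c 1}" using that by blast+
    with t show "t \<in> {c 2<..<c 1}" by auto
  qed
  define p where "p = (u + v) / 2"
  define q where "q = (u + p) / 2"
  have p: "p \<in> {u<..<v}" and q: "q \<in> {u<..<v}" and qp: "q < p" using uv by (auto simp: p_def q_def field_simps)
  obtain N where "\<And>n. n \<ge> N \<Longrightarrow> \<not> released p n" using homterval_finitely_released[OF h p] by blast
  from shadow_critical_orbit[OF _ nzh[OF p] this] p inner[OF I]
  obtain D where D: "\<And>i. sgn ((f ^^ (i + D)) p) = sgn (c (i + 2))" by blast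
  have seg: "open_segment q p \<subseteq> {u<..<v}"
    using p q by (auto simp: open_segment_real)
  have nzqp: "zero_free b n (open_segment p q)" for n
    using seg nzh unfolding zero_free_def open_segment_commute[of p q] by blast
  have sgn_q: "sgn ((f ^^ i) q) = sgn ((f ^^ i) p)" for i
  proof -
    have "\<not> (0 \<in> open_segment ((f ^^ i) p) ((f ^^ i) q))"
      using funpow_open_segment[OF nzqp[of i]] nzqp[of "Suc i"] unfolding zero_free_def
      by (metis imageE lessI)
    from one_sided[OF this] nzh[OF p, of i] nzh[OF q, of i] show ?thesis by (auto simp: sgn_if)
  qed
  have "(f ^^ (D + 1)) p \<noteq> (f ^^ (D + 1)) q"
    using funpow_inj_on[OF nzqp[of "D + 1"]] qp by (metis ends_in_segment inj_onD less_irrefl)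
  \<comment> \<open>Two points have different images, so one of them misses \<open>c 3\<close>.
    Index 3 instead of 2 matters: it makes the period found at the end \<open>D' + 1\<close>, which
    cannot be 0.\<close>
  then obtain s where s: "s = p \<or> s = q" and s3: "(f ^^ (D + 1)) s \<noteq> c 3" by metis
  define y where "y = (f ^^ (D + 1)) s"
  have y_sgn: "sgn ((f ^^ i) y) = sgn (c (i + 3))" for i
  proof -
    have "(f ^^ i) y = (f ^^ (i + (D + 1))) s" unfolding y_def by (simp only: funpow_add comp_apply)
    also have "i + (D + 1) = (i + 1) + D" by simp
    finally have "sgn ((f ^^ i) y) = sgn ((f ^^ ((i + 1) + D)) p)" using s sgn_q by metis
    also have "\<dots> = sgn (c (i + 1 + 2))" by (rule D)
    also have "i + 1 + 2 = i + 3" by simp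
    finally show ?thesis .
  qed
  have yne: "y \<noteq> c 3" using s3 by (simp add: y_def)
  have c3: "sgn ((f ^^ i) (c 3)) = sgn (c (i + 3)) \<and> (f ^^ i) (c 3) \<noteq> 0" for i
    using c_nonzero[of "3 + i"] by (simp add: f_c add.commute)
  have nzJ: "zero_free b n (open_segment (c 3) y)" for n
    by (rule zero_free_if_same_sgn) (use c3 y_sgn in auto)
  have yI: "y \<in> {c 2..c 1}" unfolding y_def using s p q I funpow_I by blast
  have J: "{min y (c 3)<..<max y (c 3)} = open_segment (c 3) y"
    by (auto simp: open_segment_real min_def max_def)
  have hJ: "homterval (min y (c 3)) (max y (c 3))"
    unfolding homterval_def J
  proof (intro conjI ballI allI)
    show "min y (c 3) < max y (c 3)" using yne by (auto simp: min_def max_def)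
    show "open_segment (c 3) y \<subseteq> {c 2..c 1}" using open_segment_I[OF c_I[of 3] yI] by auto
    show "(f ^^ i) t \<noteq> 0" if "t \<in> open_segment (c 3) y" for t i
      using that nzJ[of "Suc i"] unfolding zero_free_def by auto
  qed
  define r where "r = (c 3 + y) / 2"
  have r: "r \<in> open_segment (c 3) y" using yne by (auto simp: r_def open_segment_real)
  have r_sgn: "sgn ((f ^^ i) r) = sgn (c (i + 3))" for i
    using sgn_funpow_endpoint[OF nzJ[of "Suc i"] r, of i] c3[of i] by auto
  have rJ: "r \<in> {min y (c 3)<..<max y (c 3)}" unfolding J by (rule r)
  obtain N' where "\<And>n. n \<ge> N' \<Longrightarrow> \<not> released r n" using homterval_finitely_released[OF hJ rJ] by blast
  moreover have "r \<in> {c 2<..<c 1}" using hJ rJ inner unfolding homterval_def by blast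
  moreover have "\<And>i. (f ^^ i) r \<noteq> 0" using hJ rJ unfolding homterval_def by blast
  ultimately obtain D' where D': "\<And>i. sgn ((f ^^ (i + D')) r) = sgn (c (i + 2))"
    using shadow_critical_orbit by blast
  \<comment> \<open>\<open>r\<close> has the signs of the orbit of \<open>c 3\<close> from the
    start, and those of the orbit of \<open>c 2\<close> from time \<open>D'\<close> on.\<close>
  have "sgn (c (l + (D' + 1))) = sgn (c l)" if l: "2 \<le> l" for l
  proof -
    have "sgn (c (l - 2 + 2)) = sgn (c (l - 2 + D' + 3))" using D'[of "l - 2"] r_sgn[of "l - 2 + D'"] by argo
    moreover have "l - 2 + D' + 3 = l + (D' + 1)" "l - 2 + 2 = l" using l by simp_all
    ultimately show ?thesis by metis
  qed
  moreover obtain l where "l \<ge> 2" "sgn (c (l + (D' + 1))) \<noteq> sgn (c l)"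
    using crit_aperiodic[of "D' + 1"] by (auto simp: c_def)
  ultimately show False by blast
qed

text \<open>Compactness. Midpoints of long zero-free intervals accumulate at some \<open>l\<close>;
  an interval of length at least \<open>d\<close> whose midpoint is within \<open>d / 4\<close> of
  \<open>l\<close> covers the \<open>d / 4\<close>-neighbourhood of \<open>l\<close>, which would be
  a homterval.\<close>

lemma short_branches:
  assumes d: "0 < d"
  obtains M where "\<And>u v. u < v \<Longrightarrow> {u<..<v} \<subseteq> {c 2..c 1} \<Longrightarrow> zero_free b M {u<..<v} \<Longrightarrow> v - u < d"
proof (rule ccontr)
  assume "\<not> thesis"
  then have "\<forall>M. \<exists>u v. u < v \<and> {u<..<v} \<subseteq> {c 2..c 1} \<and> zero_free b M {u<..<v} \<and> d \<le> v - u"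
    using that by (metis not_le)
  then obtain u v where uv: "\<And>M. u M < v M" "\<And>M. {u M<..<v M} \<subseteq> {c 2..c 1}"
    "\<And>M. zero_free b M {u M<..<v M}" "\<And>M. d \<le> v M - u M" by metis
  define p where "p M = (u M + v M) / 2" for M
  have pI: "p M \<in> {u M<..<v M}" for M using uv(1)[of M] by (simp add: p_def)
  then have "\<forall>M. p M \<in> {c 2..c 1}" using uv(2) by blast
  then obtain l r where l: "l \<in> {c 2..c 1}" and r: "strict_mono (r :: nat \<Rightarrow> nat)" "(p \<circ> r) \<longlonglongrightarrow> l"
    using compact_Icc[of "c 2" "c 1"] unfolding compact_def by metis
  from r(2) have "\<forall>\<^sub>F M in sequentially. dist ((p \<circ> r) M) l < d / 4"
    by (rule tendstoD) (use d in simp)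
  then obtain K where K: "\<And>M. M \<ge> K \<Longrightarrow> \<bar>p (r M) - l\<bar> < d / 4"
    by (auto simp: eventually_sequentially dist_real_def)
  have sub: "{l - d / 4<..<l + d / 4} \<subseteq> {u (r M)<..<v (r M)}" if "M \<ge> K" for M
  proof
    fix t assume "t \<in> {l - d / 4<..<l + d / 4}"
    then have "\<bar>t - p (r M)\<bar> < d / 2" using K[OF that] unfolding greaterThanLessThan_iff by linarith
    then show "t \<in> {u (r M)<..<v (r M)}"
      using uv(4)[of "r M"] by (auto simp: p_def abs_less_iff field_simps)
  qed
  have "homterval (l - d / 4) (l + d / 4)"
    unfolding homterval_def
  proof (intro conjI ballI allI)
    show "l - d / 4 < l + d / 4" using d by simp
    show "{l - d / 4<..<l + d / 4} \<subseteq> {c 2..c 1}" using sub[of K] uv(2)[of "r K"] by blast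
    fix t i assume t: "t \<in> {l - d / 4<..<l + d / 4}"
    define M where "M = max K (Suc i)"
    have "i < r M" using seq_suble[OF r(1), of M] by (simp add: M_def)
    with t sub[of M] uv(3)[of "r M"] show "(f ^^ i) t \<noteq> 0"
      unfolding zero_free_def by (auto simp: M_def)
  qed
  with no_homterval show False by blast
qed

end

section \<open>Measure-theoretic lemmas\<close>

text \<open>Every interval that occurs lies in \<open>{-2..2}\<close>; truncating Lebesgue measure makes it finite.\<close>

definition leb :: "real measure" where
  "leb = density lborel (indicator {-9..9})"

lemma sets_leb [simp, measurable_cong]: "sets leb = sets borel"
  by (simp add: leb_def)

lemma space_leb [simp]: "space leb = UNIV"
  by (simp add: leb_def)

lemma emeasure_leb: "A \<in> sets borel \<Longrightarrow> emeasure leb A = emeasure lborel ({-9..9} \<inter> A)"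
  unfolding leb_def by (rule emeasure_restricted) simp_all

lemma finite_measure_leb: "finite_measure leb"
  by (rule finite_measureI) (simp add: emeasure_leb)

interpretation leb: finite_measure leb
  by (rule finite_measure_leb)

lemma measure_leb_interval: "-9 \<le> u \<Longrightarrow> u \<le> v \<Longrightarrow> v \<le> 9 \<Longrightarrow> measure leb {u<..<v} = v - u"
proof -
  assume *: "-9 \<le> u" "u \<le> v" "v \<le> 9"
  then have "{-9..9} \<inter> {u<..<v} = {u<..<v}" by auto
  with * show ?thesis by (simp add: measure_def emeasure_leb)
qed

lemma open_segment_min_max: "open_segment u v = {min u v<..<max u (v::real)}"
  by (auto simp: open_segment_real min_def max_def)

lemma measure_leb_open_segment:
  assumes "\<bar>u\<bar> \<le> 9" "\<bar>v\<bar> \<le> 9"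
  shows "measure leb (open_segment u v) = \<bar>u - v\<bar>"
  using assms unfolding open_segment_min_max
  by (subst measure_leb_interval) (auto simp: min_def max_def)

lemma open_segment_borel [measurable, simp]: "open_segment u (v::real) \<in> sets borel"
  by (simp add: open_segment_min_max)

lemma leb_compact_nbhd:
  assumes C: "compact C" and \<eta>: "0 < \<eta>"
  obtains d where "0 < d" "measure leb ((\<Union>x\<in>C. ball x d) - C) < \<eta>"
proof -
  define N where "N n = (\<Union>x\<in>C. ball x (1 / real (Suc n)))" for n
  have N: "open (N n)" for n by (auto simp: N_def)
  have C': "C \<in> sets borel" using C by (simp add: borel_compact)
  have "decseq N"
    unfolding N_def decseq_def
    by (intro allI impI UN_mono subset_ball) (auto simp: frac_le)
  then have dec: "decseq (\<lambda>n. N n - C)" by (auto simp: decseq_def)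
  have E: "(\<Inter>n. N n - C) = {}"
  proof (rule ccontr)
    assume "\<not> ?thesis"
    then obtain t where t: "\<And>n. t \<in> N n" "t \<notin> C" by blast
    have "\<exists>x\<in>C. dist x t < e" if e: "e > 0" for e
    proof -
      obtain n where "1 / real (Suc n) < e" using nat_approx_posE[OF e] by metis
      with t(1)[of n] show ?thesis by (force simp: N_def)
    qed
    then have "t \<in> closure C" by (simp add: closure_approachable)
    with t(2) C show False by (simp add: compact_imp_closed)
  qed
  have "(\<lambda>n. measure leb (N n - C)) \<longlonglongrightarrow> measure leb (\<Inter>n. N n - C)"
    by (rule leb.finite_Lim_measure_decseq[OF _ dec]) (use N C' in auto)
  then have "(\<lambda>n. measure leb (N n - C)) \<longlonglongrightarrow> 0" unfolding E by simp
  then have "\<forall>\<^sub>F n in sequentially. measure leb (N n - C) < \<eta>" using \<eta> by (rule order_tendstoD(2))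
  then obtain n where "measure leb (N n - C) < \<eta>" by (auto simp: eventually_sequentially)
  then show ?thesis by (intro that[of "1 / real (Suc n)"]) (auto simp: N_def)
qed

text \<open>Approximate \<open>A\<close> from inside by a compact set: the members of the family that meet it lie in a
  neighbourhood of almost the same measure.\<close>

lemma proportion_lower_bound:
  assumes A: "A \<in> sets borel" and \<kappa>: "0 < \<kappa>" "\<kappa> \<le> 1" and \<eta>: "0 < \<eta>"
  obtains d where "0 < d"
    "\<And>F h. finite F \<Longrightarrow> disjoint F \<Longrightarrow> (\<And>G. G \<in> F \<Longrightarrow> G \<in> sets borel \<and> h G \<in> sets borel \<and> h G \<subseteq> G \<and>
        \<kappa> * measure leb G \<le> measure leb (h G) \<and> (\<forall>x\<in>G. \<forall>y\<in>G. dist x y < d)) \<Longrightarrow>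
      \<kappa> * measure leb (A \<inter> \<Union>F) - \<eta> \<le> measure leb (A \<inter> (\<Union>G\<in>F. h G))"
proof -
  have "\<exists>C. compact C \<and> C \<subseteq> A \<and> measure leb A - \<eta> / 2 < measure leb C"
  proof (rule ccontr)
    assume "\<not> ?thesis"
    then have le: "measure leb C \<le> measure leb A - \<eta> / 2" if "compact C" "C \<subseteq> A" for C
      using that by (metis not_less)
    have "emeasure leb A = (SUP C\<in>{K. K \<subseteq> A \<and> compact K}. emeasure leb C)"
      by (rule inner_regular) (use A leb.emeasure_finite in auto)
    also have "\<dots> \<le> ennreal (measure leb A - \<eta> / 2)"
      using le by (intro SUP_least) (auto simp: leb.emeasure_eq_measure intro!: ennreal_leI)
    finally have "ennreal (measure leb A) \<le> ennreal (measure leb A - \<eta> / 2)"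
      by (simp add: leb.emeasure_eq_measure)
    moreover have "0 \<le> measure leb A - \<eta> / 2" using le[of "{}"] by simp
    ultimately show False using \<eta> by simp
  qed
  then obtain C where C: "compact C" "C \<subseteq> A" "measure leb A - \<eta> / 2 < measure leb C" by blast
  have "0 < \<eta> / 2" using \<eta> by simp
  from leb_compact_nbhd[OF C(1) this]
  obtain d where d: "0 < d" "measure leb ((\<Union>x\<in>C. ball x d) - C) < \<eta> / 2" .
  define W where "W = (\<Union>x\<in>C. ball x d)"
  have C': "C \<in> sets borel" and W': "W \<in> sets borel" using C(1) by (simp_all add: borel_compact W_def borel_open open_UN)
  show ?thesis
  proof (rule that[OF d(1)])
    fix F :: "real set set" and h
    assume F: "finite F" "disjoint F" and G: "\<And>G. G \<in> F \<Longrightarrow> G \<in> sets borel \<and> h G \<in> sets borel \<and> h G \<subseteq> G \<and>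
        \<kappa> * measure leb G \<le> measure leb (h G) \<and> (\<forall>x\<in>G. \<forall>y\<in>G. dist x y < d)"
    \<comment> \<open>A member missing \<open>C\<close> contributes nothing. A member meeting
      \<open>C\<close> lies in \<open>W\<close> since its diameter is small, and its error is its
      share of \<open>W - C\<close>; by disjointness these shares add up to less than
      \<open>\<eta> / 2\<close>.\<close>
    have one: "\<kappa> * measure leb (C \<inter> G) - measure leb ((W - C) \<inter> G) \<le> measure leb (C \<inter> h G)"
      if "G \<in> F" for G
    proof (cases "C \<inter> G = {}")
      case True
      then have z: "measure leb (C \<inter> G) = 0" by simp
      show ?thesis unfolding z
        using measure_nonneg[of leb "(W - C) \<inter> G"] measure_nonneg[of leb "C \<inter> h G"] by linarith
    next
      case False
      note g = G[OF that]
      have GO: "G - C \<subseteq> (W - C) \<inter> G"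
      proof
        fix x assume x: "x \<in> G - C"
        obtain y where "y \<in> C" "y \<in> G" using False by blast
        then have "x \<in> W" using g x unfolding W_def by (intro UN_I[of y]) auto
        with x show "x \<in> (W - C) \<inter> G" by blast
      qed
      have "measure leb (h G) = measure leb (C \<inter> h G) + measure leb (h G - C)"
      proof -
        have "h G = (C \<inter> h G) \<union> (h G - C)" by blast
        also have "measure leb \<dots> = measure leb (C \<inter> h G) + measure leb (h G - C)"
          using g C' by (intro leb.finite_measure_Union) auto
        finally show ?thesis .
      qed
      moreover have "measure leb (h G - C) \<le> measure leb ((W - C) \<inter> G)"
        using g GO C' W' by (intro leb.finite_measure_mono) auto
      moreover have "\<kappa> * measure leb (C \<inter> G) \<le> \<kappa> * measure leb G"
        using g C' \<kappa> by (intro mult_left_mono leb.finite_measure_mono) auto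
      ultimately show ?thesis using g by linarith
    qed
    have U: "measure leb (E \<inter> (\<Union>G\<in>F. k G)) = (\<Sum>G\<in>F. measure leb (E \<inter> k G))"
      if E: "E \<in> sets borel" and k: "\<And>G. G \<in> F \<Longrightarrow> k G \<in> sets borel \<and> k G \<subseteq> G" for E k
    proof -
      have "disjoint_family_on (\<lambda>G. E \<inter> k G) F"
        using F(2) k unfolding disjoint_family_on_def disjoint_def by blast
      moreover have "E \<inter> k G \<in> sets borel" if "G \<in> F" for G using k that E by auto
      then have "(\<lambda>G. E \<inter> k G) ` F \<subseteq> sets leb" by auto
      ultimately have "measure leb (\<Union>G\<in>F. E \<inter> k G) = (\<Sum>G\<in>F. measure leb (E \<inter> k G))"
        using leb.finite_measure_finite_Union[OF F(1)] by blast
      moreover have "(\<Union>G\<in>F. E \<inter> k G) = E \<inter> (\<Union>G\<in>F. k G)" by blast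
      ultimately show ?thesis by simp
    qed
    have "\<kappa> * measure leb (A \<inter> \<Union>F) - \<eta> / 2 \<le> \<kappa> * measure leb (C \<inter> \<Union>F)"
    proof -
      have UF: "\<Union>F \<in> sets borel" using F(1) G by (intro sets.finite_Union) auto
      have "measure leb (A \<inter> \<Union>F) \<le> measure leb (C \<inter> \<Union>F) + measure leb (A - C)"
      proof -
        have "measure leb (A \<inter> \<Union>F) \<le> measure leb (C \<inter> \<Union>F \<union> (A - C))"
          using A C' UF by (intro leb.finite_measure_mono) auto
        also have "\<dots> \<le> measure leb (C \<inter> \<Union>F) + measure leb (A - C)"
          using A C' UF by (intro measure_Un_le) auto
        finally show ?thesis .
      qed
      moreover have "measure leb (A - C) \<le> \<eta> / 2"
        using leb.finite_measure_Diff[of A C] A C C' by simp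
      ultimately have "measure leb (A \<inter> \<Union>F) - measure leb (C \<inter> \<Union>F) \<le> \<eta> / 2" by linarith
      then have "\<kappa> * (measure leb (A \<inter> \<Union>F) - measure leb (C \<inter> \<Union>F)) \<le> 1 * (\<eta> / 2)"
        using \<kappa> \<eta> by (intro order_trans[OF mult_left_mono mult_right_mono]) auto
      then show ?thesis by (simp add: right_diff_distrib)
    qed
    also have "\<kappa> * measure leb (C \<inter> \<Union>F) - \<eta> / 2 \<le> measure leb (C \<inter> (\<Union>G\<in>F. h G))"
    proof -
      have "(\<Sum>G\<in>F. \<kappa> * measure leb (C \<inter> G) - measure leb ((W - C) \<inter> G)) \<le> (\<Sum>G\<in>F. measure leb (C \<inter> h G))"
        by (rule sum_mono[OF one])
      then have "\<kappa> * measure leb (C \<inter> \<Union>F) - measure leb ((W - C) \<inter> \<Union>F) \<le> measure leb (C \<inter> (\<Union>G\<in>F. h G))"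
        using U[of C "\<lambda>G. G"] U[of "W - C" "\<lambda>G. G"] U[of C h] C' W' G
        by (simp add: sum_subtractf sum_distrib_left)
      moreover have "measure leb ((W - C) \<inter> \<Union>F) \<le> measure leb (W - C)"
        using W' C' by (intro leb.finite_measure_mono) auto
      ultimately show ?thesis using d(2) by (simp add: W_def)
    qed
    also have "measure leb (C \<inter> (\<Union>G\<in>F. h G)) \<le> measure leb (A \<inter> (\<Union>G\<in>F. h G))"
      using C(2) A F(1) G by (intro leb.finite_measure_mono) auto
    finally show "\<kappa> * measure leb (A \<inter> \<Union>F) - \<eta> \<le> measure leb (A \<inter> (\<Union>G\<in>F. h G))" by simp
  qed
qed

text \<open>The Radon-Nikodym density is positive and finite up to a \<mu>-null set, so the sets
  where it lies between \<open>1 / Suc n\<close> and \<open>Suc n\<close> exhaust the mass.\<close>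

lemma density_sandwich:
  assumes fin: "prob_space \<mu>" and sets: "sets \<mu> = sets borel" and ac: "absolutely_continuous leb \<mu>"
    and \<theta>: "0 < \<theta>"
  obtains A l L where "A \<in> sets borel" "0 < l" "0 < L" "measure \<mu> (- A) < \<theta>"
    "\<And>B. B \<in> sets borel \<Longrightarrow> B \<subseteq> A \<Longrightarrow> l * measure leb B \<le> measure \<mu> B \<and> measure \<mu> B \<le> L * measure leb B"
proof -
  interpret \<mu>: prob_space \<mu> by fact
  have sp: "space \<mu> = UNIV" using sets_eq_imp_space_eq[OF sets] by simp
  obtain g where g: "g \<in> borel_measurable leb" "density leb g = \<mu>"
    using leb.Radon_Nikodym[OF ac] sets by auto
  have g' [measurable]: "g \<in> borel_measurable borel" using g(1) by simp
  have em: "emeasure \<mu> B = (\<integral>\<^sup>+x. g x * indicator B x \<partial>leb)" if "B \<in> sets borel" for B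
    using that unfolding g(2)[symmetric] by (subst emeasure_density) auto
  define A where "A n = {x. g x \<le> ennreal (real (Suc n)) \<and> ennreal (1 / real (Suc n)) \<le> g x}" for n
  have A: "A n \<in> sets borel" for n unfolding A_def by measurable
  have inc: "incseq A"
  proof (intro incseq_SucI subsetI)
    fix n x assume "x \<in> A n"
    moreover have "ennreal (1 / real (Suc (Suc n))) \<le> ennreal (1 / real (Suc n))"
      by (intro ennreal_leI frac_le) simp_all
    moreover have "ennreal (real (Suc n)) \<le> ennreal (real (Suc (Suc n)))" by (intro ennreal_leI) simp
    ultimately show "x \<in> A (Suc n)" unfolding A_def mem_Collect_eq using order_trans by blast
  qed
  have UA: "(\<Union>n. A n) = {x. g x \<noteq> 0 \<and> g x \<noteq> \<infinity>}"
  proof (intro equalityI subsetI)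
    fix x assume "x \<in> (\<Union>n. A n)"
    then show "x \<in> {x. g x \<noteq> 0 \<and> g x \<noteq> \<infinity>}"
      by (auto simp: A_def top_unique ennreal_eq_0_iff simp del: of_nat_Suc)
  next
    fix x assume "x \<in> {x. g x \<noteq> 0 \<and> g x \<noteq> \<infinity>}"
    then obtain r where r: "g x = ennreal r" "0 < r" by (cases "g x") auto
    obtain n :: nat where n: "max r (1 / r) < real n" using reals_Archimedean2 by blast
    then have "1 / r \<le> real (Suc n)" "r \<le> real (Suc n)" by auto
    moreover from this(1) have "1 / real (Suc n) \<le> r" using r by (simp add: field_simps)
    ultimately have "x \<in> A n" using r by (simp add: A_def ennreal_leI del: of_nat_Suc)
    then show "x \<in> (\<Union>n. A n)" by blast
  qed
  have "emeasure \<mu> {x. g x = 0} = 0"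
    by (subst em) (auto simp: nn_integral_0_iff_AE indicator_def)
  moreover have "emeasure \<mu> {x. g x = \<infinity>} = 0"
  proof -
    have "(\<integral>\<^sup>+x. g x \<partial>leb) = emeasure \<mu> UNIV" by (subst em) auto
    then have "(\<integral>\<^sup>+x. g x \<partial>leb) \<noteq> \<infinity>" using \<mu>.emeasure_finite[of UNIV] by simp
    then have "AE x in leb. g x \<noteq> \<infinity>" using g(1) nn_integral_PInf_AE by blast
    then have "{x. g x = \<infinity>} \<in> null_sets leb" by (subst (asm) AE_iff_null) (auto simp: )
    then have "{x. g x = \<infinity>} \<in> null_sets \<mu>" using ac by (auto simp only: absolutely_continuous_def)
    then show ?thesis by (rule null_setsD1)
  qed
  ultimately have "{x. g x = 0} \<union> {x. g x = \<infinity>} \<in> null_sets \<mu>"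
    by (intro null_sets.Un) (auto simp: null_sets_def sets)
  also have "{x. g x = 0} \<union> {x. g x = \<infinity>} = - (\<Union>n. A n)" by (auto simp: UA)
  finally have "measure \<mu> (- (\<Union>n. A n)) = 0" by (simp add: null_sets_def measure_def)
  then have "measure \<mu> (\<Union>n. A n) = 1"
    using \<mu>.prob_compl[of "\<Union>n. A n"] A by (simp add: sets sp Compl_eq_Diff_UNIV)
  with \<mu>.finite_Lim_measure_incseq[OF _ inc] A have "(\<lambda>n. measure \<mu> (A n)) \<longlonglongrightarrow> 1" by (simp add: sets image_subset_iff)
  then have "\<forall>\<^sub>F n in sequentially. 1 - \<theta> < measure \<mu> (A n)" using \<theta> by (intro order_tendstoD(1)) auto
  then obtain n0 where n0: "\<And>n. n \<ge> n0 \<Longrightarrow> 1 - \<theta> < measure \<mu> (A n)" by (auto simp: eventually_sequentially)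
  define n where "n = Suc n0"
  have n: "1 - \<theta> < measure \<mu> (A n0)" "0 < real n" using n0[of n0] by (auto simp: n_def)
  show ?thesis
  proof (rule that[of "A n0" "1 / real n" "real n"])
    show "measure \<mu> (- A n0) < \<theta>" using n \<mu>.prob_compl[of "A n0"] A by (simp add: sets sp Compl_eq_Diff_UNIV)
    fix B assume B: "B \<in> sets borel" "B \<subseteq> A n0"
    have int: "(\<integral>\<^sup>+x. ennreal r * indicator B x \<partial>leb) = ennreal (r * measure leb B)" if "0 \<le> r" for r
    proof -
      have "(\<integral>\<^sup>+x. ennreal r * indicator B x \<partial>leb) = ennreal r * emeasure leb B"
        using B(1) by (intro nn_integral_cmult_indicator) simp
      then show ?thesis using that by (simp only: leb.emeasure_eq_measure ennreal_mult measure_nonneg)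
    qed
    have "ennreal (1 / real n * measure leb B) = (\<integral>\<^sup>+x. ennreal (1 / real n) * indicator B x \<partial>leb)"
      by (rule int[symmetric]) simp
    also have "\<dots> \<le> (\<integral>\<^sup>+x. g x * indicator B x \<partial>leb)"
      using B(2) by (intro nn_integral_mono) (auto simp: A_def n_def split: split_indicator)
    also have "\<dots> = ennreal (measure \<mu> B)" using em[OF B(1)] by (simp add: \<mu>.emeasure_eq_measure)
    finally have 1: "1 / real n * measure leb B \<le> measure \<mu> B" by simp
    have "ennreal (measure \<mu> B) = (\<integral>\<^sup>+x. g x * indicator B x \<partial>leb)" using em[OF B(1)] by (simp add: \<mu>.emeasure_eq_measure)
    also have "\<dots> \<le> (\<integral>\<^sup>+x. ennreal (real n) * indicator B x \<partial>leb)"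
      using B(2) by (intro nn_integral_mono) (auto simp: A_def n_def split: split_indicator)
    also have "\<dots> = ennreal (real n * measure leb B)"
      by (rule int) simp
    finally have 2: "measure \<mu> B \<le> real n * measure leb B" by simp
    from 1 2 show "1 / real n * measure leb B \<le> measure \<mu> B \<and> measure \<mu> B \<le> real n * measure leb B" by blast
  qed (use A n(2) in auto)
qed

lemma qmap_borel [measurable]: "qmap b \<in> borel_measurable borel"
  unfolding qmap_def by measurable

lemma qmap_funpow_borel [measurable]: "(qmap b ^^ n) \<in> borel_measurable borel"
proof (induction n)
  case (Suc n)
  then show ?case using measurable_comp[OF Suc qmap_borel] by (simp add: o_def)
qed simp

lemma qmap_funpow_continuous: "continuous_on UNIV (qmap b ^^ n)"
proof (induction n)
  case (Suc n)
  have "continuous_on UNIV (\<lambda>x. b - ((qmap b ^^ n) x)\<^sup>2)"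
    using Suc by (intro continuous_intros) auto
  then show ?case by (simp add: o_def qmap_def[abs_def])
qed simp

lemma finite_qmap_funpow_vimage: "finite {x. (qmap b ^^ n) x = v}"
proof (induction n arbitrary: v)
  case (Suc n)
  have "{x. qmap b x = s} \<subseteq> {sqrt (b - s), - sqrt (b - s)}" for s
  proof
    fix x assume "x \<in> {x. qmap b x = s}"
    then have "x\<^sup>2 = b - s" by (simp add: qmap_def)
    then have "sqrt (b - s) = \<bar>x\<bar>" by (metis real_sqrt_abs)
    then show "x \<in> {sqrt (b - s), - sqrt (b - s)}" by auto
  qed
  then have fin: "finite {x. qmap b x = s}" for s by (meson finite.emptyI finite.insertI finite_subset)
  have "{x. (qmap b ^^ Suc n) x = v} = (\<Union>s\<in>{s. (qmap b ^^ n) s = v}. {x. qmap b x = s})"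
    by (auto simp: funpow_swap1)
  with Suc fin show ?case by simp
qed simp

section \<open>The closure of the critical orbit and its gaps\<close>

context bounded_kneading
begin

definition \<Lambda> :: "real set" where "\<Lambda> = closure (c ` {1..})"

lemma \<Lambda>_I: "\<Lambda> \<subseteq> {c 2..c 1}"
  unfolding \<Lambda>_def using c_I by (intro closure_minimal) auto

lemma \<Lambda>_compact: "compact \<Lambda>"
  using \<Lambda>_I bounded_subset[of "{c 2..c 1}" \<Lambda>] by (auto simp: compact_eq_bounded_closed \<Lambda>_def)

lemma \<Lambda>_invariant: "(f ^^ n) ` \<Lambda> \<subseteq> \<Lambda>"
proof -
  have "(f ^^ n) ` closure (c ` {1..}) \<subseteq> closure ((f ^^ n) ` c ` {1..})"
    using continuous_on_subset[OF qmap_funpow_continuous] by (intro continuous_image_closure_subset) auto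
  also have "(f ^^ n) ` c ` {1..} \<subseteq> c ` {1..}" by (auto simp: f_c)
  then have "closure ((f ^^ n) ` c ` {1..}) \<subseteq> closure (c ` {1..})" by (rule closure_mono)
  finally show ?thesis by (simp add: \<Lambda>_def)
qed

lemma \<Lambda>_gap: "\<Lambda> \<inter> {-\<delta><..<0} = {}"
proof -
  have "c ` {1..} \<inter> {-\<delta><..<0} = {}" using c_gap by auto
  then show ?thesis unfolding \<Lambda>_def
    by (metis Int_commute open_Int_closure_eq_empty open_greaterThanLessThan)
qed

text \<open>To the left of 0 the gap is already known. To the right it is pulled back: as the
  interval from 0 to \<delta> is no homterval, some first iterate has a zero there and maps points
  of it just to the left of 0. By invariance of \<Lambda> the preimage of a gap misses
  \<Lambda>.\<close>

lemma \<Lambda>_gap_pos: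
  obtains p q where "0 < p" "p < q" "q \<le> \<delta>" "\<Lambda> \<inter> {p<..<q} = {}"
proof -
  have I: "{0<..<\<delta>} \<subseteq> {c 2..c 1}" using \<delta> b_gt c_2_neg by (auto simp: c_simps)
  have "\<not> homterval 0 \<delta>" by (rule no_homterval)
  then obtain t i where t: "0 < t" "t < \<delta>" "(f ^^ i) t = 0"
    using I \<delta>(1) by (auto simp: homterval_def)
  define i0 where "i0 = (LEAST i. \<exists>t. 0 < t \<and> t < \<delta> \<and> (f ^^ i) t = 0)"
  have ex: "\<exists>i t. 0 < t \<and> t < \<delta> \<and> (f ^^ i) t = 0" using t by blast
  from LeastI_ex[OF ex] obtain t0 where t0: "0 < t0" "t0 < \<delta>" "(f ^^ i0) t0 = 0"
    unfolding i0_def by blast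
  have "\<And>j t. j < i0 \<Longrightarrow> 0 < t \<Longrightarrow> t < \<delta> \<Longrightarrow> (f ^^ j) t \<noteq> 0"
    unfolding i0_def using not_less_Least[where P = "\<lambda>i. \<exists>t. 0 < t \<and> t < \<delta> \<and> (f ^^ i) t = 0"] by blast
  then have nz: "zero_free b i0 (open_segment 0 \<delta>)"
    using \<delta>(1) unfolding zero_free_def by (auto simp: open_segment_real)
  let ?l = "(f ^^ i0) 0" and ?r = "(f ^^ i0) \<delta>"
  have "t0 \<in> open_segment 0 \<delta>" using t0 by (simp add: open_segment_real)
  then have "(f ^^ i0) t0 \<in> (f ^^ i0) ` open_segment 0 \<delta>" by (rule imageI)
  then have "0 \<in> {min ?l ?r<..<max ?l ?r}"
    unfolding funpow_open_segment[OF nz] t0(3) unfolding open_segment_min_max .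
  then have 0: "min ?l ?r < 0" "0 < max ?l ?r"
    unfolding greaterThanLessThan_iff by blast+
  \<comment> \<open>Half of the larger of the two negative bounds lies both in the gap left of 0 and
    inside the image.\<close>
  define v where "v = max (- \<delta>) (min ?l ?r) / 2"
  have v: "v < 0" "-\<delta> < v" "min ?l ?r < v"
    using 0(1) \<delta>(1) unfolding v_def by linarith+
  have v': "v \<in> open_segment ?l ?r"
    unfolding open_segment_min_max using v 0(2) by simp
  define G where "G = {0<..<\<delta>} \<inter> (f ^^ i0) -` {-\<delta><..<0}"
  have "open G" unfolding G_def
    by (intro open_Int open_vimage qmap_funpow_continuous) auto
  moreover from v' funpow_open_segment[OF nz] obtain s where "s \<in> open_segment 0 \<delta>" "(f ^^ i0) s = v"
    by (metis imageE)
  then have "s \<in> G" using v \<delta>(1) by (auto simp: G_def open_segment_real)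
  ultimately obtain e where e: "0 < e" "ball s e \<subseteq> G" by (meson openE)
  have "G \<inter> \<Lambda> = {}" using \<Lambda>_gap \<Lambda>_invariant[of i0] unfolding G_def by blast
  moreover have "{s - e / 2<..<s + e / 2} \<subseteq> G" "s - e / 2 \<in> G" "s + e / 2 \<in> G"
    using e by (auto simp: subset_eq dist_real_def)
  ultimately show ?thesis using e(1)
    by (intro that[of "s - e / 2" "s + e / 2"]) (auto simp: G_def)
qed

lemma release_interval_I:
  assumes "release_interval n i z w"
  shows "open_segment z w \<subseteq> {c 2..c 1}" "\<bar>z\<bar> \<le> 2" "\<bar>w\<bar> \<le> 2"
proof -
  from release_interval_space[OF assms] obtain u e where "ordered4 u z w e"
    and I: "u \<in> {c 2..c 1}" "e \<in> {c 2..c 1}" by metis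
  then have I': "z \<in> {c 2..c 1}" "w \<in> {c 2..c 1}" by (auto simp: ordered4_def)
  then show "open_segment z w \<subseteq> {c 2..c 1}" using open_segment_I by blast
  show "\<bar>z\<bar> \<le> 2" "\<bar>w\<bar> \<le> 2" using I_bound[OF I'(1)] I_bound[OF I'(2)] b_lt by linarith+
qed

lemma release_interval_zero:
  assumes "release_interval n i z w"
  shows "(f ^^ n) z = 0" "(f ^^ (n + i)) w = 0" "i = 1 \<or> i = 2" "\<delta> \<le> \<bar>(f ^^ n) w\<bar>"
    "zero_free b (Suc (n + i)) (open_segment z w)"
  using release_interval_space[OF assms] by metis+

text \<open>The ends of the first interval are zeros at times up to \<open>n' + i'\<close>, while
  the second is free of zeros up to that time and so cannot contain them.\<close>

lemma release_interval_nested: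
  assumes R: "release_interval n i z w" "release_interval n' i' z' w'" "n + i \<le> n' + i'"
    and ne: "open_segment z w \<inter> open_segment z' w' \<noteq> {}"
  shows "open_segment z' w' \<subseteq> open_segment z w"
proof -
  have "z \<notin> open_segment z' w'" "w \<notin> open_segment z' w'"
    using release_interval_zero(1,2)[OF R(1)] release_interval_zero(5)[OF R(2)] R(3)
    unfolding zero_free_def by (metis le_add1 le_imp_less_Suc le_trans)+
  with ne show ?thesis by (auto simp: open_segment_real)
qed

lemma finite_release_intervals:
  "finite {open_segment z w |n i z w. release_interval n i z w \<and> n + i \<le> K}"
proof -
  define Z where "Z = (\<Union>n\<le>K. {x. (f ^^ n) x = 0})"
  have "finite Z" unfolding Z_def using finite_qmap_funpow_vimage by auto
  then have "finite ((\<lambda>(z, w). open_segment z w) ` (Z \<times> Z))" by simp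
  moreover have "{open_segment z w |n i z w. release_interval n i z w \<and> n + i \<le> K} \<subseteq> (\<lambda>(z, w). open_segment z w) ` (Z \<times> Z)"
  proof
    fix G assume "G \<in> {open_segment z w |n i z w. release_interval n i z w \<and> n + i \<le> K}"
    then obtain n i z w where G: "G = open_segment z w" "release_interval n i z w" "n + i \<le> K" by blast
    from release_interval_zero(1,2)[OF G(2)] G(3) have "z \<in> Z" "w \<in> Z"
      unfolding Z_def by (auto intro: bexI[of _ n] bexI[of _ "n + i"] simp del: funpow.simps)
    then show "G \<in> (\<lambda>(z, w). open_segment z w) ` (Z \<times> Z)" unfolding G(1) by force
  qed
  ultimately show ?thesis by (rule rev_finite_subset)
qed

lemma countable_exceptional: "countable {t. (\<exists>i. (f ^^ i) t = 0) \<or> (\<exists>i. (f ^^ i) t = v)}"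
proof -
  have "{t. (\<exists>i. (f ^^ i) t = 0) \<or> (\<exists>i. (f ^^ i) t = v)} = (\<Union>i. {t. (f ^^ i) t = 0}) \<union> (\<Union>i. {t. (f ^^ i) t = v})"
    by blast
  then show ?thesis using finite_qmap_funpow_vimage by (simp add: countable_finite)
qed

text \<open>Two points with the same nonzero signs for ever would span a homterval.\<close>

lemma eq_if_same_sgn:
  assumes "x \<in> {c 2..c 1}" "1 \<le> n" "\<And>i. sgn ((f ^^ i) x) = sgn (c (n + i))"
  shows "x = c n"
proof (rule ccontr)
  assume ne: "x \<noteq> c n"
  have nz: "zero_free b k (open_segment (c n) x)" for k
    by (rule zero_free_if_same_sgn) (use assms(2,3) c_nonzero in \<open>auto simp: f_c\<close>)
  have "homterval (min (c n) x) (max (c n) x)"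
    unfolding homterval_def open_segment_min_max[symmetric]
  proof (intro conjI ballI allI)
    show "min (c n) x < max (c n) x" using ne by (auto simp: min_def max_def)
    show "open_segment (c n) x \<subseteq> {c 2..c 1}" using open_segment_I[OF c_I assms(1)] assms(2) by auto
    show "(f ^^ i) t \<noteq> 0" if "t \<in> open_segment (c n) x" for t i
      using that nz[of "Suc i"] unfolding zero_free_def by auto
  qed
  with no_homterval show False by blast
qed

text \<open>A point with finitely many releases has the signs of the orbit of \<open>c 2\<close>
  from some time on, and so lands on \<open>c 2\<close> exactly.\<close>

lemma infinitely_released:
  assumes t: "t \<in> {c 2<..<c 1}" and nz: "\<And>i. (f ^^ i) t \<noteq> 0" and ne: "\<And>i. (f ^^ i) t \<noteq> c 2"
  shows "\<exists>n\<ge>N. released t n"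
proof (rule ccontr)
  assume "\<not> ?thesis"
  then have "\<And>n. n \<ge> N \<Longrightarrow> \<not> released t n" by blast
  from shadow_critical_orbit[OF t nz this] obtain D where D: "\<And>i. sgn ((f ^^ (i + D)) t) = sgn (c (i + 2))" by blast
  have "(f ^^ D) t = c 2"
    by (rule eq_if_same_sgn[OF funpow_I]) (use t D in \<open>auto simp: funpow_add add.commute\<close>)
  with ne show False by blast
qed

lemma small_release_intervals:
  assumes "0 < d"
  obtains M where "\<And>n i z w. release_interval n i z w \<Longrightarrow> M \<le> n \<Longrightarrow> \<bar>z - w\<bar> < d"
proof -
  from short_branches[OF assms] obtain M where
    M: "\<And>u v. u < v \<Longrightarrow> {u<..<v} \<subseteq> {c 2..c 1} \<Longrightarrow> zero_free b M {u<..<v} \<Longrightarrow> v - u < d" by blast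
  show ?thesis
  proof (rule that[of M])
    fix n i z w assume R: "release_interval n i z w" "M \<le> n"
    have nz: "zero_free b M {min z w<..<max z w}"
      using zero_free_subset[OF release_interval_zero(5)[OF R(1)], of _ M] R(2)
      by (simp add: open_segment_min_max)
    show "\<bar>z - w\<bar> < d"
    proof (cases "z = w")
      case False
      then have "max z w - min z w < d"
        using M[of "min z w" "max z w"] nz release_interval_I(1)[OF R(1)] by (auto simp: open_segment_min_max)
      then show ?thesis by (auto simp: min_def max_def split: if_splits)
    qed (use assms in simp)
  qed
qed

definition part :: "real \<Rightarrow> real \<Rightarrow> nat \<Rightarrow> real set \<Rightarrow> real set" where
  "part p q n G = G \<inter> (f ^^ n) -` open_segment p q"

lemma release_interval_part:
  assumes R: "release_interval n i z w" and pq: "p \<in> closed_segment 0 q" "p \<noteq> q" "q \<in> closed_segment 0 ((f ^^ n) w)"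
  shows "\<eta> / 36 * \<bar>p - q\<bar> * measure leb (open_segment z w) \<le> measure leb (part p q n (open_segment z w))"
proof -
  from release_interval_koebe[OF R pq] obtain p' q' where sub: "open_segment p' q' \<subseteq> open_segment z w"
    "(f ^^ n) ` open_segment p' q' = open_segment p q"
    "\<eta> / 36 * \<bar>p - q\<bar> * \<bar>z - w\<bar> \<le> \<bar>p' - q'\<bar>" .
  note zw = release_interval_I(2,3)[OF R]
  have m: "measure leb (open_segment z w) = \<bar>z - w\<bar>" using zw by (intro measure_leb_open_segment) auto
  show ?thesis
  proof (cases "p' = q'")
    case True
    then show ?thesis using sub(3) m by (simp add: measure_nonneg order_trans)
  next
    case False
    have "{min p' q'<..<max p' q'} \<subseteq> {min z w<..<max z w}" using sub(1) by (simp add: open_segment_min_max)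
    then have "min z w \<le> min p' q'" "max p' q' \<le> max z w" using False
      unfolding greaterThanLessThan_subseteq_greaterThanLessThan by (auto simp: min_def max_def split: if_splits)
    then have "\<bar>p'\<bar> \<le> 9" "\<bar>q'\<bar> \<le> 9" using zw by (auto simp: min_def max_def split: if_splits)
    then have "\<bar>p' - q'\<bar> = measure leb (open_segment p' q')" by (simp add: measure_leb_open_segment)
    also have "\<dots> \<le> measure leb (part p q n (open_segment z w))"
      using sub(1,2) unfolding part_def by (intro leb.finite_measure_mono) auto
    finally show ?thesis using sub(3) m by simp
  qed
qed

end

section \<open>First releases and the Lebesgue measure of \<Lambda>\<close>

context bounded_kneading
begin

text \<open>Intervals are ordered by \<open>n + i\<close>, the time that governs nesting. The
  minimal ones are therefore equal or disjoint and still contain every point released after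
  \<open>N\<close>.\<close>

definition first_release :: "nat \<Rightarrow> nat \<Rightarrow> nat \<Rightarrow> real \<Rightarrow> real \<Rightarrow> bool" where
  "first_release N n i z w \<longleftrightarrow> release_interval n i z w \<and> N \<le> n \<and>
     (\<forall>n' i' z' w'. release_interval n' i' z' w' \<and> N \<le> n' \<and> n' + i' < n + i \<longrightarrow>
        open_segment z w \<inter> open_segment z' w' = {})"

lemma first_release_disjoint:
  assumes "first_release N n i z w" "first_release N n' i' z' w'"
    and "open_segment z w \<inter> open_segment z' w' \<noteq> {}"
  shows "open_segment z w = open_segment z' w'"
proof -
  have R: "release_interval n i z w" "release_interval n' i' z' w'"
    using assms by (auto simp: first_release_def)
  have "\<not> n' + i' < n + i" "\<not> n + i < n' + i'"
    using assms unfolding first_release_def by (metis Int_commute)+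
  then have "n + i = n' + i'" by simp
  then show ?thesis
    using release_interval_nested[OF R] release_interval_nested[OF R(2,1)] assms(3)
    by (metis Int_commute order_refl subset_antisym)
qed

lemma first_release_exists:
  assumes "n\<ge>N" "released t n"
  shows "\<exists>n i z w. first_release N n i z w \<and> t \<in> open_segment z w"
proof -
  define P where "P p = (case p of (n, i, z, w) \<Rightarrow> release_interval n i z w \<and> N \<le> n \<and> t \<in> open_segment z w)"
    for p :: "nat \<times> nat \<times> real \<times> real"
  define m where "m p = (case p of (n, i, z, w) \<Rightarrow> n + i)" for p :: "nat \<times> nat \<times> real \<times> real"
  from assms(2) obtain i0 z0 w0 where "release_interval n i0 z0 w0" "t \<in> open_segment z0 w0"
    unfolding released_def by blast
  then have "P (n, i0, z0, w0)" using assms(1) by (simp add: P_def)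
  from ex_has_least_nat[of P, OF this, of m]
  obtain p where p: "P p" "\<And>p'. P p' \<Longrightarrow> m p \<le> m p'" by blast
  obtain n i z w where nizw: "p = (n, i, z, w)" by (metis surj_pair)
  have R: "release_interval n i z w" "N \<le> n" "t \<in> open_segment z w" using p(1) by (auto simp: P_def nizw)
  have "open_segment z w \<inter> open_segment z' w' = {}"
    if R': "release_interval n' i' z' w'" "N \<le> n'" "n' + i' < n + i" for n' i' z' w'
  proof (rule ccontr)
    assume "open_segment z w \<inter> open_segment z' w' \<noteq> {}"
    then have "open_segment z w \<subseteq> open_segment z' w'"
      using release_interval_nested[OF R'(1) R(1)] R'(3) by (auto simp: Int_commute)
    then have "P (n', i', z', w')" using R R' by (auto simp: P_def)
    from p(2)[OF this] R'(3) show False by (simp add: m_def nizw)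
  qed
  with R show ?thesis unfolding first_release_def by blast
qed

text \<open>The image of a release interval reaches from 0 to distance at least \<delta> on one
  side, so it contains a gap of \<Lambda>; by invariance, points landing in the gap are outside
  \<Lambda>. The gap on the right is no longer than \<delta>, so its constant serves on both
  sides.\<close>

lemma \<Lambda>_proportion:
  obtains \<kappa> where "0 < \<kappa>" "\<kappa> \<le> 1"
    "\<And>n i z w. release_interval n i z w \<Longrightarrow>
       \<kappa> * measure leb (open_segment z w) \<le> measure leb (open_segment z w - \<Lambda>)"
proof -
  from \<Lambda>_gap_pos obtain p q where pq: "0 < p" "p < q" "q \<le> \<delta>" "\<Lambda> \<inter> {p<..<q} = {}" .
  define \<kappa> where "\<kappa> = \<eta> / 36 * (q - p)"
  have \<Lambda>_borel: "\<Lambda> \<in> sets borel" using \<Lambda>_compact by (rule borel_compact)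
  have "\<eta> / 36 * (q - p) \<le> 1 * 1" using \<eta> pq \<delta> by (intro mult_mono) auto
  then have 1: "\<kappa> \<le> 1" by (simp add: \<kappa>_def)
  have 0: "0 < \<kappa>" using \<eta> pq by (simp add: \<kappa>_def)
  have part: "measure leb (part r s n (open_segment z w)) \<le> measure leb (open_segment z w - \<Lambda>)"
    if "\<Lambda> \<inter> open_segment r s = {}" for r s n z w
  proof (rule leb.finite_measure_mono)
    show "part r s n (open_segment z w) \<subseteq> open_segment z w - \<Lambda>"
      using that \<Lambda>_invariant[of n] unfolding part_def by blast
  qed (use \<Lambda>_borel in auto)
  show ?thesis
  proof (rule that[OF 0 1])
    fix n i z w assume R: "release_interval n i z w"
    note zero = release_interval_zero[OF R]
    show "\<kappa> * measure leb (open_segment z w) \<le> measure leb (open_segment z w - \<Lambda>)"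
    proof (cases "0 < (f ^^ n) w")
      case True
      then have "p \<in> closed_segment 0 q" "p \<noteq> q" "q \<in> closed_segment 0 ((f ^^ n) w)"
        using pq zero(4) by (auto simp: closed_segment_real)
      from release_interval_part[OF R this] part[of p q n z w] pq
      show ?thesis by (simp add: \<kappa>_def open_segment_min_max)
    next
      case False
      then have "0 \<in> closed_segment 0 (-\<delta>)" "0 \<noteq> -\<delta>" "-\<delta> \<in> closed_segment 0 ((f ^^ n) w)"
        using \<delta>(1) zero(4) by (auto simp: closed_segment_real)
      from release_interval_part[OF R this] part[of 0 "-\<delta>" n z w] \<Lambda>_gap \<delta>(1)
      have "\<eta> / 36 * \<delta> * measure leb (open_segment z w) \<le> measure leb (open_segment z w - \<Lambda>)"
        by (simp add: open_segment_min_max)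
      moreover have "\<kappa> * measure leb (open_segment z w) \<le> \<eta> / 36 * \<delta> * measure leb (open_segment z w)"
        unfolding \<kappa>_def using pq \<eta> by (intro mult_right_mono mult_left_mono) auto
      ultimately show ?thesis by linarith
    qed
  qed
qed

text \<open>Almost every point of \<open>\<Lambda>\<close> lies in arbitrarily short release intervals, and each of them
  contains a definite proportion of the complement of \<open>\<Lambda>\<close>.\<close>

lemma measure_\<Lambda>: "measure leb \<Lambda> = 0"
proof -
  from \<Lambda>_proportion obtain \<kappa> where \<kappa>: "0 < \<kappa>" "\<kappa> \<le> 1"
    "\<And>n i z w. release_interval n i z w \<Longrightarrow>
       \<kappa> * measure leb (open_segment z w) \<le> measure leb (open_segment z w - \<Lambda>)" by blast
  have \<Lambda>_borel: "\<Lambda> \<in> sets borel" using \<Lambda>_compact by (rule borel_compact)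
  have "\<kappa> * measure leb \<Lambda> \<le> 0 + \<zeta>" if \<zeta>: "0 < \<zeta>" for \<zeta>
  proof -
    from proportion_lower_bound[OF \<Lambda>_borel \<kappa>(1,2) \<zeta>] obtain d where d: "0 < d"
      and low: "\<And>F h. finite F \<Longrightarrow> disjoint F \<Longrightarrow> (\<And>G. G \<in> F \<Longrightarrow> G \<in> sets borel \<and> h G \<in> sets borel \<and> h G \<subseteq> G \<and>
        \<kappa> * measure leb G \<le> measure leb (h G) \<and> (\<forall>x\<in>G. \<forall>y\<in>G. dist x y < d)) \<Longrightarrow>
      \<kappa> * measure leb (\<Lambda> \<inter> \<Union>F) - \<zeta> \<le> measure leb (\<Lambda> \<inter> (\<Union>G\<in>F. h G))" by metis
    from small_release_intervals[OF d] obtain M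
      where M: "\<And>n i z w. release_interval n i z w \<Longrightarrow> M \<le> n \<Longrightarrow> \<bar>z - w\<bar> < d" by blast
    \<comment> \<open>The cut-off \<open>K\<close> makes the family finite; afterwards
      \<open>K\<close> tends to infinity.\<close>
    define F where "F K = {open_segment z w |n i z w. first_release M n i z w \<and> n + i \<le> K}" for K
    define U where "U K = \<Lambda> \<inter> \<Union>(F K)" for K
    have fin: "finite (F K)" for K
      by (rule rev_finite_subset[OF finite_release_intervals[of K]]) (auto simp: F_def first_release_def)
    have dis: "disjoint (F K)" for K
      unfolding disjoint_def F_def using first_release_disjoint by blast
    have FG: "G \<in> sets borel \<and> G - \<Lambda> \<in> sets borel \<and> G - \<Lambda> \<subseteq> G \<and>
        \<kappa> * measure leb G \<le> measure leb (G - \<Lambda>) \<and> (\<forall>x\<in>G. \<forall>y\<in>G. dist x y < d)" if "G \<in> F K" for G K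
    proof -
      from that obtain n i z w where G: "G = open_segment z w" and R: "release_interval n i z w" "M \<le> n"
        unfolding F_def first_release_def by blast
      have "dist x y < d" if "x \<in> G" "y \<in> G" for x y
        using that M[OF R] unfolding G by (auto simp: open_segment_real dist_real_def)
      then show ?thesis using \<kappa>(3)[OF R(1)] \<Lambda>_borel by (simp add: G)
    qed
    have "\<kappa> * measure leb (U K) \<le> \<zeta>" for K
    proof -
      \<comment> \<open>The chosen parts avoid \<Lambda>, so the proportion estimate bounds a
        positive multiple of the covered part of \<Lambda> by \<zeta>.\<close>
      have "\<Lambda> \<inter> (\<Union>G\<in>F K. G - \<Lambda>) = {}" by blast
      with low[of "F K" "\<lambda>G. G - \<Lambda>", OF fin dis FG] show ?thesis by (simp add: U_def)
    qed
    moreover have "incseq U"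
    proof (rule incseq_SucI)
      fix K
      have "F K \<subseteq> F (Suc K)" unfolding F_def using le_SucI by blast
      then show "U K \<subseteq> U (Suc K)" unfolding U_def by blast
    qed
    moreover have Ub: "range U \<subseteq> sets leb"
      using \<Lambda>_borel fin FG unfolding U_def by (auto intro!: sets.Int sets.finite_Union)
    ultimately have "\<kappa> * measure leb (\<Union>K. U K) \<le> \<zeta>"
      by (intro LIMSEQ_le_const2[OF tendsto_mult_left[OF leb.finite_Lim_measure_incseq]]) auto
    moreover have "measure leb \<Lambda> \<le> measure leb (\<Union>K. U K)"
    proof -
      define E where "E = {t. (\<exists>i. (f ^^ i) t = 0) \<or> (\<exists>i. (f ^^ i) t = c 2)} \<union> {c 1, c 2}"
      have "countable E" unfolding E_def using countable_exceptional by simp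
      then have "E \<in> null_sets lborel" by (rule countable_imp_null_set_lborel)
      then have E: "E \<in> sets borel" "emeasure leb E = 0"
        by (auto simp: emeasure_leb null_sets_def intro: emeasure_eq_0)
      have "\<Lambda> \<subseteq> (\<Union>K. U K) \<union> E"
      proof
        fix t assume t: "t \<in> \<Lambda>"
        show "t \<in> (\<Union>K. U K) \<union> E"
        proof (cases "t \<in> E")
          case False
          then have "t \<noteq> c 1" "t \<noteq> c 2" "\<And>i. (f ^^ i) t \<noteq> 0" "\<And>i. (f ^^ i) t \<noteq> c 2"
            by (auto simp: E_def)
          moreover from this t \<Lambda>_I have "t \<in> {c 2<..<c 1}" by (auto simp: less_le subset_eq)
          ultimately obtain n where "n \<ge> M" "released t n" using infinitely_released by blast
          then obtain n i z w where "first_release M n i z w" "t \<in> open_segment z w"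
            using first_release_exists by blast
          then have "t \<in> U (n + i)" using t unfolding U_def F_def by blast
          then show ?thesis by blast
        qed simp
      qed
      then have "measure leb \<Lambda> \<le> measure leb ((\<Union>K. U K) \<union> E)"
        using Ub E by (intro leb.finite_measure_mono sets.Un sets.countable_UN) auto
      also have "\<dots> \<le> measure leb (\<Union>K. U K) + measure leb E"
        using Ub E by (intro measure_Un_le sets.countable_UN) auto
      finally show ?thesis using E by (simp add: measure_def)
    qed
    ultimately show ?thesis using \<kappa>(1) mult_left_mono[of "measure leb \<Lambda>" "measure leb (\<Union>K. U K)" \<kappa>] by linarith
  qed
  then have "\<kappa> * measure leb \<Lambda> \<le> 0" by (rule field_le_epsilon)
  then show ?thesis using \<kappa>(1) measure_nonneg[of leb \<Lambda>] by (simp add: mult_le_0_iff)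
qed

end

section \<open>Invariant densities are bounded below near the turning point\<close>

locale bounded_kneading_acip = bounded_kneading b S Q + prob_space \<mu>
  for b :: real and S Q :: "nat \<Rightarrow> nat" and \<mu> :: "real measure" +
  assumes sets_\<mu>: "sets \<mu> = sets borel" and ac_lborel: "absolutely_continuous lborel \<mu>"
    and invariant: "distr \<mu> borel (qmap b) = \<mu>"
begin

lemma space_\<mu>: "space \<mu> = UNIV"
  using sets_eq_imp_space_eq[OF sets_\<mu>] by simp

lemma measure_vimage: "A \<in> sets borel \<Longrightarrow> measure \<mu> ((f ^^ n) -` A) = measure \<mu> A"
proof (induction n arbitrary: A)
  case (Suc n)
  have fA: "f -` A \<in> sets borel" using measurable_sets_borel[OF qmap_borel Suc.prems] by simp
  have "(f ^^ Suc n) -` A = (f ^^ n) -` (f -` A)" by auto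
  then have "measure \<mu> ((f ^^ Suc n) -` A) = measure \<mu> (f -` A)" using Suc.IH[OF fA] by simp
  also have "\<dots> = measure (distr \<mu> borel f) A"
    using Suc.prems by (subst measure_distr) (auto simp: space_\<mu> sets_\<mu> measurable_cong_sets[OF sets_\<mu> refl])
  also have "\<dots> = measure \<mu> A" by (simp add: invariant)
  finally show ?case .
qed simp

lemma vimage_borel: "A \<in> sets borel \<Longrightarrow> (f ^^ n) -` A \<in> sets borel"
  using measurable_sets_borel[OF qmap_funpow_borel] by simp

lemma countable_null:
  assumes "countable N"
  shows "N \<in> null_sets \<mu>"
  using countable_imp_null_set_lborel[OF assms] ac_lborel by (auto simp only: absolutely_continuous_def)

text \<open>The points that stay in \<open>X\<close> from time \<open>k\<close> on form an
  increasing sequence of sets of total mass 1, and each is contained in a preimage of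
  \<open>X\<close>, which has the measure of \<open>X\<close>.\<close>

lemma measure_eventually:
  assumes X: "X \<in> sets borel" and N: "countable N"
    and ev: "\<And>x. x \<notin> N \<Longrightarrow> \<exists>k. \<forall>n\<ge>k. (f ^^ n) x \<in> X"
  shows "measure \<mu> X = 1"
proof -
  define A where "A k = (\<Inter>n\<in>{k..}. (f ^^ n) -` X)" for k
  have A: "A k \<in> sets borel" for k unfolding A_def
    by (rule sets.countable_INT') (use X vimage_borel in auto)
  have inc: "incseq A"
    by (rule incseq_SucI) (auto simp: A_def)
  have UA: "(\<Union>k. A k) \<in> sets borel" using A by auto
  have "UNIV - (\<Union>k. A k) \<subseteq> N"
  proof
    fix x assume x: "x \<in> UNIV - (\<Union>k. A k)"
    show "x \<in> N"
    proof (rule ccontr)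
      assume "x \<notin> N"
      from ev[OF this] obtain k where "\<forall>n\<ge>k. (f ^^ n) x \<in> X" ..
      then have "x \<in> A k" by (auto simp: A_def)
      with x show False by blast
    qed
  qed
  moreover have "UNIV - (\<Union>k. A k) \<in> sets \<mu>" unfolding sets_\<mu> using UA by (rule borel_comp[unfolded Compl_eq_Diff_UNIV])
  ultimately have "UNIV - (\<Union>k. A k) \<in> null_sets \<mu>"
    by (intro null_sets_subset[OF countable_null[OF N]])
  then have "measure \<mu> (UNIV - (\<Union>k. A k)) = 0" by (rule measure_eq_0_null_sets)
  then have "measure \<mu> (\<Union>k. A k) = 1"
    using prob_compl[of "\<Union>k. A k"] UA by (simp add: space_\<mu> sets_\<mu>)
  moreover have "(\<lambda>k. measure \<mu> (A k)) \<longlonglongrightarrow> measure \<mu> (\<Union>k. A k)"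
    by (rule finite_Lim_measure_incseq[OF _ inc]) (use A in \<open>auto simp: sets_\<mu>\<close>)
  moreover have "measure \<mu> (A k) \<le> measure \<mu> X" for k
  proof -
    have "measure \<mu> (A k) \<le> measure \<mu> ((f ^^ k) -` X)"
      using vimage_borel[OF X, of k] by (intro finite_measure_mono) (auto simp: A_def sets_\<mu>)
    then show ?thesis by (simp add: measure_vimage X)
  qed
  ultimately have "1 \<le> measure \<mu> X" by (metis LIMSEQ_le_const2)
  then show ?thesis using prob_le_1[of X] by linarith
qed

text \<open>\<open>- \<beta>\<close> is the negative fixed point, with second preimage \<beta>. An
  orbit that never enters the interval stays below \<open>c 2\<close> after one step, and its
  increment there factors as \<open>(y + \<beta>) * (\<beta> - 1 - y)\<close>. To the right of
  \<open>- \<beta>\<close> it would have to climb past \<open>c 2\<close>; to the left it tends to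
  minus infinity.\<close>

lemma absorbed_or_escaping:
  fixes \<beta> :: real
  defines "\<beta> \<equiv> (1 + sqrt (1 + 4 * b)) / 2"
  assumes x: "x \<noteq> \<beta>" "x \<noteq> - \<beta>"
  shows "\<exists>k. \<forall>n\<ge>k. (f ^^ n) x \<in> {c 2..c 1} \<union> {y. R < \<bar>y\<bar>}"
proof (cases "\<exists>n. (f ^^ n) x \<in> {c 2..c 1}")
  case True
  then obtain k where k: "(f ^^ k) x \<in> {c 2..c 1}" by blast
  have "(f ^^ n) x \<in> {c 2..c 1}" if "k \<le> n" for n
  proof -
    have "(f ^^ n) x = (f ^^ (n - k)) ((f ^^ k) x)"
      using that by (metis comp_apply funpow_add le_add_diff_inverse2)
    then show ?thesis using funpow_I[OF k] by simp
  qed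
  then show ?thesis by blast
next
  case False
  define y where "y n = (f ^^ Suc n) x" for n
  have \<beta>: "\<beta>\<^sup>2 = \<beta> + b" "1 < \<beta>"
  proof -
    have "0 \<le> 1 + 4 * b" "1 < sqrt (1 + 4 * b)" using b_gt by auto
    then show "\<beta>\<^sup>2 = \<beta> + b" "1 < \<beta>"
      by (auto simp: \<beta>_def power2_eq_square field_simps)
  qed
  have ystep: "y (Suc n) = y n + (y n + \<beta>) * (\<beta> - 1 - y n)" for n
    using \<beta>(1) by (simp add: y_def qmap_def power2_eq_square algebra_simps)
  have y2: "y n < c 2" for n
  proof -
    have "\<not> \<bar>(f ^^ n) x\<bar> \<le> b" using f_bound[of "(f ^^ n) x"] False
      by (metis comp_apply funpow.simps(2))
    then have "b\<^sup>2 < \<bar>(f ^^ n) x\<bar>\<^sup>2" using b_gt by (intro power_strict_mono) auto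
    then show ?thesis by (simp add: y_def qmap_def c_simps)
  qed
  have "y 0 \<noteq> - \<beta>"
  proof
    assume "y 0 = - \<beta>"
    then have "x\<^sup>2 = \<beta>\<^sup>2" using \<beta>(1) by (simp add: y_def qmap_def)
    with x show False by (auto simp: power2_eq_iff)
  qed
  then consider "- \<beta> < y 0" | "y 0 < - \<beta>" by linarith
  then show ?thesis
  proof cases
    case 1
    define s where "s = (y 0 + \<beta>) * (\<beta> - 1 - c 2)"
    have s: "0 < s" unfolding s_def using 1 \<beta>(2) c_2_neg by (intro mult_pos_pos) linarith+
    have "y 0 + real n * s \<le> y n" for n
    proof (induction n)
      case (Suc n)
      have "0 \<le> real n * s" using s by simp
      then have "y 0 \<le> y n" using Suc by linarith
      then have "s \<le> (y n + \<beta>) * (\<beta> - 1 - y n)"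
        unfolding s_def by (intro mult_mono) (use y2[of n] 1 \<beta>(2) c_2_neg in linarith)+
      then show ?case using Suc ystep[of n] by (simp add: distrib_right)
    qed simp
    moreover obtain n where "- y 0 < real n * s" using reals_Archimedean3[OF s] by blast
    ultimately have "0 < y n" by (smt (verit))
    with y2[of n] c_2_neg show ?thesis by linarith
  next
    case 2
    define s where "s = (- y 0 - \<beta>) * (2 * \<beta> - 1)"
    have s: "0 < s" unfolding s_def using 2 \<beta>(2) by (intro mult_pos_pos) linarith+
    have yn: "y n \<le> y 0 - real n * s" for n
    proof (induction n)
      case (Suc n)
      have "0 \<le> real n * s" using s by simp
      then have "y n \<le> y 0" using Suc by linarith
      then have "s \<le> (- y n - \<beta>) * (\<beta> - 1 - y n)"
        unfolding s_def by (intro mult_mono) (use 2 \<beta>(2) in linarith)+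
      moreover have "(- y n - \<beta>) * (\<beta> - 1 - y n) = - ((y n + \<beta>) * (\<beta> - 1 - y n))" by (simp add: algebra_simps)
      ultimately show ?case using Suc ystep[of n] by (simp add: distrib_right)
    qed simp
    obtain k where k: "y 0 + R < real k * s" using reals_Archimedean3[OF s] by blast
    have "R < \<bar>(f ^^ n) x\<bar>" if "Suc k \<le> n" for n
    proof -
      have "real k * s \<le> real (n - 1) * s" using that s by (intro mult_right_mono) auto
      with yn[of "n - 1"] k have "y (n - 1) < - R" by linarith
      moreover have "y (n - 1) = (f ^^ n) x" unfolding y_def using that by (cases n) simp_all
      ultimately show ?thesis by linarith
    qed
    then show ?thesis by blast
  qed
qed

text \<open>Escape to infinity carries no mass: the interval together with the points beyond any
  radius has measure 1, and these sets decrease to the interval.\<close>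

lemma measure_I: "measure \<mu> {c 2..c 1} = 1"
proof -
  define Y where "Y k = {c 2..c 1} \<union> {y. real k < \<bar>y\<bar>}" for k :: nat
  have Y: "Y k \<in> sets borel" for k unfolding Y_def by measurable
  define \<beta> where "\<beta> = (1 + sqrt (1 + 4 * b)) / 2"
  have "measure \<mu> (Y k) = 1" for k
    by (rule measure_eventually[OF Y, of "{\<beta>, - \<beta>}"])
      (use absorbed_or_escaping in \<open>auto simp: Y_def \<beta>_def\<close>)
  moreover have "decseq Y" by (rule decseq_SucI) (auto simp: Y_def)
  then have "(\<lambda>k. measure \<mu> (Y k)) \<longlonglongrightarrow> measure \<mu> (\<Inter>k. Y k)"
    by (rule finite_Lim_measure_decseq[rotated]) (use Y in \<open>auto simp: sets_\<mu>\<close>)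
  moreover have "(\<Inter>k. Y k) = {c 2..c 1}"
  proof (intro equalityI subsetI)
    fix x assume x: "x \<in> (\<Inter>k. Y k)"
    obtain k :: nat where "\<bar>x\<bar> < real k" using reals_Archimedean2 by blast
    moreover have "x \<in> Y k" using x by blast
    ultimately show "x \<in> {c 2..c 1}" by (simp add: Y_def)
  qed (auto simp: Y_def)
  ultimately show ?thesis using LIMSEQ_unique[OF tendsto_const] by (simp add: LIMSEQ_const_iff)
qed

lemma ac_leb: "absolutely_continuous leb \<mu>"
  unfolding absolutely_continuous_def
proof
  fix N assume "N \<in> null_sets leb"
  then have N: "N \<in> sets borel" "emeasure lborel ({-9..9} \<inter> N) = 0"
    by (auto simp: null_sets_def emeasure_leb)
  then have "{-9..9} \<inter> N \<in> null_sets lborel" by (auto simp: null_sets_def)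
  then have 1: "{-9..9} \<inter> N \<in> null_sets \<mu>" using ac_lborel by (auto simp only: absolutely_continuous_def)
  have "measure \<mu> (- {c 2..c 1}) = 0"
    using prob_compl[of "{c 2..c 1}"] measure_I by (simp add: sets_\<mu> space_\<mu> Compl_eq_Diff_UNIV)
  then have "- {c 2..c 1} \<in> null_sets \<mu>" by (simp add: null_sets_def sets_\<mu> emeasure_eq_measure)
  then have "({-9..9} \<inter> N) \<union> - {c 2..c 1} \<in> null_sets \<mu>" using 1 by (rule null_sets.Un[rotated])
  then show "N \<in> null_sets \<mu>"
  proof (rule null_sets_subset)
    show "N \<subseteq> ({-9..9} \<inter> N) \<union> - {c 2..c 1}"
    proof
      fix x assume "x \<in> N"
      moreover have "\<bar>x\<bar> \<le> 2" if "x \<in> {c 2..c 1}" using I_bound[OF that] b_lt by linarith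
      ultimately show "x \<in> ({-9..9} \<inter> N) \<union> - {c 2..c 1}" by auto
    qed
  qed (use N in \<open>simp add: sets_\<mu>\<close>)
qed

end

section \<open>Release sets at a fixed time, and shadowing of the critical orbit\<close>

context bounded_kneading
begin

text \<open>Fixing \<open>n\<close> and \<open>i\<close> makes the intervals disjoint, because
  nesting then works in both directions. Fixing the side of 0 gives all of them a common target
  segment.\<close>

definition release_sets :: "nat \<Rightarrow> bool \<Rightarrow> nat \<Rightarrow> real set set" where
  "release_sets i pos n = {open_segment z w |z w. release_interval n i z w \<and> (0 < (f ^^ n) w) = pos}"

lemma finite_release_sets: "finite (release_sets i pos n)"
  by (rule rev_finite_subset[OF finite_release_intervals[of "n + i"]]) (auto simp: release_sets_def)

lemma disjoint_release_sets: "disjoint (release_sets i pos n)"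
  unfolding disjoint_def
proof (intro ballI impI)
  fix G H assume "G \<in> release_sets i pos n" "H \<in> release_sets i pos n" "G \<noteq> H"
  then obtain z w z' w' where GH: "G = open_segment z w" "H = open_segment z' w'"
    and R: "release_interval n i z w" "release_interval n i z' w'" unfolding release_sets_def by blast
  show "G \<inter> H = {}"
  proof (rule ccontr)
    assume "G \<inter> H \<noteq> {}"
    then have "G = H" unfolding GH
      using release_interval_nested[OF R] release_interval_nested[OF R(2,1)]
      by (simp add: Int_commute subset_antisym)
    with \<open>G \<noteq> H\<close> show False by blast
  qed
qed

lemma release_sets_borel: "\<Union>(release_sets i pos n) \<in> sets borel"
  by (rule sets.finite_Union[OF finite_release_sets]) (auto simp: release_sets_def)

lemma released_iff:
  "{t. released t n} = \<Union>(release_sets 1 True n) \<union> \<Union>(release_sets 1 False n)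
     \<union> (\<Union>(release_sets 2 True n) \<union> \<Union>(release_sets 2 False n))" (is "?L = ?R")
proof (intro equalityI subsetI)
  fix t assume "t \<in> ?L"
  then obtain i z w where R: "release_interval n i z w" "t \<in> open_segment z w" by (auto simp: released_def)
  then have "t \<in> \<Union>(release_sets i (0 < (f ^^ n) w) n)" unfolding release_sets_def by blast
  with release_interval_zero(3)[OF R(1)] show "t \<in> ?R" by (cases "0 < (f ^^ n) w") auto
qed (auto simp: release_sets_def released_def)

text \<open>A finite sign condition, hence Borel; inside the invariant interval, satisfying it for
  all \<open>K\<close> forces membership in \<Lambda>.\<close>

definition shadowing :: "nat \<Rightarrow> real set" where
  "shadowing K = {y. \<exists>l\<ge>1. \<forall>i<K. sgn ((f ^^ i) y) = sgn (c (l + i))}"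

lemma shadowing_borel: "shadowing K \<in> sets borel"
proof -
  have s: "{u::real. sgn u = v} \<in> sets borel" for v by measurable
  have "shadowing K = (\<Union>l\<in>{1..}. \<Inter>i\<in>{..<K}. (f ^^ i) -` {u. sgn u = sgn (c (l + i))}) "
    by (auto simp: shadowing_def)
  also have "\<dots> \<in> sets borel"
  proof (cases "K = 0")
    case False
    then show ?thesis
      using measurable_sets_borel[OF qmap_funpow_borel s]
      by (intro sets.countable_UN' sets.finite_INT) auto
  qed simp
  finally show ?thesis .
qed

lemma shadowing_limit:
  assumes y: "y \<in> {c 2..c 1}" and sh: "\<And>K. y \<in> shadowing K"
  shows "y \<in> \<Lambda>"
  unfolding \<Lambda>_def closure_approachable
proof (intro allI impI)
  fix d :: real assume d: "0 < d"
  from short_branches[OF d] obtain M where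
    M: "\<And>u v. u < v \<Longrightarrow> {u<..<v} \<subseteq> {c 2..c 1} \<Longrightarrow> zero_free b M {u<..<v} \<Longrightarrow> v - u < d" by blast
  from sh[of M] obtain l where l: "1 \<le> l" "\<And>i. i < M \<Longrightarrow> sgn ((f ^^ i) y) = sgn (c (l + i))"
    unfolding shadowing_def by blast
  have "zero_free b M (open_segment (c l) y)"
    by (rule zero_free_if_same_sgn) (use l c_nonzero in \<open>auto simp: f_c\<close>)
  then have nz: "zero_free b M {min (c l) y<..<max (c l) y}" by (simp add: open_segment_min_max)
  have I: "{min (c l) y<..<max (c l) y} \<subseteq> {c 2..c 1}"
    using open_segment_I[OF c_I[OF l(1)] y] by (auto simp: open_segment_min_max[symmetric])
  have "dist (c l) y < d"
  proof (cases "c l = y")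
    case False
    then have "min (c l) y < max (c l) y" by (auto simp: min_def max_def)
    from M[OF this I nz] show ?thesis by (auto simp: dist_real_def min_def max_def split: if_splits)
  qed (use d in simp)
  then show "\<exists>x\<in>c ` {1..}. dist x y < d" using l(1) by auto
qed

text \<open>A window without releases makes the current branch high, at least \<open>K + 9\<close>,
  so its critical end point has a record of more than \<open>K\<close> steps. The margin 10 absorbs
  the offsets of the branch time and of the record.\<close>

lemma shadowing_if_not_released:
  assumes t: "t \<in> {c 2<..<c 1}" and nz: "\<And>i. (f ^^ i) t \<noteq> 0"
    and n: "K + 10 \<le> n" and not: "\<And>m. n - (K + 10) \<le> m \<Longrightarrow> m \<le> n \<Longrightarrow> \<not> released t m"
  shows "(f ^^ (n - K)) t \<in> shadowing K"
proof -
  obtain n' k x y where br: "branch n' k x y" "t \<in> open_segment x y" and n': "n \<le> n'" "n' \<le> n + 1"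
    using branch_exists[OF t nz, of n] by blast
  have Sk: "K + 9 \<le> S k"
    using branch_released[OF br]
  proof (elim disjE exE conjE)
    assume "n' \<le> S k"
    with n n' show ?thesis by simp
  next
    fix m assume m: "released t m" "m < n'" "n' \<le> m + S k + 2"
    then have "\<not> (n - (K + 10) \<le> m)" using not n' by (metis add.commute leD le_less_linear less_Suc_eq_le order_le_less_trans order_less_le_trans plus_1_eq_Suc)
    with m n n' show ?thesis by simp
  qed
  define l where "l = S k - (n' - n) - K"
  have l: "1 \<le> l" using Sk n' by (simp add: l_def)
  have "sgn ((f ^^ i) ((f ^^ (n - K)) t)) = sgn (c (l + i))" if i: "i < K" for i
  proof -
    define j where "j = (n' - n) + (K - i)"
    have j: "1 \<le> j" "j \<le> S k - 2" "n' - j = i + (n - K)" "S k - j = l + i"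
      using i n n' Sk by (auto simp: j_def l_def)
    from branch_shadow[OF br j(1,2)] show ?thesis by (simp only: j(3,4) funpow_add comp_apply)
  qed
  with l show ?thesis unfolding shadowing_def by blast
qed

end

section \<open>From recurring releases to the lower bound\<close>

context bounded_kneading_acip
begin

text \<open>At a late time with many releases, a proportion \<open>\<eta> / 36 * \<epsilon>\<close>
  of the released part of \<open>A\<close> lands within \<epsilon> of 0, and invariance moves this
  mass to time 0. On \<open>A\<close> the two measures are comparable through \<open>l\<close> and
  \<open>L\<close>; the time \<open>n\<close> depends on \<epsilon> and on the error
  \<open>e\<close>, but \<kappa> does not.\<close>

lemma release_sets_density:
  assumes \<theta>: "0 < \<theta>" and often: "\<And>N. \<exists>n\<ge>N. \<theta> \<le> measure \<mu> (\<Union>(release_sets i pos n))"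
  shows "\<exists>\<kappa>>0. \<forall>\<epsilon>. 0 < \<epsilon> \<and> \<epsilon> \<le> \<delta> \<longrightarrow> \<kappa> * \<epsilon> \<le> measure \<mu> {-\<epsilon><..<\<epsilon>}"
proof -
  have "0 < \<theta> / 2" using \<theta> by simp
  from density_sandwich[OF prob_space_axioms sets_\<mu> ac_leb this] obtain A l L where
    A: "A \<in> sets borel" and lL: "0 < l" "0 < L" and compl: "measure \<mu> (- A) < \<theta> / 2"
    and sand: "\<And>B. B \<in> sets borel \<Longrightarrow> B \<subseteq> A \<Longrightarrow> l * measure leb B \<le> measure \<mu> B \<and> measure \<mu> B \<le> L * measure leb B"
    by metis
  define \<kappa> where "\<kappa> = l * (\<eta> / 36 * (\<theta> / 2 / L))"
  have \<kappa>: "0 < \<kappa>" using lL \<theta> \<eta> by (simp add: \<kappa>_def)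
  have "\<kappa> * \<epsilon> \<le> measure \<mu> {-\<epsilon><..<\<epsilon>}" if \<epsilon>: "0 < \<epsilon>" "\<epsilon> \<le> \<delta>" for \<epsilon>
  proof (rule field_le_epsilon)
    fix e :: real assume e: "0 < e"
    define k where "k = \<eta> / 36 * \<epsilon>"
    define q where "q = (if pos then \<epsilon> else - \<epsilon>)"
    have q: "0 \<in> closed_segment 0 q" "0 \<noteq> q" "\<bar>0 - q\<bar> = \<epsilon>" using \<epsilon> by (auto simp: q_def)
    have k: "0 < k" using \<eta> \<epsilon> by (simp add: k_def)
    have "\<eta> / 36 * \<epsilon> \<le> 1 * 1" using \<eta> \<epsilon> \<delta> by (intro mult_mono) auto
    then have k1: "k \<le> 1" by (simp add: k_def)
    \<comment> \<open>The approximation error is later multiplied by \<open>l\<close>, which leaves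
      \<open>e\<close>.\<close>
    have "0 < e / l" using e lL by simp
    from proportion_lower_bound[OF A k k1 this] obtain d where d: "0 < d"
      and low: "\<And>F h. finite F \<Longrightarrow> disjoint F \<Longrightarrow> (\<And>G. G \<in> F \<Longrightarrow> G \<in> sets borel \<and> h G \<in> sets borel \<and> h G \<subseteq> G \<and>
        k * measure leb G \<le> measure leb (h G) \<and> (\<forall>x\<in>G. \<forall>y\<in>G. dist x y < d)) \<Longrightarrow>
      k * measure leb (A \<inter> \<Union>F) - e / l \<le> measure leb (A \<inter> (\<Union>G\<in>F. h G))" by metis
    from small_release_intervals[OF d] obtain M
      where M: "\<And>n i z w. release_interval n i z w \<Longrightarrow> M \<le> n \<Longrightarrow> \<bar>z - w\<bar> < d" by blast
    obtain n where n: "M \<le> n" "\<theta> \<le> measure \<mu> (\<Union>(release_sets i pos n))" using often by blast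
    define F where "F = release_sets i pos n"
    define h where "h = part 0 q n"
    have h_borel: "h G \<in> sets borel" if "G \<in> sets borel" for G
      using that vimage_borel[of "open_segment 0 q" n] unfolding h_def part_def by auto
    have FG: "G \<in> sets borel \<and> h G \<in> sets borel \<and> h G \<subseteq> G \<and>
        k * measure leb G \<le> measure leb (h G) \<and> (\<forall>x\<in>G. \<forall>y\<in>G. dist x y < d)" if "G \<in> F" for G
    proof -
      from that obtain z w where G: "G = open_segment z w" and R: "release_interval n i z w"
        and pos: "(0 < (f ^^ n) w) = pos" unfolding F_def release_sets_def by blast
      have "dist x y < d" if "x \<in> G" "y \<in> G" for x y
        using that M[OF R n(1)] unfolding G by (auto simp: open_segment_real dist_real_def)
      moreover have "q \<in> closed_segment 0 ((f ^^ n) w)"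
        using pos release_interval_zero(4)[OF R] \<epsilon> by (auto simp: q_def closed_segment_real)
      from release_interval_part[OF R q(1,2) this]
      have "k * measure leb G \<le> measure leb (h G)" unfolding q(3) by (simp add: k_def h_def G)
      ultimately show ?thesis using h_borel by (auto simp: G h_def part_def)
    qed
    have fin: "finite F" and dis: "disjoint F" and UF: "\<Union>F \<in> sets borel"
      using finite_release_sets disjoint_release_sets release_sets_borel by (auto simp: F_def)
    have low': "k * measure leb (A \<inter> \<Union>F) - e / l \<le> measure leb (A \<inter> (\<Union>G\<in>F. h G))"
      by (rule low[OF fin dis FG])
    have hF: "(\<Union>G\<in>F. h G) \<in> sets borel" using fin FG by (intro sets.finite_UN) auto
    have "\<theta> \<le> measure \<mu> (A \<inter> \<Union>F \<union> (- A))"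
      using n(2) A UF unfolding F_def[symmetric] by (intro order_trans[OF n(2)[folded F_def] finite_measure_mono]) (auto simp: sets_\<mu>)
    also have "\<dots> \<le> measure \<mu> (A \<inter> \<Union>F) + measure \<mu> (- A)"
      using A UF by (intro measure_Un_le) (auto simp: sets_\<mu>)
    finally have "\<theta> / 2 \<le> measure \<mu> (A \<inter> \<Union>F)" using compl by linarith
    also have "\<dots> \<le> L * measure leb (A \<inter> \<Union>F)" using sand[of "A \<inter> \<Union>F"] A UF by auto
    finally have "\<theta> / 2 / L \<le> measure leb (A \<inter> \<Union>F)" using lL by (simp add: pos_divide_le_eq mult.commute)
    then have "k * (\<theta> / 2 / L) \<le> k * measure leb (A \<inter> \<Union>F)" using k by (intro mult_left_mono) auto
    with low' have "k * (\<theta> / 2 / L) - e / l \<le> measure leb (A \<inter> (\<Union>G\<in>F. h G))" by linarith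
    then have "l * (k * (\<theta> / 2 / L) - e / l) \<le> l * measure leb (A \<inter> (\<Union>G\<in>F. h G))"
      using lL by (intro mult_left_mono) auto
    also have "\<dots> \<le> measure \<mu> (A \<inter> (\<Union>G\<in>F. h G))" using sand[of "A \<inter> (\<Union>G\<in>F. h G)"] A hF by auto
    also have "\<dots> \<le> measure \<mu> ((f ^^ n) -` {-\<epsilon><..<\<epsilon>})"
    proof (rule finite_measure_mono)
      have "open_segment 0 q \<subseteq> {-\<epsilon><..<\<epsilon>}" using \<epsilon> by (auto simp: q_def open_segment_real)
      then show "A \<inter> (\<Union>G\<in>F. h G) \<subseteq> (f ^^ n) -` {-\<epsilon><..<\<epsilon>}" unfolding h_def part_def by blast
    qed (use vimage_borel in \<open>simp add: sets_\<mu>\<close>)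
    also have "\<dots> = measure \<mu> {-\<epsilon><..<\<epsilon>}" by (rule measure_vimage) simp
    finally have "l * (k * (\<theta> / 2 / L) - e / l) \<le> measure \<mu> {-\<epsilon><..<\<epsilon>}" .
    moreover have "l * (k * (\<theta> / 2 / L) - e / l) = \<kappa> * \<epsilon> - e"
      using lL by (simp add: \<kappa>_def k_def right_diff_distrib)
    ultimately show "\<kappa> * \<epsilon> \<le> measure \<mu> {-\<epsilon><..<\<epsilon>} + e" by linarith
  qed
  with \<kappa> show ?thesis by blast
qed

text \<open>If releases become rare, a union bound over a window of \<open>H + 1\<close> times
  leaves little mass released in it. The rest shadows at time \<open>n - K\<close>, and invariance
  removes the time.\<close>

lemma measure_shadowing:
  assumes lim: "(\<lambda>n. measure \<mu> {t. released t n}) \<longlonglongrightarrow> 0"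
  shows "measure \<mu> (shadowing K) = 1"
proof -
  define H where "H = K + 10"
  have rb: "{t. released t n} \<in> sets borel" for n
    unfolding released_iff using release_sets_borel by (intro sets.Un)
  define E where "E = {t. (\<exists>i. (f ^^ i) t = 0) \<or> (\<exists>i. (f ^^ i) t = c 2)} \<union> {c 1, c 2}"
  have "countable E" unfolding E_def using countable_exceptional by simp
  then have E: "E \<in> null_sets \<mu>" by (rule countable_null)
  have "1 \<le> measure \<mu> (shadowing K) + e" if e: "0 < e" for e
  proof -
    have "0 < e / real (H + 1)" using e by simp
    with lim have "\<forall>\<^sub>F n in sequentially. measure \<mu> {t. released t n} < e / real (H + 1)"
      by (rule order_tendstoD(2))
    then obtain N where N: "\<And>n. n \<ge> N \<Longrightarrow> measure \<mu> {t. released t n} < e / real (H + 1)"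
      by (auto simp: eventually_sequentially)
    define n where "n = N + H"
    define B where "B = (\<Union>m\<in>{N..N + H}. {t. released t m})"
    have Bb: "B \<in> sets borel" unfolding B_def using rb by (intro sets.finite_UN) auto
    have "measure \<mu> B \<le> (\<Sum>m\<in>{N..N + H}. measure \<mu> {t. released t m})"
      unfolding B_def by (rule measure_UNION_le) (use rb in \<open>auto simp: sets_\<mu>\<close>)
    also have "\<dots> \<le> (\<Sum>m\<in>{N..N + H}. e / real (H + 1))" using N by (intro sum_mono less_imp_le) auto
    also have "\<dots> = e" by simp
    finally have mB: "measure \<mu> B \<le> e" .
    have sub: "{c 2..c 1} \<subseteq> (f ^^ (n - K)) -` shadowing K \<union> B \<union> E"
    proof
      fix t assume t: "t \<in> {c 2..c 1}"
      show "t \<in> (f ^^ (n - K)) -` shadowing K \<union> B \<union> E"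
      proof (cases "t \<in> E \<or> t \<in> B")
        case False
        then have t': "t \<in> {c 2<..<c 1}" "\<And>i. (f ^^ i) t \<noteq> 0" using t by (auto simp: E_def less_le)
        have "\<not> released t m" if "n - (K + 10) \<le> m" "m \<le> n" for m
          using False that by (auto simp: B_def n_def H_def)
        then have "(f ^^ (n - K)) t \<in> shadowing K"
          using shadowing_if_not_released[OF t', of K n] by (simp add: n_def H_def)
        then show ?thesis by blast
      qed blast
    qed
    have Sb: "(f ^^ (n - K)) -` shadowing K \<in> sets borel" by (rule vimage_borel[OF shadowing_borel])
    have Eb: "E \<in> sets borel" using E by (simp add: null_sets_def sets_\<mu>)
    have "1 \<le> measure \<mu> ((f ^^ (n - K)) -` shadowing K \<union> B \<union> E)"
      using finite_measure_mono[OF sub] Sb Bb Eb measure_I by (simp add: sets_\<mu> sets.Un)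
    also have "\<dots> \<le> measure \<mu> ((f ^^ (n - K)) -` shadowing K \<union> B) + measure \<mu> E"
      using Sb Bb Eb by (intro measure_Un_le) (auto simp: sets_\<mu>)
    also have "measure \<mu> E = 0" using E by (rule measure_eq_0_null_sets)
    also have "measure \<mu> ((f ^^ (n - K)) -` shadowing K \<union> B) \<le> measure \<mu> ((f ^^ (n - K)) -` shadowing K) + measure \<mu> B"
      using Sb Bb by (intro measure_Un_le) (auto simp: sets_\<mu>)
    also have "measure \<mu> ((f ^^ (n - K)) -` shadowing K) = measure \<mu> (shadowing K)"
      by (rule measure_vimage[OF shadowing_borel])
    finally show ?thesis using mB by simp
  qed
  then have "1 \<le> measure \<mu> (shadowing K)" by (rule field_le_epsilon)
  then show ?thesis using prob_le_1[of "shadowing K"] by linarith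
qed

lemma not_all_released_rarely: "\<not> (\<lambda>n. measure \<mu> {t. released t n}) \<longlonglongrightarrow> 0"
proof
  assume lim: "(\<lambda>n. measure \<mu> {t. released t n}) \<longlonglongrightarrow> 0"
  have "AE t in \<mu>. t \<in> shadowing K" for K
    using measure_shadowing[OF lim, of K] shadowing_borel by (intro AE_prob_1)
  then have "AE t in \<mu>. \<forall>K. t \<in> shadowing K" by (simp add: AE_all_countable)
  moreover have "AE t in \<mu>. t \<in> {c 2..c 1}" by (rule AE_prob_1[OF measure_I])
  moreover have "\<Lambda> \<in> null_sets leb"
    using measure_\<Lambda> borel_compact[OF \<Lambda>_compact] by (simp add: null_sets_def leb.emeasure_eq_measure)
  then have "\<Lambda> \<in> null_sets \<mu>" using ac_leb by (auto simp only: absolutely_continuous_def)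
  then have "AE t in \<mu>. t \<notin> \<Lambda>" by (rule AE_not_in)
  ultimately have "AE t in \<mu>. False" by eventually_elim (use shadowing_limit in blast)
  then show False by simp
qed

theorem acip_lower_bound:
  \<comment> \<open>Releases fall into four classes, by delay 1 or 2 and by side. If the bound
    failed, the mass of each class would tend to 0, and hence that of all releases.\<close>
  "\<exists>\<kappa>>0. \<forall>\<epsilon>. 0 < \<epsilon> \<and> \<epsilon> \<le> \<delta> \<longrightarrow> \<kappa> * \<epsilon> \<le> measure \<mu> {-\<epsilon><..<\<epsilon>}"
proof (rule ccontr)
  assume no: "\<not> ?thesis"
  have lim: "(\<lambda>n. measure \<mu> (\<Union>(release_sets i pos n))) \<longlonglongrightarrow> 0" for i pos
  proof (rule LIMSEQ_I)
    fix r :: real assume "0 < r"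
    with no release_sets_density[of r i pos] have "\<exists>N. \<forall>n\<ge>N. measure \<mu> (\<Union>(release_sets i pos n)) < r"
      by (metis not_le)
    then show "\<exists>N. \<forall>n\<ge>N. norm (measure \<mu> (\<Union>(release_sets i pos n)) - 0) < r" by simp
  qed
  let ?m = "\<lambda>i pos n. measure \<mu> (\<Union>(release_sets i pos n))"
  have "(\<lambda>n. ?m 1 True n + ?m 1 False n + (?m 2 True n + ?m 2 False n)) \<longlonglongrightarrow> 0 + 0 + (0 + 0)"
    by (intro tendsto_add lim)
  then have lim0: "(\<lambda>n. ?m 1 True n + ?m 1 False n + (?m 2 True n + ?m 2 False n)) \<longlonglongrightarrow> 0" by simp
  have "measure \<mu> {t. released t n} \<le> ?m 1 True n + ?m 1 False n + (?m 2 True n + ?m 2 False n)" for n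
    unfolding released_iff using release_sets_borel
    by (intro order_trans[OF measure_Un_le add_mono[OF measure_Un_le measure_Un_le]]) (auto simp: sets_\<mu>)
  then have "(\<lambda>n. measure \<mu> {t. released t n}) \<longlonglongrightarrow> 0"
    by (intro tendsto_sandwich[OF _ _ tendsto_const lim0]) (auto intro: always_eventually)
  with not_all_released_rarely show False by blast
qed

end

section \<open>Recurrence of the turning point\<close>

context bounded_kneading
begin

text \<open>A shift by \<open>r\<close> in the numbering of cutting times is a shift by
  \<open>q = S r - S 0\<close> in time, and the signs between cutting times are determined by
  \<open>Q\<close>. As \<open>Q r = 1\<close>, the time \<open>q\<close> is the middle of a gap of
  length 2, where the orbit is positive.\<close>

lemma sgn_periodic:
  assumes "1 \<le> r" "S r = Suc q" "Q r = 1" and per: "\<And>k. 1 \<le> k \<Longrightarrow> k \<le> K \<Longrightarrow> Q (k + r) = Q k"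
  shows "0 < c q" "1 \<le> i \<Longrightarrow> i \<le> S K \<Longrightarrow> sgn (c (i + q)) = sgn (c i)"
proof -
  obtain r' where r': "r = Suc r'" using assms(1) by (metis Suc_le_D One_nat_def)
  have q: "q = Suc (S r')" using assms(2,3) S_Suc[of r'] S_1 by (simp add: r')
  show "0 < c q" using c_sign(3)[of r'] assms(3) by (simp add: q r')
  have pos: "0 < c (Suc q)" using c_sign(2)[of r'] assms(2,3) by (simp add: r')
  have shift: "S (k + r) = S k + q" if "k \<le> K" for k
    using that
  proof (induction k)
    case 0
    then show ?case using assms(2) by (simp add: S_0)
  next
    case (Suc k)
    then show ?case using S_Suc[of "k + r"] S_Suc[of k] per[of "Suc k"] by simp
  qed
  assume i: "1 \<le> i" "i \<le> S K"
  show "sgn (c (i + q)) = sgn (c i)"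
  proof (cases "i = 1")
    case True
    then show ?thesis using pos c_1_pos by simp
  next
    case False
    then obtain k where k: "i = S k + 1 \<or> i = S k + 2 \<and> Q (Suc k) = 1" using time_cases[of i] i by auto
    have "mono S" by (rule incseq_SucI) (simp add: S_Suc)
    have kK: "Suc k \<le> K"
    proof (rule ccontr)
      assume "\<not> Suc k \<le> K"
      then have "S K \<le> S k" using \<open>mono S\<close> by (simp add: monoD)
      with k i(2) show False by auto
    qed
    have Sk: "S (k + r) = S k + q" and Q: "Q (Suc (k + r)) = Q (Suc k)"
      using shift[of k] per[of "Suc k"] kK by simp_all
    from Q_cases[of "Suc k"] k consider "Q (Suc k) = 0" "i = S k + 1" | "Q (Suc k) = 1" "i = S k + 1"
      | "Q (Suc k) = 1" "i = S k + 2" by auto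
    then show ?thesis
    proof cases
      case 1
      then show ?thesis using crit_neg[of k] crit_neg[of "k + r"] Q Sk by (simp add: c_def add_ac)
    next
      case 2
      then show ?thesis using crit_pos[of k] crit_pos[of "k + r"] Q Sk by (simp add: c_def add_ac)
    next
      case i2: 3
      then have "0 < c (S k + 2)" "0 < c (S k + q + 2)"
        using crit_pos[of k, folded c_def] crit_pos[of "k + r", folded c_def] Q Sk by simp_all
      moreover have "i + q = S k + q + 2" using i2 by simp
      ultimately have "0 < c (i + q)" "0 < c i" using i2(2) by simp_all
      then show ?thesis by simp
    qed
  qed
qed

text \<open>Equal signs make \<open>f ^^ q\<close> monotone from 0 to \<open>c (j * q)\<close>. If
  \<open>c (2 * q)\<close> were below \<open>c q\<close>, the iterate would map the interval from 0
  to \<open>c q\<close> into itself and create a homterval. So the first return moves outwards, and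
  monotonicity passes this on.\<close>

lemma recurrence_order:
  assumes q: "1 \<le> q" "0 < c q" and per: "\<forall>i\<in>{1..N * q}. sgn (c (i + q)) = sgn (c i)"
  shows "1 \<le> j \<Longrightarrow> j \<le> N \<Longrightarrow> c q \<le> c (j * q) \<and> c (j * q) < c (Suc j * q) \<and> zero_free b (Suc q) (open_segment 0 (c (j * q)))"
proof -
  have cong: "sgn (c (i + j * q)) = sgn (c i)" if "1 \<le> i" "i \<le> q" "j \<le> N" for i j
    using that(3)
  proof (induction j)
    case (Suc j)
    have "i + j * q \<le> q + j * q" using that(2) by simp
    also have "\<dots> = Suc j * q" by simp
    also have "\<dots> \<le> N * q" using Suc.prems by (rule mult_le_mono1)
    finally have "sgn (c ((i + j * q) + q)) = sgn (c (i + j * q))" using that(1) per by simp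
    then show ?case using Suc by (simp add: add_ac)
  qed simp
  have pos: "0 < c (j * q)" if j: "1 \<le> j" "j \<le> Suc N" for j
  proof -
    obtain k where k: "j = Suc k" using j(1) by (cases j) auto
    from cong[of q k] q j k have "sgn (c (q + k * q)) = 1" by simp
    then show ?thesis by (simp add: k sgn_1_pos)
  qed
  have nz: "zero_free b (Suc q) (open_segment 0 (c (j * q)))" if "1 \<le> j" "j \<le> N" for j
  proof -
    have "zero_free b q (open_segment (c (Suc 0)) (c (Suc (j * q))))"
    proof (rule zero_free_if_same_sgn)
      fix i assume "i < q"
      then have "sgn (c (Suc i + j * q)) = sgn (c (Suc i))" using that by (intro cong) auto
      then show "sgn ((f ^^ i) (c (Suc 0))) = sgn ((f ^^ i) (c (Suc (j * q)))) \<and> (f ^^ i) (c (Suc 0)) \<noteq> 0"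
        using c_nonzero[of "Suc i"] by (simp add: f_c add_ac)
    qed
    moreover have "f 0 = c (Suc 0)" using f_c(1)[of 0] by (simp add: c_simps)
    ultimately show ?thesis by (simp add: zero_free_Suc f_c open_segment_real)
  qed
  have f0: "(f ^^ q) 0 = c q" by (simp add: c_def)
  have fj: "(f ^^ q) (c (j * q)) = c (Suc j * q)" for j by (simp add: f_c add.commute)
  have nzq: "zero_free b q (open_segment 0 (c (j * q)))" if "1 \<le> j" "j \<le> N" for j
    by (rule zero_free_subset[OF nz[OF that]]) auto
  show "c q \<le> c (j * q) \<and> c (j * q) < c (Suc j * q) \<and> zero_free b (Suc q) (open_segment 0 (c (j * q)))"
    if "1 \<le> j" "j \<le> N" using that
  proof (induction j rule: dec_induct)
    case base
    have two: "0 < c (2 * q)" using pos[of 2] base by simp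
    have img: "(f ^^ q) ` open_segment 0 (c q) = open_segment (c q) (c (2 * q))"
      using funpow_open_segment[OF nzq[of 1]] base f0 fj[of 1] by (simp add: numeral_2_eq_2)
    have "c (2 * q) \<noteq> c q"
    proof
      assume "c (2 * q) = c q"
      then have "(f ^^ q) 0 = (f ^^ q) (c q)" using f0 fj[of 1] by (simp add: numeral_2_eq_2)
      then have "0 = c q" using funpow_inj_on[OF nzq[of 1]] base by (auto dest: inj_onD)
      with q show False by simp
    qed
    moreover have "\<not> c (2 * q) < c q"
    proof
      assume lt: "c (2 * q) < c q"
      have maps: "(f ^^ q) t \<in> open_segment 0 (c q)" if "t \<in> open_segment 0 (c q)" for t
      proof -
        have "(f ^^ q) t \<in> open_segment (c q) (c (2 * q))" using img that by blast
        with lt two show ?thesis by (auto simp: open_segment_real)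
      qed
      have all: "(f ^^ n) t \<noteq> 0" if "t \<in> open_segment 0 (c q)" for n t
        using that
      proof (induction n arbitrary: t rule: less_induct)
        case (less n)
        show ?case
        proof (cases "n < Suc q")
          case True
          then show ?thesis using nz[of 1] base less.prems unfolding zero_free_def by simp
        next
          case False
          then have "n - q + q = n" by simp
          then have "(f ^^ n) t = (f ^^ (n - q)) ((f ^^ q) t)" by (metis comp_apply funpow_add)
          moreover have "n - q < n" using False q by simp
          ultimately show ?thesis using less.IH[of "n - q" "(f ^^ q) t"] maps[OF less.prems] by simp
        qed
      qed
      have "homterval 0 (c q)"
        unfolding homterval_def
      proof (intro conjI)
        show "0 < c q" by (rule q)
        show "{0<..<c q} \<subseteq> {c 2..c 1}" using c_I[of q] q c_2_neg by auto
        show "\<forall>t\<in>{0<..<c q}. \<forall>i. (f ^^ i) t \<noteq> 0" using all by (auto simp: open_segment_real)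
      qed
      with no_homterval show False by blast
    qed
    ultimately show ?case using q nz[of 1] base by (simp add: numeral_2_eq_2)
  next
    case (step j)
    then have IH: "c q \<le> c (j * q)" "0 < c (j * q)" "c (j * q) < c (Suc j * q)" and j: "Suc j \<le> N"
      using q(2) by auto
    have nzj: "zero_free b q (open_segment 0 (c (Suc j * q)))" using nzq[of "Suc j"] j by simp
    have "c (j * q) \<in> open_segment 0 (c (Suc j * q))" using IH by (simp add: open_segment_real)
    then have "(f ^^ q) (c (j * q)) \<in> open_segment ((f ^^ q) 0) ((f ^^ q) (c (Suc j * q)))"
      using funpow_open_segment[OF nzj] by blast
    then have mem: "c (Suc j * q) \<in> open_segment (c q) (c (Suc (Suc j) * q))" unfolding f0 fj .
    with mem IH have "c (Suc j * q) < c (Suc (Suc j) * q)" by (auto simp: open_segment_real)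
    then show ?case using IH nz[of "Suc j"] j by linarith
  qed
qed

text \<open>\<open>f\<close> is even, so \<open>x\<close> may be replaced by its absolute value; its
  \<open>i\<close>-th return then stays between the returns \<open>c (i * q)\<close> and
  \<open>c (Suc i * q)\<close>.\<close>

lemma recurrence_escape:
  assumes q: "1 \<le> q" "0 < c q" and per: "\<forall>i\<in>{1..N * q}. sgn (c (i + q)) = sgn (c i)"
    and x: "\<bar>x\<bar> < c q" and j: "1 \<le> j" "j \<le> N"
  shows "c q \<le> (f ^^ (j * q)) x"
proof -
  note ord = recurrence_order[OF q per]
  have c0: "c (0 * q) = 0" by (simp add: c_simps)
  have iter: "(f ^^ (Suc j * q)) t = (f ^^ q) ((f ^^ (j * q)) t)" for j t
    by (simp add: funpow_add)
  show ?thesis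
  proof (cases "x = 0")
    case True
    then show ?thesis using ord[OF j] by (simp add: c_def)
  next
    case False
    have abs: "(f ^^ (j * q)) x = (f ^^ (j * q)) \<bar>x\<bar>"
    proof -
      obtain m where "j * q = Suc m" using j q by (metis Suc_pred mult_pos_pos not_gr_zero not_one_le_zero)
      moreover have "f x = f \<bar>x\<bar>" by (simp add: qmap_def)
      ultimately show ?thesis by (simp add: funpow_swap1)
    qed
    have "(f ^^ (i * q)) \<bar>x\<bar> \<in> open_segment (c (i * q)) (c (Suc i * q))" if "i \<le> N" for i
      using that
    proof (induction i)
      case 0
      then show ?case using False x by (simp add: c_simps open_segment_real)
    next
      case (Suc i)
      have nz: "zero_free b q (open_segment (c (i * q)) (c (Suc i * q)))"
      proof (rule zero_free_subset)
        show "zero_free b (Suc q) (open_segment 0 (c (Suc i * q)))" using ord[of "Suc i"] Suc.prems by simp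
        have "0 \<le> c (i * q) \<and> c (i * q) < c (Suc i * q)"
          using ord[of i] Suc.prems q(2) c0 by (cases "i = 0") auto
        then show "open_segment (c (i * q)) (c (Suc i * q)) \<subseteq> open_segment 0 (c (Suc i * q))"
          by (auto simp: open_segment_real)
      qed simp
      have "(f ^^ q) ((f ^^ (i * q)) \<bar>x\<bar>) \<in> open_segment ((f ^^ q) (c (i * q))) ((f ^^ q) (c (Suc i * q)))"
        using funpow_open_segment[OF nz] Suc by (metis Suc_leD imageI)
      then show ?case unfolding iter by (simp add: f_c add.commute)
    qed
    from this[OF j(2)] ord[OF j] abs show ?thesis by (auto simp: open_segment_real)
  qed
qed

end

context bounded_kneading_acip
begin

text \<open>The sets \<open>(f ^^ (j * q)) -` {- c q<..<c q}\<close>, \<open>j \<le> N\<close>, are disjoint and have the same measure.\<close>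

lemma recurrence_measure:
  assumes q: "1 \<le> q" "0 < c q" and per: "\<forall>i\<in>{1..N * q}. sgn (c (i + q)) = sgn (c i)"
  shows "real N * measure \<mu> {- c q<..<c q} \<le> 1"
proof -
  define E where "E j = (f ^^ (j * q)) -` {- c q<..<c q}" for j
  have E: "E j \<in> sets borel" for j unfolding E_def by (rule vimage_borel) simp
  have disj: "E i \<inter> E j = {}" if "i < j" "j \<le> N" for i j
  proof (rule ccontr)
    assume "E i \<inter> E j \<noteq> {}"
    then obtain x where "x \<in> E i" "x \<in> E j" by blast
    then have x: "\<bar>(f ^^ (i * q)) x\<bar> < c q" "\<bar>(f ^^ (j * q)) x\<bar> < c q" by (auto simp: E_def abs_less_iff)
    have "j * q = (j - i) * q + i * q" using that by (simp add: diff_mult_distrib)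
    then have "(f ^^ (j * q)) x = (f ^^ ((j - i) * q)) ((f ^^ (i * q)) x)" by (simp add: funpow_add)
    moreover have "c q \<le> (f ^^ ((j - i) * q)) ((f ^^ (i * q)) x)"
      by (rule recurrence_escape[OF q per x(1)]) (use that in auto)
    ultimately show False using x(2) by simp
  qed
  have "disjoint_family_on E {..<N}"
    unfolding disjoint_family_on_def using disj by (metis Int_commute lessThan_iff less_imp_le linorder_neqE_nat)
  then have "measure \<mu> (\<Union>j<N. E j) = (\<Sum>j<N. measure \<mu> (E j))"
    by (intro finite_measure_finite_Union) (use E in \<open>auto simp: sets_\<mu>\<close>)
  also have "\<dots> = (\<Sum>j<N. measure \<mu> {- c q<..<c q})"
    unfolding E_def by (intro sum.cong refl measure_vimage) simp
  finally show ?thesis using prob_le_1[of "\<Union>j<N. E j"] by simp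
qed

end

section \<open>Multipliers and close returns\<close>

lemma qmap_funpow_deriv:
  "((qmap b ^^ n) has_real_derivative (\<Prod>i<n. - 2 * (qmap b ^^ i) x)) (at x)"
proof (induction n)
  case 0
  then show ?case by (auto intro!: derivative_eq_intros simp: id_def)
next
  case (Suc n)
  have "((\<lambda>x. b - ((qmap b ^^ n) x)\<^sup>2) has_real_derivative
      - (2 * (qmap b ^^ n) x * (\<Prod>i<n. - 2 * (qmap b ^^ i) x))) (at x)"
    using Suc by (auto intro!: derivative_eq_intros)
  moreover have "(qmap b ^^ Suc n) = (\<lambda>x. b - ((qmap b ^^ n) x)\<^sup>2)" by (auto simp: qmap_def)
  ultimately show ?case by (simp add: mult.commute mult.left_commute)
qed

context bounded_kneading
begin

text \<open>If \<open>c q\<close> were closer to the turning point, then \<open>f ^^ q\<close> would contract an interval around it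
  into itself.\<close>

lemma return_lower_bound:
  assumes rep: "\<And>n y. 1 \<le> n \<Longrightarrow> (f ^^ n) y = y \<Longrightarrow> 1 \<le> \<bar>\<Prod>i<n. - 2 * (f ^^ i) y\<bar>"
    and q: "1 \<le> q"
  shows "3 / 4 / 4 ^ q < \<bar>c q\<bar>"
proof (rule ccontr)
  assume "\<not> ?thesis"
  then have cq: "\<bar>c q\<bar> \<le> 3 / 4 / 4 ^ q" by simp
  obtain m where m: "q = Suc m" using q by (cases q) auto
  \<comment> \<open>The first step shrinks radius \<open>r\<close> to \<open>r * r\<close>, the
    other \<open>m = q - 1\<close> steps expand at most by 4 each: the image has radius
    \<open>r / 4\<close> around \<open>c q\<close>. With \<open>\<bar>c q\<bar>\<close> at most
    \<open>3 / 4 * r\<close> it stays within \<open>r\<close> of 0.\<close>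
  define r :: real where "r = 1 / 4 ^ q"
  have r: "0 < r" "r \<le> 1" by (auto simp: r_def)
  have r4: "4 ^ m * r = 1 / 4" by (simp add: r_def m)
  have rb: "\<bar>x\<bar> \<le> b" if "\<bar>x\<bar> \<le> r" for x using that r b_gt by linarith
  have close: "\<bar>(f ^^ q) x\<bar> \<le> r" if x: "\<bar>x\<bar> \<le> r" for x
  proof -
    have "\<bar>(f ^^ m) (f x) - (f ^^ m) (f 0)\<bar> \<le> 4 ^ m * \<bar>f x - f 0\<bar>"
      using f_bound[OF rb[OF x]] f_bound[of 0] b_gt by (intro funpow_lipschitz I_bound) auto
    also have "\<bar>f x - f 0\<bar> = \<bar>x\<bar> * \<bar>x\<bar>" by (simp add: qmap_def power2_eq_square)
    also have "4 ^ m * (\<bar>x\<bar> * \<bar>x\<bar>) \<le> 4 ^ m * (r * r)"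
      using x by (intro mult_left_mono mult_mono) auto
    also have "4 ^ m * (r * r) = r / 4" using r4 by (simp add: mult.assoc[symmetric])
    finally have "\<bar>(f ^^ q) x - c q\<bar> \<le> r / 4" by (simp add: m c_def funpow_swap1)
    with cq show ?thesis by (simp add: r_def)
  qed
  have "\<exists>x\<ge>-r. x \<le> r \<and> (f ^^ q) x - x = 0"
  proof (rule IVT2')
    show "continuous_on {-r..r} (\<lambda>x. (f ^^ q) x - x)"
      using continuous_on_subset[OF qmap_funpow_continuous] by (intro continuous_intros) auto
  qed (use close[of r] close[of "-r"] r in auto)
  then obtain x where "- r \<le> x" "x \<le> r" "(f ^^ q) x - x = 0" by blast
  then have x: "\<bar>x\<bar> \<le> r" "(f ^^ q) x = x" by simp_all
  \<comment> \<open>The fixed point lies within \<open>r\<close> of 0, so one factor is at most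
    \<open>2 * r\<close> and the others at most 4: the multiplier is at most 1/2.\<close>
  have "\<bar>\<Prod>i<q. - 2 * (f ^^ i) x\<bar> = (\<Prod>i<q. 2 * \<bar>(f ^^ i) x\<bar>)"
    by (simp add: abs_prod abs_mult)
  also have "\<dots> = 2 * \<bar>x\<bar> * (\<Prod>i<m. 2 * \<bar>(f ^^ Suc i) x\<bar>)"
    unfolding m by (subst prod.lessThan_Suc_shift) simp
  also have "(\<Prod>i<m. 2 * \<bar>(f ^^ Suc i) x\<bar>) \<le> (\<Prod>i<m. 4)"
  proof (rule prod_mono)
    fix i
    have "(f ^^ Suc i) x = (f ^^ i) (f x)" by (simp add: funpow_swap1)
    then have "\<bar>(f ^^ Suc i) x\<bar> \<le> b" using I_bound[OF funpow_I[OF f_bound[OF rb[OF x(1)]]]] by simp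
    then show "0 \<le> 2 * \<bar>(f ^^ Suc i) x\<bar> \<and> 2 * \<bar>(f ^^ Suc i) x\<bar> \<le> 4" using b_lt by simp
  qed
  then have "2 * \<bar>x\<bar> * (\<Prod>i<m. 2 * \<bar>(f ^^ Suc i) x\<bar>) \<le> 2 * r * 4 ^ m"
    using x(1) by (intro mult_mono prod_nonneg) auto
  also have "2 * r * 4 ^ m = 2 * (4 ^ m * r)" by (simp only: mult_ac)
  also have "\<dots> = 1 / 2" unfolding r4 by simp
  finally show False using rep[OF q x(2)] by simp
qed

end

section \<open>Continued fractions\<close>

lemma cf_value_foldr: "cf_value ds = foldr (\<lambda>d r. 1 / (real d + r)) ds 0"
  by (induction ds) auto

context
  fixes a :: "nat \<Rightarrow> nat"
  assumes digits: "\<And>n. 1 \<le> n \<Longrightarrow> 1 \<le> a n"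
begin

lemma cf_q_pos: "0 < cf_q a n"
proof -
  have "0 < cf_q a n \<and> 0 < cf_q a (Suc n)"
    by (induction n) (use digits[of 1] in auto)
  then show ?thesis ..
qed

text \<open>The value is computed from the first digit inwards while the recursions append digits at
  the end; a free tail \<open>x\<close> reconciles the two.\<close>

lemma cf_foldr:
  assumes "0 \<le> x"
  shows "foldr (\<lambda>d r. 1 / (real d + r)) (map a [1..<Suc (Suc n)]) x =
    (real (cf_p a (Suc n)) + x * real (cf_p a n)) / (real (cf_q a (Suc n)) + x * real (cf_q a n))"
  using assms
proof (induction n arbitrary: x)
  case 0
  then show ?case by simp
next
  case (Suc n)
  define d where "d = real (a (Suc (Suc n))) + x"
  have d: "0 < d" using digits[of "Suc (Suc n)"] Suc.prems by (simp add: d_def)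
  have mult: "d * (u + 1 / d * v) = d * u + v" for u v using d by (simp add: distrib_left)
  have "foldr (\<lambda>d r. 1 / (real d + r)) (map a [1..<Suc (Suc (Suc n))]) x =
      (real (cf_p a (Suc n)) + 1 / d * real (cf_p a n)) / (real (cf_q a (Suc n)) + 1 / d * real (cf_q a n))"
    using Suc.IH[of "1 / d"] d by (simp add: d_def)
  also have "\<dots> = (d * (real (cf_p a (Suc n)) + 1 / d * real (cf_p a n))) / (d * (real (cf_q a (Suc n)) + 1 / d * real (cf_q a n)))"
    using d by (intro mult_divide_mult_cancel_left[symmetric]) simp
  also have "\<dots> = (real (cf_p a (Suc (Suc n))) + x * real (cf_p a (Suc n))) / (real (cf_q a (Suc (Suc n))) + x * real (cf_q a (Suc n)))"
    unfolding mult by (simp add: d_def distrib_right add_ac)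
  finally show ?case .
qed

lemma cf_value_convergent: "cf_value (map a [1..<Suc n]) = real (cf_p a n) / real (cf_q a n)"
proof (cases n)
  case (Suc m)
  then show ?thesis using cf_foldr[of 0 m] by (simp add: cf_value_foldr)
qed simp

lemma cf_det:
  "real (cf_p a (Suc n)) * real (cf_q a n) - real (cf_p a n) * real (cf_q a (Suc n)) = (-1) ^ n"
proof (induction n)
  case (Suc n)
  have "real (cf_p a (Suc (Suc n))) * real (cf_q a (Suc n)) - real (cf_p a (Suc n)) * real (cf_q a (Suc (Suc n)))
    = - (real (cf_p a (Suc n)) * real (cf_q a n) - real (cf_p a n) * real (cf_q a (Suc n)))"
    by (simp add: algebra_simps)
  then show ?case using Suc by simp
qed simp

lemma cf_q_mono: "cf_q a n \<le> cf_q a (Suc n)"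
proof (cases n)
  case 0
  then show ?thesis using digits[of 1] by simp
next
  case (Suc m)
  have "1 * cf_q a (Suc m) \<le> a (Suc (Suc m)) * cf_q a (Suc m)"
    using digits[of "Suc (Suc m)"] by (intro mult_right_mono) auto
  then show ?thesis unfolding Suc cf_q.simps by linarith
qed

lemma cf_q_ge: "n \<le> cf_q a (2 * n)"
proof (induction n)
  case (Suc n)
  have "cf_q a (2 * n) \<le> cf_q a (Suc (2 * n))" by (rule cf_q_mono)
  moreover have "1 * cf_q a (Suc (2 * n)) \<le> a (Suc (Suc (2 * n))) * cf_q a (Suc (2 * n))"
    using digits[of "Suc (Suc (2 * n))"] by (intro mult_right_mono) auto
  moreover have "2 * Suc n = Suc (Suc (2 * n))" by simp
  ultimately show ?case using Suc cf_q_pos[of "2 * n"] by (simp only: cf_q.simps)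
qed simp

lemma cf_p_pos: "0 < cf_p a (Suc n)"
proof (induction n)
  case (Suc n)
  then show ?case using digits[of "Suc (Suc n)"] by simp
qed simp

text \<open>Even convergents increase to \<gamma> and odd ones decrease to it. By the determinant
  identity two neighbours differ by \<open>1 / (q n * q (n + 1))\<close>, and the next denominator
  is at least the next digit times the current one.\<close>

lemma even_convergent:
  assumes lim: "(\<lambda>n. cf_value (map a [1..<Suc n])) \<longlonglongrightarrow> \<gamma>" and n: "1 \<le> n"
  shows "real (cf_p a (2 * n)) \<le> \<gamma> * real (cf_q a (2 * n))"
    and "(\<gamma> * real (cf_q a (2 * n)) - real (cf_p a (2 * n))) * (real (a (2 * n + 1)) * real (cf_q a (2 * n))) \<le> 1"
proof -
  let ?p = "\<lambda>n. real (cf_p a n)" and ?q = "\<lambda>n. real (cf_q a n)"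
  define u where "u n = ?p n / ?q n" for n
  have u: "u \<longlonglongrightarrow> \<gamma>" using lim unfolding cf_value_convergent u_def .
  have q: "0 < ?q n" for n using cf_q_pos by simp
  have diff: "u (Suc n) - u n = (-1) ^ n / (?q n * ?q (Suc n))" for n
    unfolding u_def using cf_det[of n] q[of n] q[of "Suc n"]
    by (simp add: diff_frac_eq mult.commute)
  have le: "1 / (?q (Suc n) * ?q (Suc (Suc n))) \<le> 1 / (?q n * ?q (Suc n))" for n
    using q[of n] q[of "Suc n"] cf_q_mono[of n] cf_q_mono[of "Suc n"]
    by (intro divide_left_mono mult_mono mult_pos_pos) (simp_all del: cf_q.simps)
  have "incseq (\<lambda>n. u (2 * n))"
  proof (rule incseq_SucI)
    fix n
    show "u (2 * n) \<le> u (2 * Suc n)" using diff[of "2 * n"] diff[of "Suc (2 * n)"] le[of "2 * n"] by simp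
  qed
  moreover have "(\<lambda>n. u (2 * n)) \<longlonglongrightarrow> \<gamma>"
    using LIMSEQ_subseq_LIMSEQ[OF u, of "\<lambda>n. 2 * n"] by (simp add: strict_mono_def o_def)
  ultimately have lo: "u (2 * n) \<le> \<gamma>" by (rule incseq_le)
  have "decseq (\<lambda>n. u (Suc (2 * n)))"
  proof (rule decseq_SucI)
    fix n
    show "u (Suc (2 * Suc n)) \<le> u (Suc (2 * n))"
      using diff[of "Suc (2 * n)"] diff[of "Suc (Suc (2 * n))"] le[of "Suc (2 * n)"] by simp
  qed
  moreover have "(\<lambda>n. u (Suc (2 * n))) \<longlonglongrightarrow> \<gamma>"
    using LIMSEQ_subseq_LIMSEQ[OF u, of "\<lambda>n. Suc (2 * n)"] by (simp add: strict_mono_def o_def)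
  ultimately have hi: "\<gamma> \<le> u (Suc (2 * n))" by (rule decseq_ge)
  show "?p (2 * n) \<le> \<gamma> * ?q (2 * n)"
    using lo q[of "2 * n"] by (simp add: u_def pos_divide_le_eq)
  obtain m where m: "2 * n = Suc m" using n by (cases "2 * n") auto
  have "a (2 * n + 1) * cf_q a (2 * n) \<le> cf_q a (Suc (2 * n))" unfolding m by simp
  then have "real (a (2 * n + 1) * cf_q a (2 * n)) \<le> ?q (Suc (2 * n))" by (rule of_nat_mono)
  then have aq: "real (a (2 * n + 1)) * ?q (2 * n) \<le> ?q (Suc (2 * n))" by simp
  have "\<gamma> - u (2 * n) \<le> 1 / (?q (2 * n) * ?q (Suc (2 * n)))"
    using hi diff[of "2 * n"] by simp
  then have "(\<gamma> - u (2 * n)) * (?q (2 * n) * ?q (Suc (2 * n))) \<le> 1"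
    using q[of "2 * n"] q[of "Suc (2 * n)"] by (simp add: pos_le_divide_eq)
  moreover have "(\<gamma> - u (2 * n)) * ?q (2 * n) = \<gamma> * ?q (2 * n) - ?p (2 * n)"
    using q[of "2 * n"] by (simp add: u_def left_diff_distrib)
  ultimately have 1: "(\<gamma> * ?q (2 * n) - ?p (2 * n)) * ?q (Suc (2 * n)) \<le> 1"
    by (simp add: mult.assoc[symmetric])
  have "0 \<le> \<gamma> * ?q (2 * n) - ?p (2 * n)"
    using lo q[of "2 * n"] by (simp add: u_def pos_divide_le_eq)
  from mult_left_mono[OF aq this] 1
  show "(\<gamma> * ?q (2 * n) - ?p (2 * n)) * (real (a (2 * n + 1)) * ?q (2 * n)) \<le> 1"
    by linarith
qed

lemma Lambda_rec_ge: "16 \<le> Lambda_rec"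
proof -
  have e: "1 < exp (1::real)" by simp
  then have "exp 1 - 1 \<le> (exp (1::real))\<^sup>2" using power_increasing[of 1 2 "exp (1::real)"] by simp
  with e show ?thesis unfolding Lambda_rec_def by (simp add: pos_le_divide_eq)
qed

text \<open>Replacing \<open>Lambda_rec\<close> by 16 leaves enough room to absorb the factor \<open>q - p\<close>.\<close>

lemma large_digit:
  assumes div: "filterlim
           (\<lambda>N. \<Sum>n = 1..N. real (a (2 * n + 1)) * (real (cf_q a (2 * n)) - real (cf_p a (2 * n)))
                  * Lambda_rec powi (- int (cf_q a (2 * n))))
           at_top sequentially"
  shows "\<exists>n\<ge>1. C * 4 ^ cf_q a (2 * n) < real (a (2 * n + 1))"
proof (rule ccontr)
  let ?T = "\<lambda>n. real (a (2 * n + 1)) * (real (cf_q a (2 * n)) - real (cf_p a (2 * n)))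
    * Lambda_rec powi (- int (cf_q a (2 * n)))"
  assume "\<not> ?thesis"
  then have small: "real (a (2 * n + 1)) \<le> C * 4 ^ cf_q a (2 * n)" if "1 \<le> n" for n
    using that by (metis not_le)
  have C: "0 \<le> C"
  proof -
    have "0 \<le> real (a (2 * 1 + 1))" by simp
    also have "\<dots> \<le> C * 4 ^ cf_q a (2 * 1)" by (rule small) simp
    finally have "0 \<le> C * 4 ^ cf_q a (2 * 1)" .
    moreover have "0 < (4::real) ^ cf_q a (2 * 1)" by simp
    ultimately show ?thesis by (simp only: zero_le_mult_iff) linarith
  qed
  have summand: "?T n \<le> C * (1 / 2) ^ n" if n: "1 \<le> n" for n
  proof -
    let ?q = "cf_q a (2 * n)"
    have pw: "Lambda_rec powi (- int ?q) = 1 / Lambda_rec ^ ?q"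
      by (simp add: power_int_minus inverse_eq_divide)
    have "1 / Lambda_rec ^ ?q \<le> 1 / 16 ^ ?q"
      using Lambda_rec_ge by (intro divide_left_mono power_mono mult_pos_pos zero_less_power) auto
    moreover have "real ?q - real (cf_p a (2 * n)) \<le> 2 ^ ?q"
      using of_nat_less_two_power[where 'a = real, of ?q] of_nat_0_le_iff[where 'a = real, of "cf_p a (2 * n)"]
      by linarith
    ultimately have "real (a (2 * n + 1)) * (real ?q - real (cf_p a (2 * n))) * (1 / Lambda_rec ^ ?q)
      \<le> (C * 4 ^ ?q) * 2 ^ ?q * (1 / 16 ^ ?q)"
      using small[OF n] C Lambda_rec_ge
      by (smt (verit) divide_nonneg_nonneg mult_mono mult_nonneg_nonneg mult_right_mono of_nat_0_le_iff zero_le_power mult_left_mono mult_nonneg_nonpos2)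
    \<comment> \<open>\<open>4 * 2 / 16 = 1 / 2\<close>: the assumed bound on the digit, the crude
      bound for the factor \<open>q - p\<close>, and the base 16.\<close>
    also have "\<dots> = C * (1 / 2) ^ ?q"
    proof -
      have "(4::real) ^ ?q * 2 ^ ?q = 8 ^ ?q" by (simp add: power_mult_distrib[symmetric])
      moreover have "(8::real) ^ ?q * (1 / 16 ^ ?q) = (1 / 2) ^ ?q" by (simp add: power_divide[symmetric])
      ultimately show ?thesis by (metis mult.assoc)
    qed
    also have "\<dots> \<le> C * (1 / 2) ^ n"
      using C cf_q_ge[of n] by (intro mult_left_mono power_decreasing) auto
    finally show ?thesis by (simp only: pw)
  qed
  have "(\<Sum>n = 1..N. ?T n) \<le> C * 2" for N
  proof -
    have "(\<Sum>n = 1..N. ?T n) \<le> (\<Sum>n = 1..N. C * (1 / 2) ^ n)"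
      by (rule sum_mono, rule summand) simp
    also have "\<dots> \<le> (\<Sum>n<Suc N. C * (1 / 2) ^ n)"
      using C by (intro sum_mono2) auto
    also have "\<dots> = C * (\<Sum>n<Suc N. (1 / 2) ^ n)" by (simp only: sum_distrib_left)
    also have "(\<Sum>n<Suc N. (1 / 2 :: real) ^ n) \<le> 2"
      by (subst geometric_sum) (auto simp: field_simps)
    then have "C * (\<Sum>n<Suc N. (1 / 2) ^ n) \<le> C * 2" using C by (rule mult_left_mono)
    finally show ?thesis .
  qed
  moreover from div have "\<forall>\<^sub>F N in sequentially. C * 2 < (\<Sum>n = 1..N. ?T n)"
    by (simp only: filterlim_at_top_dense)
  ultimately show False by (metis (mono_tags, lifting) eventually_sequentially not_le order_refl)
qed

end

section \<open>The kneading map of angle \<open>\<gamma>\<close>\<close>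

lemma floor_step:
  fixes x y :: real
  assumes "x \<le> y" "y < x + 1"
  shows "\<lfloor>x\<rfloor> \<le> \<lfloor>y\<rfloor>" "\<lfloor>y\<rfloor> \<le> \<lfloor>x\<rfloor> + 1"
  using assms by linarith+

context
  fixes \<gamma> \<omega> :: real
  assumes \<gamma>: "0 < \<gamma>" "\<gamma> < 1 / 2" and \<omega>_def: "\<omega> = \<gamma> / (1 - \<gamma>)"
begin

definition slope_floor :: "nat \<Rightarrow> nat" where
  "slope_floor k = nat \<lfloor>real k * \<omega>\<rfloor>"

lemma \<omega>: "0 < \<omega>" "\<omega> < 1"
  using \<gamma> by (auto simp: \<omega>_def)

lemma slope_floor_int: "int (slope_floor k) = \<lfloor>real k * \<omega>\<rfloor>"
  using \<omega> by (simp add: slope_floor_def)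

lemma slope_floor_step: "slope_floor k \<le> slope_floor (Suc k)" "slope_floor (Suc k) \<le> slope_floor k + 1"
proof -
  have "real k * \<omega> \<le> real (Suc k) * \<omega>" "real (Suc k) * \<omega> < real k * \<omega> + 1"
    using \<omega> by (auto simp: distrib_right)
  from floor_step[OF this] show "slope_floor k \<le> slope_floor (Suc k)" "slope_floor (Suc k) \<le> slope_floor k + 1"
    unfolding slope_floor_int[symmetric] by linarith+
qed

lemma Q_angle_Suc: "Q_angle \<gamma> (Suc k) = slope_floor (Suc k) - slope_floor k"
proof -
  have "Q_angle \<gamma> (Suc k) = nat (\<lfloor>real (Suc k) * \<omega>\<rfloor> - \<lfloor>real k * \<omega>\<rfloor>)"
    by (simp add: Q_angle_def Let_def \<omega>_def)
  also have "\<dots> = slope_floor (Suc k) - slope_floor k"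
    unfolding slope_floor_int[symmetric] by arith
  finally show ?thesis .
qed

lemma Q_angle_le: "Q_angle \<gamma> k \<le> 1"
proof (cases k)
  case 0
  \<comment> \<open>At the dummy index 0 the formula yields 1, so the bound holds there as
    well.\<close>
  have "\<lfloor>- \<omega>\<rfloor> = -1" using \<omega> by linarith
  then show ?thesis by (simp add: 0 Q_angle_def \<omega>_def)
next
  case (Suc j)
  then show ?thesis using slope_floor_step[of j] by (simp add: Q_angle_Suc)
qed

lemma slope_floor_0: "slope_floor 0 = 0" "slope_floor (Suc 0) = 0"
  using \<omega> by (auto simp: slope_floor_def floor_eq_iff)

context
  fixes S :: "nat \<Rightarrow> nat"
  assumes S_0: "S 0 = 1" and S_Suc: "\<And>k. S (Suc k) = S k + Suc (Q_angle \<gamma> (Suc k))"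
begin

lemma S_slope_floor: "S k = 1 + k + slope_floor k"
  by (induction k) (use slope_floor_step in \<open>auto simp: S_0 S_Suc Q_angle_Suc slope_floor_0\<close>)

text \<open>In a periodic sequence the density of negative terms is rational, while here it is
  \<open>(1 - \<omega>) / (1 + \<omega>) = 1 - 2 * \<gamma>\<close>.\<close>

lemma angle_signs_aperiodic:
  fixes s :: "nat \<Rightarrow> real"
  assumes neg: "\<And>k. Q_angle \<gamma> (Suc k) = 0 \<Longrightarrow> s (S k + 1) < 0"
    and pos: "\<And>k. Q_angle \<gamma> (Suc k) = 1 \<Longrightarrow> 0 < s (S k + 1) \<and> 0 < s (S k + 2)"
    and irrational: "\<gamma> \<notin> \<rat>" and d: "1 \<le> d"
  shows "\<exists>l\<ge>2. sgn (s (l + d)) \<noteq> sgn (s l)"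
proof (rule ccontr)
  assume "\<not> ?thesis"
  then have per: "sgn (s (l + d)) = sgn (s l)" if "2 \<le> l" for l using that by blast
  define N where "N M = (\<Sum>l\<in>{2..M}. if s l < 0 then 1 else 0 :: nat)" for M
  have N_Suc: "N (Suc M) = N M + (if s (Suc M) < 0 then 1 else 0)" if "1 \<le> M" for M
    using that by (simp add: N_def)
  \<comment> \<open>Each gap of length 1 contributes one negative term and each gap of length 2
    none; \<open>slope_floor k\<close> counts the latter.\<close>
  have N_S: "N (S k) + slope_floor k = k" for k
  proof (induction k)
    case 0
    then show ?case by (simp add: N_def S_0 slope_floor_0)
  next
    case (Suc k)
    have S1: "1 \<le> S k" by (simp add: S_slope_floor)
    show ?case
    proof (cases "Q_angle \<gamma> (Suc k) = 0")
      case True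
      then have "s (Suc (S k)) < 0" using neg[of k] by simp
      moreover have "slope_floor (Suc k) = slope_floor k"
        using True slope_floor_step[of k] by (simp add: Q_angle_Suc)
      ultimately show ?thesis using Suc True N_Suc[OF S1] by (simp add: S_Suc)
    next
      case False
      then have Q: "Q_angle \<gamma> (Suc k) = 1" using Q_angle_le[of "Suc k"] by simp
      then have "0 < s (Suc (S k))" "0 < s (Suc (Suc (S k)))" using pos[of k] by simp_all
      moreover have "slope_floor (Suc k) = Suc (slope_floor k)"
        using Q slope_floor_step[of k] by (simp add: Q_angle_Suc)
      ultimately show ?thesis using Suc Q N_Suc[OF S1] N_Suc[of "Suc (S k)"] by (simp add: S_Suc)
    qed
  qed
  define r where "r = N (1 + d)"
  have shift: "N (M + d) = N M + r" if "1 \<le> M" for M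
    using that
  proof (induction M rule: dec_induct)
    case base
    show ?case by (simp add: r_def N_def)
  next
    case (step M)
    have "s (Suc M + d) < 0 \<longleftrightarrow> s (Suc M) < 0" using per[of "Suc M"] step.hyps by (auto simp: sgn_if split: if_splits)
    then show ?case using step N_Suc[of M] N_Suc[of "M + d"] by simp
  qed
  have N_mult: "N (1 + m * d) = m * r" for m
  proof (induction m)
    case 0
    then show ?case by (simp add: N_def)
  next
    case (Suc m)
    have "N (1 + Suc m * d) = N ((1 + m * d) + d)" by (simp add: add_ac)
    also have "\<dots> = N (1 + m * d) + r" by (rule shift) simp
    finally show ?case using Suc by simp
  qed
  have N_mono: "N M \<le> N M'" if "M \<le> M'" for M M'
    unfolding N_def using that by (intro sum_mono2) auto
  \<comment> \<open>\<open>x = 0\<close> says that a period of length \<open>d\<close> with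
    \<open>r\<close> negative terms has the density required by \<omega>. Counting is exact up to
    one period, so \<open>k * x\<close> stays bounded.\<close>
  define x where "x = (1 - \<omega>) * real d - real r * (1 + \<omega>)"
  have bound: "\<bar>real k * x\<bar> \<le> real (2 * r * d + d + 2 * r)" for k
  proof -
    define F where "F = slope_floor k"
    define m where "m = (k + F) div d"
    have m: "m * d \<le> k + F" "k + F < Suc m * d"
      using d by (auto simp: m_def div_times_less_eq_dividend dividend_less_div_times)
    have "m * r \<le> N (S k)" "N (S k) \<le> Suc m * r"
      using N_mult[of m] N_mult[of "Suc m"] N_mono[of "1 + m * d" "S k"] N_mono[of "S k" "1 + Suc m * d"] m
      by (simp_all add: S_slope_floor F_def)
    then have kF: "m * r \<le> k - F" "k - F \<le> Suc m * r" "F \<le> k" using N_S[of k] by (auto simp: F_def)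
    have "(k - F) * d \<le> Suc m * r * d" by (rule mult_le_mono1[OF kF(2)])
    also have "\<dots> = r * (m * d) + r * d" by (simp add: algebra_simps)
    also have "\<dots> \<le> r * (k + F) + r * d" using m(1) by simp
    finally have "real ((k - F) * d) \<le> real (r * (k + F) + r * d)" by (rule of_nat_mono)
    then have u: "(real k - real F) * real d \<le> real r * (real k + real F) + real r * real d"
      using kF(3) by (simp add: of_nat_diff)
    have "r * (k + F) \<le> r * (Suc m * d)" using m(2) by (intro mult_le_mono2) simp
    also have "\<dots> = (m * r) * d + r * d" by (simp add: algebra_simps)
    also have "\<dots> \<le> (k - F) * d + r * d" using kF(1) by (simp add: mult_le_mono1)
    finally have "real (r * (k + F)) \<le> real ((k - F) * d + r * d)" by (rule of_nat_mono)
    then have l: "real r * (real k + real F) \<le> (real k - real F) * real d + real r * real d"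
      using kF(3) by (simp add: of_nat_diff)
    define \<theta> where "\<theta> = real k * \<omega> - real F"
    have "real F = real_of_int \<lfloor>real k * \<omega>\<rfloor>" unfolding F_def slope_floor_int[symmetric] by simp
    then have \<theta>: "0 \<le> \<theta>" "\<theta> < 1" unfolding \<theta>_def by linarith+
    have "real k * x = ((real k - real F) * real d - real r * (real k + real F)) - \<theta> * (real d + real r)"
      by (simp add: x_def \<theta>_def algebra_simps)
    moreover have "0 \<le> \<theta> * (real d + real r)" using \<theta> by simp
    moreover have "\<theta> * (real d + real r) \<le> 1 * (real d + real r)"
      by (rule mult_right_mono) (use \<theta> in auto)
    ultimately show ?thesis using u l by simp
  qed
  have "x = 0"
  proof (rule ccontr)
    assume "x \<noteq> 0"
    then obtain k :: nat where "real (2 * r * d + d + 2 * r) < real k * \<bar>x\<bar>"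
      using reals_Archimedean3[of "\<bar>x\<bar>"] by auto
    with bound[of k] show False by (simp add: abs_mult)
  qed
  have "(1 - \<omega>) * (1 - \<gamma>) = 1 - 2 * \<gamma>" "(1 + \<omega>) * (1 - \<gamma>) = 1"
    using \<gamma> by (auto simp: \<omega>_def field_simps)
  moreover have "x * (1 - \<gamma>) = ((1 - \<omega>) * (1 - \<gamma>)) * real d - real r * ((1 + \<omega>) * (1 - \<gamma>))"
    by (simp add: x_def algebra_simps)
  ultimately have "x * (1 - \<gamma>) = (1 - 2 * \<gamma>) * real d - real r" by simp
  with \<open>x = 0\<close> have "\<gamma> = (real d - real r) / (2 * real d)" using d by (simp add: field_simps)
  also have "\<dots> \<in> \<rat>" by (intro Rats_divide Rats_diff Rats_mult) auto
  finally show False using irrational by blast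
qed

end

text \<open>Up to time about \<open>A * q / 2\<close> the slope \<open>\<omega>\<close> may be replaced by \<open>p / (q - p)\<close>.\<close>

lemma angle_almost_periodic:
  assumes p: "1 \<le> p" and lo: "real p \<le> \<gamma> * real q" and up: "(\<gamma> * real q - real p) * (real A * real q) \<le> 1"
    and N: "1 \<le> N" "2 * (N + 1) \<le> A"
  shows "p < q" "slope_floor (q - p) = p" "Q_angle \<gamma> (q - p) = 1"
    "\<And>k. 1 \<le> k \<Longrightarrow> k \<le> N * q \<Longrightarrow> Q_angle \<gamma> (k + (q - p)) = Q_angle \<gamma> k"
proof -
  have q: "0 < q" using p lo by (cases q) auto
  have "\<gamma> * real q < 1 / 2 * real q" using \<gamma> q by (intro mult_strict_right_mono) auto
  with lo have pq: "2 * p < q" by linarith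
  then show "p < q" by simp
  define r where "r = q - p"
  have r: "0 < r" "p \<le> r" "real r = real q - real p" using pq by (auto simp: r_def)
  have "real p \<le> real r * \<omega>" and ineq: "(real r * \<omega> - real p) * (1 - \<gamma>) = \<gamma> * real q - real p"
  proof -
    have "\<omega> * (1 - \<gamma>) = \<gamma>" using \<gamma> by (simp add: \<omega>_def)
    then have "real r * \<omega> * (1 - \<gamma>) = real r * \<gamma>" by (simp only: mult.assoc)
    then show "(real r * \<omega> - real p) * (1 - \<gamma>) = \<gamma> * real q - real p"
      by (simp add: left_diff_distrib right_diff_distrib r(3) mult.commute)
    with lo have "0 \<le> (real r * \<omega> - real p) * (1 - \<gamma>)" by simp
    then show "real p \<le> real r * \<omega>" using \<gamma> by (simp add: zero_le_mult_iff)
  qed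
  have F: "slope_floor k = k * p div r" if k: "k \<le> (N + 1) * q" for k
  proof -
    define m where "m = k * p div r"
    have m: "m * r \<le> k * p" "k * p + 1 \<le> Suc m * r"
      using r by (auto simp: m_def div_times_less_eq_dividend dividend_less_div_times Suc_le_eq)
    have "real (m * r) \<le> real (k * p)" using m(1) by (rule of_nat_mono)
    then have 1: "real m * real r \<le> real k * real p" by simp
    have "real (k * p + 1) \<le> real (Suc m * r)" using m(2) by (rule of_nat_mono)
    then have 2: "real k * real p + 1 \<le> (real m + 1) * real r" by (simp add: distrib_right)
    \<comment> \<open>An excess below 1 keeps \<open>k * \<omega> * r\<close> below the next
      multiple of \<open>r\<close> after \<open>k * p\<close>, so both slopes have the same floor.
      The bound uses \<open>1 / 2 < 1 - \<gamma>\<close> and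
      \<open>k \<le> A * q / 2\<close>.\<close>
    have "real k * (real r * \<omega> - real p) < 1"
    proof -
      have "real (2 * k) \<le> real (A * q)"
      proof (rule of_nat_mono)
        have "2 * k \<le> 2 * ((N + 1) * q)" using k by simp
        also have "\<dots> = (2 * (N + 1)) * q" by simp
        also have "\<dots> \<le> A * q" by (rule mult_le_mono1[OF N(2)])
        finally show "2 * k \<le> A * q" .
      qed
      then have k2: "real k \<le> real A * real q / 2" by simp
      define z where "z = real r * \<omega> - real p"
      have z: "0 \<le> z" using \<open>real p \<le> real r * \<omega>\<close> by (simp add: z_def)
      have zz: "z * (1 - \<gamma>) * (real A * real q) \<le> 1" using up ineq by (simp add: z_def)
      show ?thesis
      proof (cases "z = 0")
        case False
        with z have "0 < z" by simp
        moreover have Aq: "0 < real A * real q" using N q by simp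
        ultimately have zAq: "0 < z * (real A * real q)" by simp
        have "real k * z \<le> real A * real q / 2 * z" using k2 z by (rule mult_right_mono)
        also have "\<dots> = 1 / 2 * (z * (real A * real q))" by simp
        also have "\<dots> < (1 - \<gamma>) * (z * (real A * real q))" using \<gamma> zAq by (intro mult_strict_right_mono) auto
        also have "\<dots> \<le> 1" using zz by (simp add: mult_ac)
        finally show ?thesis by (simp add: z_def)
      qed (simp add: z_def)
    qed
    then have 3: "real k * \<omega> * real r < real k * real p + 1" by (simp add: algebra_simps)
    have "real k * real p \<le> real k * (real r * \<omega>)" using \<open>real p \<le> real r * \<omega>\<close> by (rule mult_left_mono) simp
    then have "real m * real r \<le> (real k * \<omega>) * real r" using 1 by (simp add: mult_ac)
    then have "real m \<le> real k * \<omega>" using r(1) by simp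
    moreover have "(real k * \<omega>) * real r < (real m + 1) * real r" using 2 3 by linarith
    then have "real k * \<omega> < real m + 1" using r(1) by simp
    ultimately have "\<lfloor>real k * \<omega>\<rfloor> = int m" by (simp add: floor_eq_iff)
    then show ?thesis by (simp add: slope_floor_def m_def)
  qed
  have rq: "r \<le> q" by (simp add: r_def)
  have qN: "q \<le> (N + 1) * q" by simp
  show Fr: "slope_floor (q - p) = p" using F[of r] rq qN r(1) by (simp add: r_def)
  \<comment> \<open>At index \<open>r\<close> the slope \<open>p / r\<close> reaches the integer
    \<open>p\<close>, so the floor jumps exactly there.\<close>
  show "Q_angle \<gamma> (q - p) = 1"
  proof -
    obtain j where j: "r = Suc j" using r(1) by (cases r) auto
    have "slope_floor j = j * p div r" using j rq qN by (intro F) linarith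
    also have "j * p = (r - p) + (p - 1) * r"
    proof -
      obtain p' where p': "p = Suc p'" using p by (cases p) auto
      obtain e where e: "r = p + e" using r(2) le_iff_add by blast
      show ?thesis using j p' e by (simp add: algebra_simps)
    qed
    also have "\<dots> div r = p - 1" using r(1) p by simp
    finally show ?thesis using Fr p unfolding r_def[symmetric] unfolding j Q_angle_Suc by simp
  qed
  fix k assume k: "1 \<le> k" "k \<le> N * q"
  obtain j where j: "k = Suc j" using k(1) by (cases k) auto
  have shift: "slope_floor (l + r) = slope_floor l + p" if "l \<le> N * q" for l
  proof -
    have "l + r \<le> (N + 1) * q" using that rq by simp
    then have "slope_floor (l + r) = (l * p + p * r) div r" by (simp add: F algebra_simps)
    also have "\<dots> = l * p div r + p" using r(1) by simp
    finally show ?thesis using F[of l] that by simp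
  qed
  have "slope_floor (Suc j + r) = slope_floor (Suc j) + p" "slope_floor (j + r) = slope_floor j + p"
    using shift[of "Suc j"] shift[of j] k(2) by (simp_all add: j)
  then show "Q_angle \<gamma> (k + (q - p)) = Q_angle \<gamma> k"
    using slope_floor_step[of j] slope_floor_step[of "j + r"]
    unfolding r_def[symmetric] j add_Suc Q_angle_Suc by simp
qed

end

section \<open>Conjugation and conclusion\<close>

lemma quad_conjugate: "(\<lambda>x. - quad t (- x)) = qmap (- t)"
  by (auto simp: quad_def qmap_def)

lemma quad_funpow: "(quad t ^^ n) x = - (qmap (- t) ^^ n) (- x)"
  by (induction n) (auto simp: quad_def qmap_def)

lemma multiplier_if_not_attracting:
  assumes "\<not> has_attracting_orbit (quad t)" "1 \<le> n" "(qmap (- t) ^^ n) y = y"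
  shows "1 \<le> \<bar>\<Prod>i<n. - 2 * (qmap (- t) ^^ i) y\<bar>"
proof -
  let ?D = "\<Prod>i<n. - 2 * (qmap (- t) ^^ i) y"
  have "((\<lambda>x. - (qmap (- t) ^^ n) (- x)) has_real_derivative - (?D * - 1)) (at (- y))"
    by (rule DERIV_minus[OF DERIV_chain2[where g = uminus]])
      (use qmap_funpow_deriv[of n "- t" y] in \<open>auto intro!: derivative_eq_intros\<close>)
  then have "((quad t ^^ n) has_real_derivative ?D) (at (- y))"
    by (simp add: quad_funpow[abs_def, symmetric] fun_eq_iff)
  then have "deriv (quad t ^^ n) (- y) = ?D" by (rule DERIV_imp_deriv)
  moreover have "(quad t ^^ n) (- y) = - y" using assms(3) by (simp add: quad_funpow)
  ultimately show ?thesis using assms(1,2) unfolding has_attracting_orbit_def by (metis not_le)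
qed

lemma is_acip_conjugate:
  assumes "is_acip (quad t) \<mu>"
  shows "is_acip (qmap (- t)) (distr \<mu> borel uminus)"
proof -
  interpret prob_space \<mu> using assms by (simp add: is_acip_def)
  have s: "sets \<mu> = sets borel" and ac: "absolutely_continuous lborel \<mu>" and inv: "distr \<mu> borel (quad t) = \<mu>"
    using assms by (auto simp: is_acip_def)
  have [measurable]: "quad t \<in> borel_measurable borel" unfolding quad_def by measurable
  have um: "uminus \<in> measurable \<mu> (borel :: real measure)" and qm: "quad t \<in> measurable \<mu> borel"
    by (simp_all add: measurable_cong_sets[OF s refl])
  have "qmap (- t) \<circ> uminus = uminus \<circ> quad t" by (auto simp: qmap_def quad_def)
  then have "distr (distr \<mu> borel uminus) borel (qmap (- t)) = distr \<mu> borel (uminus \<circ> quad t)"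
    using um by (subst distr_distr) auto
  also have "\<dots> = distr (distr \<mu> borel (quad t)) borel uminus"
    using qm by (subst distr_distr) auto
  finally have inv': "distr (distr \<mu> borel uminus) borel (qmap (- t)) = distr \<mu> borel uminus" by (simp add: inv)
  have "N \<in> null_sets (distr \<mu> borel uminus)" if N: "N \<in> null_sets lborel" for N
  proof -
    have "N \<in> null_sets (distr lborel borel uminus)" using N by (simp add: lborel_distr_uminus)
    then have "uminus -` N \<in> null_sets lborel" by (subst (asm) null_sets_distr_iff) auto
    then have "uminus -` N \<in> null_sets \<mu>" using ac by (auto simp only: absolutely_continuous_def)
    then show ?thesis using N um sets_eq_imp_space_eq[OF s]
      by (subst null_sets_distr_iff) (auto simp: null_sets_def)
  qed
  then have "absolutely_continuous lborel (distr \<mu> borel uminus)" by (auto simp: absolutely_continuous_def)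
  with inv' show ?thesis using prob_space_distr[OF um] by (simp add: is_acip_def)
qed

text \<open>After a cutting time the interval runs from \<open>c (S k + 1)\<close> to
  \<open>b > 0\<close>. It contains 0 at once only if its other end is negative. Otherwise it is
  positive, its image must contain 0, and since \<open>qmap b\<close> decreases there, the upper end
  \<open>c (S k + 2)\<close> of the image is positive. The hypothesis \<open>nz\<close> makes the
  signs strict.\<close>

lemma kneading_structure:
  assumes K: "has_kneading_map u v 0 (qmap b) Q" and b: "0 < b"
    and Q: "Q (Suc 0) = 0" "\<And>k. Q k \<le> 1" and nz: "\<And>n. 1 \<le> n \<Longrightarrow> (qmap b ^^ n) 0 \<noteq> 0"
  obtains S where "S 0 = 1" "\<And>k. S (Suc k) = S k + S (Q (Suc k))"
    "\<And>k. Q (Suc k) = 0 \<Longrightarrow> (qmap b ^^ (S k + 1)) 0 < 0"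
    "\<And>k. Q (Suc k) = 1 \<Longrightarrow> 0 < (qmap b ^^ (S k + 1)) 0 \<and> 0 < (qmap b ^^ (S k + 2)) 0"
proof -
  let ?D = "knead_D (qmap b) 0"
  define c where "c n = (qmap b ^^ n) 0" for n
  from K obtain S where S: "strict_mono S" "range S = {n. cutting_time (qmap b) 0 n}"
    and step: "\<forall>k\<ge>1. S k - S (k - 1) = S (Q k)" unfolding has_kneading_map_def by blast
  have cut: "cutting_time (qmap b) 0 n \<longleftrightarrow> n \<in> range S" for n using S(2) by simp
  have S_Suc: "S (Suc k) = S k + S (Q (Suc k))" for k
    using step[rule_format, of "Suc k"] strict_monoD[OF S(1), of k "Suc k"] by simp
  have S1: "1 \<le> S k" for k using cut[of "S k"] by (simp add: cutting_time_def)
  have S_0: "S 0 = 1"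
  proof -
    have "cutting_time (qmap b) 0 (Suc 0)" by (simp add: cutting_time_def)
    then obtain j where "S j = Suc 0" using cut by (metis imageE)
    moreover have "S 0 \<le> S j" using S(1) by (simp add: strict_mono_less_eq)
    ultimately show ?thesis using S1[of 0] by simp
  qed
  have S_1: "S (Suc 0) = 2" using S_Suc[of 0] Q(1) S_0 by simp
  have c1: "c 1 = b" "qmap b 0 = b" by (simp_all add: c_def qmap_def)
  have inS: "0 \<in> ?D (S k)" for k using cut[of "S k"] by (simp add: cutting_time_def)
  have next_D: "?D (Suc (S k)) = closed_segment (c (Suc (S k))) b" for k
  proof -
    obtain m where "S k = Suc m" using S1[of k] by (cases "S k") auto
    with inS[of k] show ?thesis by (simp add: c_def c1)
  qed
  have neg: "c (S k + 1) < 0" if "Q (Suc k) = 0" for k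
  proof -
    have "S (Suc k) = Suc (S k)" using S_Suc[of k] that S_0 by simp
    then have "0 \<in> closed_segment (c (Suc (S k))) b" using inS[of "Suc k"] next_D by metis
    then have "c (S k + 1) \<le> 0" using b by (auto simp: closed_segment_real)
    then show ?thesis using nz[of "S k + 1"] unfolding c_def by linarith
  qed
  have pos: "0 < c (S k + 1) \<and> 0 < c (S k + 2)" if "Q (Suc k) = 1" for k
  proof -
    have Sk: "S (Suc k) = Suc (Suc (S k))" using S_Suc[of k] that S_1 by simp
    have "Suc (S k) \<notin> range S"
    proof
      assume "Suc (S k) \<in> range S"
      then obtain j where j: "S j = Suc (S k)" by (metis imageE)
      then have "k < j" "j < Suc k" using strict_mono_less[OF S(1)] Sk by (metis lessI)+
      then show False by simp
    qed
    then have no: "0 \<notin> ?D (Suc (S k))" using cut[of "Suc (S k)"] by (simp add: cutting_time_def del: knead_D.simps)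
    then have p1: "0 < c (Suc (S k))" unfolding next_D using b by (auto simp: closed_segment_real)
    have "?D (Suc (Suc (S k))) = qmap b ` ?D (Suc (S k))"
    proof -
      obtain m where "S k = Suc m" using S1[of k] by (cases "S k") auto
      with no show ?thesis by simp
    qed
    then have "0 \<in> qmap b ` closed_segment (c (Suc (S k))) b" using inS[of "Suc k"] unfolding Sk next_D by simp
    then obtain y where y: "y \<in> closed_segment (c (Suc (S k))) b" "qmap b y = 0" by (metis imageE)
    show ?thesis
    proof (rule conjI)
      show "0 < c (S k + 1)" using p1 by simp
      have c2: "c (Suc (Suc (S k))) = qmap b (c (Suc (S k)))" by (simp add: c_def)
      have c_le: "c (Suc (S k)) \<le> b" by (simp add: c_def qmap_def)
      then have "c (Suc (S k)) \<le> y" using y(1) by (auto simp: closed_segment_real)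
      then have "(c (Suc (S k)))\<^sup>2 \<le> y\<^sup>2" using p1 by (intro power_mono) auto
      then have "0 \<le> c (Suc (Suc (S k)))" using y(2) unfolding c2 by (simp add: qmap_def)
      moreover have "c (Suc (Suc (S k))) \<noteq> 0" unfolding c_def by (rule nz) simp
      ultimately show "0 < c (S k + 2)" by (simp only: add_2_eq_Suc')
    qed
  qed
  from that[OF S_0 S_Suc neg[unfolded c_def] pos[unfolded c_def]] show thesis by blast
qed

theorem corollary5p8:
  fixes \<gamma> t :: real and a :: "nat \<Rightarrow> nat"
  assumes "0 < \<gamma>" and "\<gamma> < 1 / 2" and "\<gamma> \<notin> \<rat>"
    and "has_cf_expansion \<gamma> a"
    and "quadratic_representative \<gamma> t"
    and "\<not> has_attracting_orbit (quad t)" and "\<not> has_parabolic_orbit (quad t)"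
    and "filterlim
           (\<lambda>N. \<Sum>n = 1..N. real (a (2 * n + 1)) * (real (cf_q a (2 * n)) - real (cf_p a (2 * n)))
                  * Lambda_rec powi (- int (cf_q a (2 * n))))
           at_top sequentially"
  shows "\<not> (\<exists>\<mu>. is_acip (quad t) \<mu>)"
proof
  assume "\<exists>\<mu>. is_acip (quad t) \<mu>"
  then obtain \<mu>0 where "is_acip (quad t) \<mu>0" by blast
  define b where "b = - t"
  define \<mu> where "\<mu> = distr \<mu>0 borel uminus"
  have acip: "is_acip (qmap b) \<mu>"
    unfolding b_def \<mu>_def using \<open>is_acip (quad t) \<mu>0\<close> by (rule is_acip_conjugate)
  note mult = multiplier_if_not_attracting[OF assms(6), folded b_def]
  \<comment> \<open>A periodic turning point would have multiplier 0.\<close>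
  have nz: "(qmap b ^^ n) 0 \<noteq> 0" if n: "1 \<le> n" for n
  proof
    assume 0: "(qmap b ^^ n) 0 = 0"
    have zero: "(\<Prod>i<n. - 2 * (qmap b ^^ i) 0) = 0"
      using n by (intro prod_zero) (auto intro!: bexI[of _ 0])
    from mult[OF n 0] show False unfolding zero by simp
  qed
  have K: "has_kneading_map (- quad_beta t) (quad_beta t) 0 (qmap b) (Q_angle \<gamma>)"
    using assms(5) by (simp add: quadratic_representative_def quad_has_kneading_map_def quad_conjugate b_def)
  have "(qmap b ^^ 2) 0 < 0" "0 < qmap b 0" "(qmap b ^^ 2) 0 < (qmap b ^^ 3) 0"
    using K by (auto simp: has_kneading_map_def unimodal_map_def)
  then have b: "b - b\<^sup>2 < 0" "0 < b" "(b - b\<^sup>2)\<^sup>2 < b\<^sup>2"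
    by (auto simp: qmap_def numeral_2_eq_2 numeral_3_eq_3)
  have b1: "1 < b" using b(1,2) by (simp add: power2_eq_square)
  have "\<bar>b - b\<^sup>2\<bar> < \<bar>b\<bar>" using b(3) abs_le_square_iff[of b "b - b\<^sup>2"] by linarith
  then have b2: "b < 2" using b by (simp add: power2_eq_square abs_if split: if_splits)
  define \<omega> where "\<omega> = \<gamma> / (1 - \<gamma>)"
  note ang = assms(1,2) \<omega>_def
  have Q1: "Q_angle \<gamma> (Suc 0) = 0"
    using Q_angle_Suc[OF ang, of 0] slope_floor_0[OF ang] by simp
  from kneading_structure[OF K b(2) Q1 Q_angle_le[OF ang] nz] obtain S where
    S: "S 0 = 1" "\<And>k. S (Suc k) = S k + S (Q_angle \<gamma> (Suc k))"
    and neg: "\<And>k. Q_angle \<gamma> (Suc k) = 0 \<Longrightarrow> (qmap b ^^ (S k + 1)) 0 < 0"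
    and pos: "\<And>k. Q_angle \<gamma> (Suc k) = 1 \<Longrightarrow> 0 < (qmap b ^^ (S k + 1)) 0 \<and> 0 < (qmap b ^^ (S k + 2)) 0"
    by metis
  have S1: "S (Suc 0) = 2" using S(1) S(2)[of 0] Q1 by simp
  have SQ: "S (Q_angle \<gamma> k) = Suc (Q_angle \<gamma> k)" for k
    using Q_angle_le[OF ang, of k] S(1) S1 by (cases "Q_angle \<gamma> k = 0") (auto simp: le_Suc_eq)
  have S_step: "S (Suc k) = S k + Suc (Q_angle \<gamma> (Suc k))" for k using S(2)[of k] SQ by simp
  interpret bounded_kneading b S "Q_angle \<gamma>"
  proof unfold_locales
    show "\<exists>l\<ge>2. sgn ((qmap b ^^ (l + d)) 0) \<noteq> sgn ((qmap b ^^ l) 0)" if "1 \<le> d" for d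
      using angle_signs_aperiodic[OF ang S(1) S_step neg pos assms(3) that] by blast
  qed (use b1 b2 S Q1 Q_angle_le[OF ang] neg pos in auto)
  interpret prob_space \<mu> using acip by (simp add: is_acip_def)
  interpret bounded_kneading_acip b S "Q_angle \<gamma>" \<mu>
    by unfold_locales (use acip in \<open>auto simp: is_acip_def\<close>)
  from acip_lower_bound obtain \<kappa> where \<kappa>: "0 < \<kappa>"
    "\<And>\<epsilon>. 0 < \<epsilon> \<Longrightarrow> \<epsilon> \<le> \<delta> \<Longrightarrow> \<kappa> * \<epsilon> \<le> measure \<mu> {-\<epsilon><..<\<epsilon>}" by blast
  have digits: "\<And>n. 1 \<le> n \<Longrightarrow> 1 \<le> a n" and lim: "(\<lambda>n. cf_value (map a [1..<Suc n])) \<longlonglongrightarrow> \<gamma>"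
    using assms(4) by (auto simp: has_cf_expansion_def)
  \<comment> \<open>The 6 ensures \<open>N \<ge> 1\<close> and \<open>A \<le> 4 * N\<close>; the
    other entry is what contradicts \<open>A * \<kappa> * \<epsilon> \<le> 4\<close> at the
    end.\<close>
  define C where "C = max 6 (16 / (3 * \<kappa> * \<delta>))"
  obtain n where n: "1 \<le> n" "C * 4 ^ cf_q a (2 * n) < real (a (2 * n + 1))"
    using large_digit[OF digits assms(8)] by blast
  define p q A where "p = cf_p a (2 * n)" and "q = cf_q a (2 * n)" and "A = a (2 * n + 1)"
  have CA: "C * 4 ^ q < real A" using n(2) by (simp add: q_def A_def)
  have "C * 1 \<le> C * 4 ^ q" by (intro mult_left_mono) (auto simp: C_def)
  then have "6 < real A" using CA by (simp add: C_def)
  then have A6: "6 < A" by simp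
  \<comment> \<open>The largest number of periods permitted by
    \<open>2 * (N + 1) \<le> A\<close>.\<close>
  define N where "N = A div 2 - 1"
  have N: "1 \<le> N" "2 * (N + 1) \<le> A" "real A \<le> 4 * real N" using A6 by (auto simp: N_def)
  have p1: "1 \<le> p"
  proof -
    obtain m where "2 * n = Suc m" using n(1) by (cases "2 * n") auto
    moreover have "0 < cf_p a (Suc m)" using digits by (rule cf_p_pos)
    ultimately show ?thesis by (simp add: p_def)
  qed
  have conv: "real p \<le> \<gamma> * real q" "(\<gamma> * real q - real p) * (real A * real q) \<le> 1"
    using even_convergent[OF digits lim n(1)] by (auto simp: p_def q_def A_def)
  note ap = angle_almost_periodic[OF ang p1 conv N(1,2)]
  have r: "1 \<le> q - p" "S (q - p) = Suc q"
    using ap(1,2) S_slope_floor[OF ang S(1) S_step, of "q - p"] by auto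
  note sg = sgn_periodic[OF r ap(3) ap(4)]
  have q1: "1 \<le> q" using ap(1) by simp
  have cq: "0 < c q" using sg(1) by blast
  have per: "\<forall>i\<in>{1..N * q}. sgn (c (i + q)) = sgn (c i)"
  proof
    fix i assume i: "i \<in> {1..N * q}"
    then have "i \<le> S (N * q)" using S_ge[of "N * q"] by auto
    then show "sgn (c (i + q)) = sgn (c i)" using sg(2)[of "N * q" i] i by auto
  qed
  have "3 / 4 / 4 ^ q < \<bar>c q\<bar>" by (rule return_lower_bound[OF mult q1])
  then have cq_lower: "3 / 4 / 4 ^ q < c q" using cq by simp
  \<comment> \<open>The factor \<open>\<delta> < 1\<close> brings the lower bound for
    \<open>c q\<close> below both \<delta> and \<open>c q\<close>.\<close>
  define \<epsilon> where "\<epsilon> = \<delta> * (3 / 4 / 4 ^ q)"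
  have "1 \<le> (4 :: real) ^ q" by (rule one_le_power) simp
  then have "3 \<le> 4 * (4 :: real) ^ q" by linarith
  then have pw: "3 / 4 / (4 :: real) ^ q \<le> 1" by (simp add: divide_le_eq)
  have \<epsilon>: "0 < \<epsilon>" "\<epsilon> \<le> \<delta>" "\<epsilon> \<le> c q"
    using \<delta> pw cq_lower mult_right_mono[of \<delta> 1 "3 / 4 / 4 ^ q"] mult_left_mono[OF pw, of \<delta>]
    by (auto simp: \<epsilon>_def)
  have "\<kappa> * \<epsilon> \<le> measure \<mu> {-\<epsilon><..<\<epsilon>}" by (rule \<kappa>(2)[OF \<epsilon>(1,2)])
  also have "\<dots> \<le> measure \<mu> {- c q<..<c q}" using \<epsilon> by (intro finite_measure_mono) (auto simp: sets_\<mu>)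
  finally have "real N * (\<kappa> * \<epsilon>) \<le> real N * measure \<mu> {- c q<..<c q}" by (rule mult_left_mono) simp
  then have N1: "real N * (\<kappa> * \<epsilon>) \<le> 1" using recurrence_measure[OF q1 cq per] by linarith
  have "real A * (\<kappa> * \<epsilon>) \<le> 4 * real N * (\<kappa> * \<epsilon>)"
    using N(3) \<kappa> \<epsilon> by (intro mult_right_mono) auto
  then have "real A * (\<kappa> * \<epsilon>) \<le> 4" using N1 by linarith
  moreover have "4 < real A * (\<kappa> * \<epsilon>)"
  proof -
    have "16 / (3 * \<kappa> * \<delta>) * 4 ^ q \<le> C * 4 ^ q" by (intro mult_right_mono) (auto simp: C_def)
    then have "16 / (3 * \<kappa> * \<delta>) * 4 ^ q < real A" using CA by linarith
    then have "16 / (3 * \<kappa> * \<delta>) * 4 ^ q * (\<kappa> * \<epsilon>) < real A * (\<kappa> * \<epsilon>)"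
      using \<kappa> \<epsilon> by (intro mult_strict_right_mono) auto
    moreover have "16 / (3 * \<kappa> * \<delta>) * 4 ^ q * (\<kappa> * \<epsilon>) = 4"
      using \<kappa> \<delta>(1) by (simp add: \<epsilon>_def field_simps)
    ultimately show ?thesis by simp
  qed
  ultimately show False by linarith
qed

end
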